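(* Let $k,l$ be coprime positive integers. The principal $\mathcal{O}(U(1))$-comodule algebra $\mathcal{A}_{k,l}$ (with coaction $\rho_{k,l}$) is not cleft.
   Context: Fix real numbers $0<p,q,\theta<1$ with $\theta$ irrational. $\mathcal{O}(S^3_{pq\theta})$ is the unital complex $*$-algebra generated by $a,b$ subject to $$ab=e^{2\pi i\theta}ba,\quad ab^*=e^{-2\pi i\theta}b^*a,\quad a^*a-paa^*=1-p,\quad b^*b-qbb^*=1-q,\quad (1-aa^* )(1-bb^* )=0.$$ Put $A=1-aa^*$, $B=1-bb^*$. $\mathcal{O}(U(1))=\mathbb{C}[u,u^*]$ with $uu^*=u^*u=1$ is the Hopf $*$-algebra with $\Delta(u)=u\otimes u$, $\epsilon(u)=1$, $S(u)=u^*$; $\mathcal{O}(\mathbb{Z}_m)$ is its quotient by $u^m=1$. $\mathcal{A}_{k,l}$ is the coinvariant subalgebra of $\mathcal{O}(S^3_{pq\theta})$ under the $\mathcal{O}(\mathbb{Z}_{kl})$-coaction given by the $*$-algebra map $a\mapsto a\otimes u^k$, $b\mapsto b\otimes u^l$; it is the $*$-subalgebra generated by $x=a^l$, $y=b^k$, $z=A$, $w=B$. The coaction is the $*$-algebra map $\rho_{k,l}:\mathcal{A}_{k,l}\to\mathcal{A}_{k,l}\otimes\mathcal{O}(U(1))$, $x\mapsto x\otimes u$, $y\mapsto y\otimes u$, $z\mapsto z\otimes1$, $w\mapsto w\otimes1$. For a Hopf algebra $\mathcal{H}$, a right $\mathcal{H}$-comodule algebra $\mathcal{A}$ is called cleft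 if there is a convolution invertible right $\mathcal{H}$-comodule map $j:\mathcal{H}\to\mathcal{A}$ (with $\mathcal{H}$ a comodule via its coproduct). *)

theory Defs
  imports Complex_Main "HOL-Algebra.Module" "HOL-Library.FuncSet"
begin

section \<open>Complex unital *-algebras\<close>

record 'a star_algebra = "(complex, 'a) module" +
  star :: "'a \<Rightarrow> 'a"

definition complex_alg :: "complex star_algebra" where
  "complex_alg = \<lparr>carrier = UNIV, monoid.mult = (*), one = 1, zero = 0, add = (+),
                  smult = (*), star = cnj\<rparr>"

locale star_algebra = ring A for A :: "('a, 'm) star_algebra_scheme" (structure) +
  assumes module_complex: "module complex_alg A"
    and smult_mult_left: "x \<in> carrier A \<Longrightarrow> y \<in> carrier A \<Longrightarrow> (c \<odot> x) \<otimes> y = c \<odot> (x \<otimes> y)"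
    and smult_mult_right: "x \<in> carrier A \<Longrightarrow> y \<in> carrier A \<Longrightarrow> x \<otimes> (c \<odot> y) = c \<odot> (x \<otimes> y)"
    and star_closed [simp, intro]: "x \<in> carrier A \<Longrightarrow> star A x \<in> carrier A"
    and star_star [simp]: "x \<in> carrier A \<Longrightarrow> star A (star A x) = x"
    and star_add: "x \<in> carrier A \<Longrightarrow> y \<in> carrier A \<Longrightarrow> star A (x \<oplus> y) = star A x \<oplus> star A y"
    and star_mult: "x \<in> carrier A \<Longrightarrow> y \<in> carrier A \<Longrightarrow> star A (x \<otimes> y) = star A y \<otimes> star A x"
    and star_smult: "x \<in> carrier A \<Longrightarrow> star A (c \<odot> x) = cnj c \<odot> star A x"

definition star_alg_hom ::
    "('a, 'm) star_algebra_scheme \<Rightarrow> ('b, 'n) star_algebra_scheme \<Rightarrow> ('a \<Rightarrow> 'b) set" where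
  "star_alg_hom A B = {f \<in> ring_hom A B.
     (\<forall>c. \<forall>x\<in>carrier A. f (c \<odot>\<^bsub>A\<^esub> x) = c \<odot>\<^bsub>B\<^esub> f x) \<and>
     (\<forall>x\<in>carrier A. f (star A x) = star B (f x))}"

definition linear_maps ::
    "('a, 'm) star_algebra_scheme \<Rightarrow> ('b, 'n) star_algebra_scheme \<Rightarrow> ('a \<Rightarrow> 'b) set" where
  "linear_maps A B = {f \<in> carrier A \<rightarrow> carrier B.
     (\<forall>x\<in>carrier A. \<forall>y\<in>carrier A. f (x \<oplus>\<^bsub>A\<^esub> y) = f x \<oplus>\<^bsub>B\<^esub> f y) \<and>
     (\<forall>c. \<forall>x\<in>carrier A. f (c \<odot>\<^bsub>A\<^esub> x) = c \<odot>\<^bsub>B\<^esub> f x)}"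

definition rep :: "'a set \<Rightarrow> 'a" where
  "rep X = (SOME x. x \<in> X)"

section \<open>*-algebras given by generators and relations\<close>

datatype 'g sterm =
    Gen 'g | Zero | One | Add "'g sterm" "'g sterm" | Mult "'g sterm" "'g sterm"
  | Scal complex "'g sterm" | Star "'g sterm"

text \<open>The least congruence that contains the relations \<open>R\<close> and makes the terms a unital
  complex *-algebra. Additive inverses are the multiples by \<open>-1\<close>.\<close>

inductive pres_eq :: "('g sterm \<times> 'g sterm) set \<Rightarrow> 'g sterm \<Rightarrow> 'g sterm \<Rightarrow> bool"
  for R :: "('g sterm \<times> 'g sterm) set" where
  rel: "(s, t) \<in> R \<Longrightarrow> pres_eq R s t"
| refl: "pres_eq R t t"
| sym: "pres_eq R s t \<Longrightarrow> pres_eq R t s"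
| trans: "pres_eq R s t \<Longrightarrow> pres_eq R t u \<Longrightarrow> pres_eq R s u"
| cong_add: "pres_eq R s s' \<Longrightarrow> pres_eq R t t' \<Longrightarrow> pres_eq R (Add s t) (Add s' t')"
| cong_mult: "pres_eq R s s' \<Longrightarrow> pres_eq R t t' \<Longrightarrow> pres_eq R (Mult s t) (Mult s' t')"
| cong_scal: "pres_eq R s s' \<Longrightarrow> pres_eq R (Scal c s) (Scal c s')"
| cong_star: "pres_eq R s s' \<Longrightarrow> pres_eq R (Star s) (Star s')"
| add_assoc: "pres_eq R (Add (Add s t) u) (Add s (Add t u))"
| add_comm: "pres_eq R (Add s t) (Add t s)"
| add_zero: "pres_eq R (Add Zero t) t"
| scal_zero: "pres_eq R (Scal 0 t) Zero"
| scal_one: "pres_eq R (Scal 1 t) t"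
| scal_scal: "pres_eq R (Scal (c * d) t) (Scal c (Scal d t))"
| scal_add_left: "pres_eq R (Scal (c + d) t) (Add (Scal c t) (Scal d t))"
| scal_add_right: "pres_eq R (Scal c (Add s t)) (Add (Scal c s) (Scal c t))"
| mult_assoc: "pres_eq R (Mult (Mult s t) u) (Mult s (Mult t u))"
| mult_one_left: "pres_eq R (Mult One t) t"
| mult_one_right: "pres_eq R (Mult t One) t"
| mult_add_left: "pres_eq R (Mult (Add s t) u) (Add (Mult s u) (Mult t u))"
| mult_add_right: "pres_eq R (Mult s (Add t u)) (Add (Mult s t) (Mult s u))"
| scal_mult_left: "pres_eq R (Mult (Scal c s) t) (Scal c (Mult s t))"
| scal_mult_right: "pres_eq R (Mult s (Scal c t)) (Scal c (Mult s t))"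
| star_star: "pres_eq R (Star (Star t)) t"
| star_add: "pres_eq R (Star (Add s t)) (Add (Star s) (Star t))"
| star_mult: "pres_eq R (Star (Mult s t)) (Mult (Star t) (Star s))"
| star_scal: "pres_eq R (Star (Scal c t)) (Scal (cnj c) (Star t))"

definition pres_class :: "('g sterm \<times> 'g sterm) set \<Rightarrow> 'g sterm \<Rightarrow> 'g sterm set" where
  "pres_class R t = {s. pres_eq R t s}"

definition presented :: "('g sterm \<times> 'g sterm) set \<Rightarrow> 'g sterm set star_algebra" where
  "presented R = \<lparr>carrier = range (pres_class R),
     monoid.mult = (\<lambda>X Y. pres_class R (Mult (rep X) (rep Y))),
     one = pres_class R One, zero = pres_class R Zero,
     add = (\<lambda>X Y. pres_class R (Add (rep X) (rep Y))),
     smult = (\<lambda>c X. pres_class R (Scal c (rep X))),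
     star = (\<lambda>X. pres_class R (Star (rep X)))\<rparr>"

primrec eval_term :: "('a, 'm) star_algebra_scheme \<Rightarrow> ('g \<Rightarrow> 'a) \<Rightarrow> 'g sterm \<Rightarrow> 'a" where
  "eval_term A \<phi> (Gen g) = \<phi> g"
| "eval_term A \<phi> Zero = \<zero>\<^bsub>A\<^esub>"
| "eval_term A \<phi> One = \<one>\<^bsub>A\<^esub>"
| "eval_term A \<phi> (Add s t) = eval_term A \<phi> s \<oplus>\<^bsub>A\<^esub> eval_term A \<phi> t"
| "eval_term A \<phi> (Mult s t) = eval_term A \<phi> s \<otimes>\<^bsub>A\<^esub> eval_term A \<phi> t"
| "eval_term A \<phi> (Scal c t) = c \<odot>\<^bsub>A\<^esub> eval_term A \<phi> t"
| "eval_term A \<phi> (Star t) = star A (eval_term A \<phi> t)"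

text \<open>The *-algebra map from \<open>presented R\<close> to \<open>A\<close> that sends each generator \<open>g\<close> to \<open>\<phi> g\<close>;
  see \<open>pres_hom\<close> below for when it is well defined.\<close>

definition pres_map ::
    "('a, 'm) star_algebra_scheme \<Rightarrow> ('g \<Rightarrow> 'a) \<Rightarrow> 'g sterm set \<Rightarrow> 'a" where
  "pres_map A \<phi> X = eval_term A \<phi> (rep X)"

section \<open>Tensor products over the complex numbers\<close>

text \<open>A list \<open>[(v1, w1), \<dots>, (vn, wn)]\<close> stands for the tensor
  \<open>v1 \<otimes> w1 + \<dots> + vn \<otimes> wn\<close>.\<close>

inductive tensor_eq ::
    "('a, 'm) star_algebra_scheme \<Rightarrow> ('b, 'n) star_algebra_scheme
      \<Rightarrow> ('a \<times> 'b) list \<Rightarrow> ('a \<times> 'b) list \<Rightarrow> bool"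
  for A :: "('a, 'm) star_algebra_scheme" and B :: "('b, 'n) star_algebra_scheme" where
  refl: "set xs \<subseteq> carrier A \<times> carrier B \<Longrightarrow> tensor_eq A B xs xs"
| sym: "tensor_eq A B xs ys \<Longrightarrow> tensor_eq A B ys xs"
| trans: "tensor_eq A B xs ys \<Longrightarrow> tensor_eq A B ys zs \<Longrightarrow> tensor_eq A B xs zs"
| append: "tensor_eq A B xs xs' \<Longrightarrow> tensor_eq A B ys ys' \<Longrightarrow> tensor_eq A B (xs @ ys) (xs' @ ys')"
| comm: "set xs \<subseteq> carrier A \<times> carrier B \<Longrightarrow> set ys \<subseteq> carrier A \<times> carrier B \<Longrightarrow>
    tensor_eq A B (xs @ ys) (ys @ xs)"
| zero: "w \<in> carrier B \<Longrightarrow> tensor_eq A B [(\<zero>\<^bsub>A\<^esub>, w)] []"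
| add_left: "v \<in> carrier A \<Longrightarrow> v' \<in> carrier A \<Longrightarrow> w \<in> carrier B \<Longrightarrow>
    tensor_eq A B [(v \<oplus>\<^bsub>A\<^esub> v', w)] [(v, w), (v', w)]"
| add_right: "v \<in> carrier A \<Longrightarrow> w \<in> carrier B \<Longrightarrow> w' \<in> carrier B \<Longrightarrow>
    tensor_eq A B [(v, w \<oplus>\<^bsub>B\<^esub> w')] [(v, w), (v, w')]"
| scal: "v \<in> carrier A \<Longrightarrow> w \<in> carrier B \<Longrightarrow>
    tensor_eq A B [(c \<odot>\<^bsub>A\<^esub> v, w)] [(v, c \<odot>\<^bsub>B\<^esub> w)]"

definition tensor_class ::
    "('a, 'm) star_algebra_scheme \<Rightarrow> ('b, 'n) star_algebra_scheme
      \<Rightarrow> ('a \<times> 'b) list \<Rightarrow> ('a \<times> 'b) list set" where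
  "tensor_class A B xs = {ys. tensor_eq A B xs ys}"

definition tensor_elem ::
    "('a, 'm) star_algebra_scheme \<Rightarrow> ('b, 'n) star_algebra_scheme
      \<Rightarrow> 'a \<Rightarrow> 'b \<Rightarrow> ('a \<times> 'b) list set" where
  "tensor_elem A B v w = tensor_class A B [(v, w)]"

definition tensor_list_mult ::
    "('a, 'm) star_algebra_scheme \<Rightarrow> ('b, 'n) star_algebra_scheme
      \<Rightarrow> ('a \<times> 'b) list \<Rightarrow> ('a \<times> 'b) list \<Rightarrow> ('a \<times> 'b) list" where
  "tensor_list_mult A B xs ys =
     concat (map (\<lambda>(v, w). map (\<lambda>(v', w'). (v \<otimes>\<^bsub>A\<^esub> v', w \<otimes>\<^bsub>B\<^esub> w')) ys) xs)"

definition tensor ::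
    "('a, 'm) star_algebra_scheme \<Rightarrow> ('b, 'n) star_algebra_scheme
      \<Rightarrow> ('a \<times> 'b) list set star_algebra" where
  "tensor A B = \<lparr>carrier = tensor_class A B ` {xs. set xs \<subseteq> carrier A \<times> carrier B},
     monoid.mult = (\<lambda>X Y. tensor_class A B (tensor_list_mult A B (rep X) (rep Y))),
     one = tensor_elem A B \<one>\<^bsub>A\<^esub> \<one>\<^bsub>B\<^esub>, zero = tensor_class A B [],
     add = (\<lambda>X Y. tensor_class A B (rep X @ rep Y)),
     smult = (\<lambda>c X. tensor_class A B (map (\<lambda>(v, w). (c \<odot>\<^bsub>A\<^esub> v, w)) (rep X))),
     star = (\<lambda>X. tensor_class A B (map (\<lambda>(v, w). (star A v, star B w)) (rep X)))\<rparr>"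

text \<open>The map \<open>f \<otimes> g\<close> into \<open>C \<otimes> D\<close>, for linear \<open>f\<close> and \<open>g\<close>.\<close>

definition tensor_map ::
    "('c, 'm) star_algebra_scheme \<Rightarrow> ('d, 'n) star_algebra_scheme
      \<Rightarrow> ('a \<Rightarrow> 'c) \<Rightarrow> ('b \<Rightarrow> 'd) \<Rightarrow> ('a \<times> 'b) list set \<Rightarrow> ('c \<times> 'd) list set" where
  "tensor_map C D f g X = tensor_class C D (map (\<lambda>(v, w). (f v, g w)) (rep X))"

definition list_sum :: "('a, 'm) ring_scheme \<Rightarrow> 'a list \<Rightarrow> 'a" where
  "list_sum A xs = foldr (\<lambda>x s. x \<oplus>\<^bsub>A\<^esub> s) xs \<zero>\<^bsub>A\<^esub>"

text \<open>The multiplication of \<open>A\<close> as a map \<open>A \<otimes> A \<rightarrow> A\<close>.\<close>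

definition mult_map :: "('a, 'm) star_algebra_scheme \<Rightarrow> ('a \<times> 'a) list set \<Rightarrow> 'a" where
  "mult_map A X = list_sum A (map (\<lambda>(v, w). v \<otimes>\<^bsub>A\<^esub> w) (rep X))"

section \<open>Cleft comodule algebras\<close>

record 'h hopf =
  alg :: "'h star_algebra"
  comult :: "'h \<Rightarrow> ('h \<times> 'h) list set"
  counit :: "'h \<Rightarrow> complex"
  antipode :: "'h \<Rightarrow> 'h"

definition convolution ::
    "'h hopf \<Rightarrow> ('a, 'm) star_algebra_scheme \<Rightarrow> ('h \<Rightarrow> 'a) \<Rightarrow> ('h \<Rightarrow> 'a) \<Rightarrow> 'h \<Rightarrow> 'a" where
  "convolution H A f g h = mult_map A (tensor_map A A f g (comult H h))"

definition convolution_invertible ::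
    "'h hopf \<Rightarrow> ('a, 'm) star_algebra_scheme \<Rightarrow> ('h \<Rightarrow> 'a) \<Rightarrow> bool" where
  "convolution_invertible H A f \<longleftrightarrow> (\<exists>g \<in> linear_maps (alg H) A. \<forall>h\<in>carrier (alg H).
     convolution H A f g h = counit H h \<odot>\<^bsub>A\<^esub> \<one>\<^bsub>A\<^esub> \<and>
     convolution H A g f h = counit H h \<odot>\<^bsub>A\<^esub> \<one>\<^bsub>A\<^esub>)"

text \<open>Right \<open>H\<close>-comodule maps from \<open>H\<close>, with its coproduct as coaction, to \<open>A\<close> with the
  coaction \<open>\<delta>\<close>.\<close>

definition comodule_maps ::
    "'h hopf \<Rightarrow> ('a, 'm) star_algebra_scheme \<Rightarrow> ('a \<Rightarrow> ('a \<times> 'h) list set) \<Rightarrow> ('h \<Rightarrow> 'a) set"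
  where
  "comodule_maps H A \<delta> = {j \<in> linear_maps (alg H) A. \<forall>h\<in>carrier (alg H).
     \<delta> (j h) = tensor_map A (alg H) j id (comult H h)}"

definition cleft ::
    "'h hopf \<Rightarrow> ('a, 'm) star_algebra_scheme \<Rightarrow> ('a \<Rightarrow> ('a \<times> 'h) list set) \<Rightarrow> bool" where
  "cleft H A \<delta> \<longleftrightarrow> (\<exists>j \<in> comodule_maps H A \<delta>. convolution_invertible H A j)"

section \<open>The Hopf *-algebra of the circle and its cyclic quotients\<close>

datatype u_gen = U

abbreviation term_pow :: "'g sterm \<Rightarrow> nat \<Rightarrow> 'g sterm" where
  "term_pow t n \<equiv> (Mult t ^^ n) One"

definition circle_rels :: "(u_gen sterm \<times> u_gen sterm) set" where
  "circle_rels = {(Mult (Gen U) (Star (Gen U)), One), (Mult (Star (Gen U)) (Gen U), One)}"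

definition cyclic_rels :: "nat \<Rightarrow> (u_gen sterm \<times> u_gen sterm) set" where
  "cyclic_rels m = insert (term_pow (Gen U) m, One) circle_rels"

definition circle_u :: "u_gen sterm set" where
  "circle_u = pres_class circle_rels (Gen U)"

definition circle_alg :: "u_gen sterm set star_algebra" where
  "circle_alg = presented circle_rels"

definition circle_hopf :: "u_gen sterm set hopf" where
  "circle_hopf = \<lparr>alg = circle_alg,
     comult = pres_map (tensor circle_alg circle_alg)
                (\<lambda>_. tensor_elem circle_alg circle_alg circle_u circle_u),
     counit = pres_map complex_alg (\<lambda>_. 1),
     antipode = pres_map circle_alg (\<lambda>_. star circle_alg circle_u)\<rparr>"

definition cyclic_alg :: "nat \<Rightarrow> u_gen sterm set star_algebra" where
  "cyclic_alg m = presented (cyclic_rels m)"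

definition cyclic_u :: "nat \<Rightarrow> u_gen sterm set" where
  "cyclic_u m = pres_class (cyclic_rels m) (Gen U)"

section \<open>The quantum sphere and the algebras of coinvariants\<close>

datatype s3_gen = Ga | Gb

definition s3_rels :: "real \<Rightarrow> real \<Rightarrow> real \<Rightarrow> (s3_gen sterm \<times> s3_gen sterm) set" where
  "s3_rels p q \<theta> =
    (let a = Gen Ga; b = Gen Gb; e = exp (2 * pi * \<i> * \<theta>); e' = exp (- 2 * pi * \<i> * \<theta>);
         minus = (\<lambda>s t. Add s (Scal (- 1) t)) in
     {(Mult a b, Scal e (Mult b a)),
      (Mult a (Star b), Scal e' (Mult (Star b) a)),
      (minus (Mult (Star a) a) (Scal p (Mult a (Star a))), Scal (1 - p) One),
      (minus (Mult (Star b) b) (Scal q (Mult b (Star b))), Scal (1 - q) One),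
      (Mult (minus One (Mult a (Star a))) (minus One (Mult b (Star b))), Zero)})"

definition s3 :: "real \<Rightarrow> real \<Rightarrow> real \<Rightarrow> s3_gen sterm set star_algebra" where
  "s3 p q \<theta> = presented (s3_rels p q \<theta>)"

definition s3_a :: "real \<Rightarrow> real \<Rightarrow> real \<Rightarrow> s3_gen sterm set" where
  "s3_a p q \<theta> = pres_class (s3_rels p q \<theta>) (Gen Ga)"

definition s3_b :: "real \<Rightarrow> real \<Rightarrow> real \<Rightarrow> s3_gen sterm set" where
  "s3_b p q \<theta> = pres_class (s3_rels p q \<theta>) (Gen Gb)"

definition s3_A :: "real \<Rightarrow> real \<Rightarrow> real \<Rightarrow> s3_gen sterm set" where
  "s3_A p q \<theta> = \<one>\<^bsub>s3 p q \<theta>\<^esub> \<ominus>\<^bsub>s3 p q \<theta>\<^esub>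
     (s3_a p q \<theta> \<otimes>\<^bsub>s3 p q \<theta>\<^esub> star (s3 p q \<theta>) (s3_a p q \<theta>))"

definition s3_B :: "real \<Rightarrow> real \<Rightarrow> real \<Rightarrow> s3_gen sterm set" where
  "s3_B p q \<theta> = \<one>\<^bsub>s3 p q \<theta>\<^esub> \<ominus>\<^bsub>s3 p q \<theta>\<^esub>
     (s3_b p q \<theta> \<otimes>\<^bsub>s3 p q \<theta>\<^esub> star (s3 p q \<theta>) (s3_b p q \<theta>))"

definition coinvariants ::
    "('a, 'm) star_algebra_scheme \<Rightarrow> ('h, 'n) star_algebra_scheme
      \<Rightarrow> ('a \<Rightarrow> ('a \<times> 'h) list set) \<Rightarrow> ('a, 'm) star_algebra_scheme" where
  "coinvariants A H \<delta> =
     A\<lparr>carrier := {v \<in> carrier A. \<delta> v = tensor_elem A H v \<one>\<^bsub>H\<^esub>}\<rparr>"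

definition cyclic_coaction ::
    "real \<Rightarrow> real \<Rightarrow> real \<Rightarrow> nat \<Rightarrow> nat
      \<Rightarrow> s3_gen sterm set \<Rightarrow> (s3_gen sterm set \<times> u_gen sterm set) list set" where
  "cyclic_coaction p q \<theta> k l =
    (let S = s3 p q \<theta>; H = cyclic_alg (k * l); u = cyclic_u (k * l) in
     pres_map (tensor S H)
       (\<lambda>g. case g of Ga \<Rightarrow> tensor_elem S H (s3_a p q \<theta>) (u [^]\<^bsub>H\<^esub> k)
                     | Gb \<Rightarrow> tensor_elem S H (s3_b p q \<theta>) (u [^]\<^bsub>H\<^esub> l)))"

definition A_alg :: "real \<Rightarrow> real \<Rightarrow> real \<Rightarrow> nat \<Rightarrow> nat \<Rightarrow> s3_gen sterm set star_algebra" where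
  "A_alg p q \<theta> k l =
     coinvariants (s3 p q \<theta>) (cyclic_alg (k * l)) (cyclic_coaction p q \<theta> k l)"

text \<open>The *-algebra maps \<open>A \<rightarrow> A \<otimes> O(U(1))\<close> with the prescribed values on \<open>x\<close>, \<open>y\<close>, \<open>z\<close>, \<open>w\<close>;
  \<open>extensional\<close> only fixes the irrelevant values outside the carrier.\<close>

definition rho_candidates ::
    "real \<Rightarrow> real \<Rightarrow> real \<Rightarrow> nat \<Rightarrow> nat
      \<Rightarrow> (s3_gen sterm set \<Rightarrow> (s3_gen sterm set \<times> u_gen sterm set) list set) set" where
  "rho_candidates p q \<theta> k l =
    (let A = A_alg p q \<theta> k l; T = tensor A circle_alg;
         x = s3_a p q \<theta> [^]\<^bsub>s3 p q \<theta>\<^esub> l; y = s3_b p q \<theta> [^]\<^bsub>s3 p q \<theta>\<^esub> k;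
         z = s3_A p q \<theta>; w = s3_B p q \<theta> in
     {f \<in> star_alg_hom A T \<inter> extensional (carrier A).
        f x = tensor_elem A circle_alg x circle_u \<and>
        f y = tensor_elem A circle_alg y circle_u \<and>
        f z = tensor_elem A circle_alg z \<one>\<^bsub>circle_alg\<^esub> \<and>
        f w = tensor_elem A circle_alg w \<one>\<^bsub>circle_alg\<^esub>})"

definition rho ::
    "real \<Rightarrow> real \<Rightarrow> real \<Rightarrow> nat \<Rightarrow> nat
      \<Rightarrow> s3_gen sterm set \<Rightarrow> (s3_gen sterm set \<times> u_gen sterm set) list set" where
  "rho p q \<theta> k l = (THE f. f \<in> rho_candidates p q \<theta> k l)"

end

theory Submission
  imports Defs "HOL-Library.Multiset" "HOL-Computational_Algebra.Polynomial"
begin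

text \<open>Since \<open>u\<close> is group-like, a cleaving map \<open>j\<close> would give an invertible element \<open>v = j(u)\<close> of
  the algebra of coinvariants with \<open>\<rho>(v) = v \<otimes> u\<close> (\<open>cleft_circle_unit\<close>). In the sphere, with
  \<open>a\<close> of degree \<open>k\<close> and \<open>b\<close> of degree \<open>l\<close>, such a \<open>v\<close> has degree \<open>k l\<close>, and its inverse has
  degree \<open>- k l\<close>. The proof shows that this is impossible.

  Write \<open>a\<^sup>i\<close> for a power of the adjoint if \<open>i < 0\<close>. As \<open>k\<close> and \<open>l\<close> are coprime, an element of
  degree \<open>k l\<close> is a finite sum of terms \<open>P\<^sub>s a\<^bsup>ls\<^esup> b\<^bsup>k(1-s)\<^esup>\<close> with \<open>P\<^sub>s\<close> a
  polynomial in \<open>A\<close> and \<open>B\<close> (\<open>star_gen_bihom_sums\<close>, \<open>homog_multiple\<close>). In the quotient by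
  \<open>A\<close> the element \<open>a\<close> is unitary and \<open>b\<close> generates a quantum disc. There is a representation of this
  quotient on sequences in which \<open>b\<close> acts as the shift and \<open>a\<close> diagonally, so that the term
  with index \<open>s\<close> sits on the diagonal \<open>k(1-s)\<close> and its entries are values of a polynomial at the
  powers of \<open>q\<close>. The outermost diagonals of a product of two such band operators are products of
  outermost diagonals and do not vanish. So an invertible band operator whose inverse is also one has a
  single diagonal, and because both preserve the sequences on the natural numbers, it is the main one
  (\<open>invertible_band_op\<close>). Hence only \<open>s = 1\<close> survives modulo \<open>A\<close>: there \<open>v\<close> is a multiple of
  \<open>a\<^sup>l\<close>, by a polynomial whose constant term is not zero. In the same way only \<open>s = 0\<close> survives modulo \<open>B\<close>, where \<open>v\<close> is a multiple of
  \<open>b\<^sup>k\<close>. Modulo both \<open>A\<close> and \<open>B\<close>, that is on the constant terms of the \<open>P\<^sub>s\<close>, the two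
  statements contradict each other (\<open>no_unit_of_degree_kl\<close>). This replaces the index of a Toeplitz
  operator by a comparison of leading terms.

  The rest of the development relates the definitions to this picture. The coaction \<open>\<rho>\<close> is the
  unique homomorphism with prescribed values on \<open>x\<close>, \<open>y\<close>, \<open>z\<close>, \<open>w\<close>, so these have to generate the
  coinvariants (\<open>\<A>_generated\<close>), and a homomorphism with these values has to exist. It is obtained
  from its graph, which is the subalgebra generated by the prescribed pairs: evaluations at points of the
  circle separate the elements of \<open>A \<otimes> O(U(1))\<close> and turn \<open>\<rho>\<close> into the gauge action, which is
  already defined on the sphere, so the graph is that of a function (\<open>contract_rho_graph\<close>,
  \<open>hom_of_graph\<close>). Both this separation and the recognition of homogeneous elements rest on the linear independence of
  the characters of the circle (\<open>cis_separation\<close>).\<close>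

section \<open>Complex *-algebras\<close>

lemma complex_alg_simps [simp]:
  "carrier complex_alg = UNIV" "monoid.mult complex_alg = (*)" "one complex_alg = 1"
  "zero complex_alg = 0" "add complex_alg = (+)" "module.smult complex_alg = (*)"
  "star complex_alg = cnj"
  by (simp_all add: complex_alg_def)

lemma cring_complex_alg: "cring complex_alg"
proof -
  have "\<exists>y. y + x = 0" for x :: complex
    by (rule exI[of _ "- x"]) simp
  then show ?thesis
    by (intro cringI abelian_groupI comm_monoidI) (simp_all add: algebra_simps)
qed

text \<open>The laws are those by which \<open>pres_eq\<close> is defined; the additive inverse of \<open>x\<close> is
  \<open>(-1) \<odot> x\<close>.\<close>

lemma star_algebraI:
  fixes A (structure)
  assumes closed: "\<zero> \<in> carrier A" "\<one> \<in> carrier A"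
      "\<And>x y. x \<in> carrier A \<Longrightarrow> y \<in> carrier A \<Longrightarrow> x \<oplus> y \<in> carrier A"
      "\<And>x y. x \<in> carrier A \<Longrightarrow> y \<in> carrier A \<Longrightarrow> x \<otimes> y \<in> carrier A"
      "\<And>c x. x \<in> carrier A \<Longrightarrow> c \<odot> x \<in> carrier A"
      "\<And>x. x \<in> carrier A \<Longrightarrow> star A x \<in> carrier A"
    and add: "\<And>x y z. x \<in> carrier A \<Longrightarrow> y \<in> carrier A \<Longrightarrow> z \<in> carrier A \<Longrightarrow>
        (x \<oplus> y) \<oplus> z = x \<oplus> (y \<oplus> z)"
      "\<And>x y. x \<in> carrier A \<Longrightarrow> y \<in> carrier A \<Longrightarrow> x \<oplus> y = y \<oplus> x"
      "\<And>x. x \<in> carrier A \<Longrightarrow> \<zero> \<oplus> x = x"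
    and scal: "\<And>x. x \<in> carrier A \<Longrightarrow> 0 \<odot> x = \<zero>"
      "\<And>x. x \<in> carrier A \<Longrightarrow> 1 \<odot> x = x"
      "\<And>c d x. x \<in> carrier A \<Longrightarrow> (c * d) \<odot> x = c \<odot> (d \<odot> x)"
      "\<And>c d x. x \<in> carrier A \<Longrightarrow> (c + d) \<odot> x = c \<odot> x \<oplus> d \<odot> x"
      "\<And>c x y. x \<in> carrier A \<Longrightarrow> y \<in> carrier A \<Longrightarrow> c \<odot> (x \<oplus> y) = c \<odot> x \<oplus> c \<odot> y"
    and mult: "\<And>x y z. x \<in> carrier A \<Longrightarrow> y \<in> carrier A \<Longrightarrow> z \<in> carrier A \<Longrightarrow>
        (x \<otimes> y) \<otimes> z = x \<otimes> (y \<otimes> z)"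
      "\<And>x. x \<in> carrier A \<Longrightarrow> \<one> \<otimes> x = x"
      "\<And>x. x \<in> carrier A \<Longrightarrow> x \<otimes> \<one> = x"
      "\<And>x y z. x \<in> carrier A \<Longrightarrow> y \<in> carrier A \<Longrightarrow> z \<in> carrier A \<Longrightarrow>
        (x \<oplus> y) \<otimes> z = x \<otimes> z \<oplus> y \<otimes> z"
      "\<And>x y z. x \<in> carrier A \<Longrightarrow> y \<in> carrier A \<Longrightarrow> z \<in> carrier A \<Longrightarrow>
        x \<otimes> (y \<oplus> z) = x \<otimes> y \<oplus> x \<otimes> z"
      "\<And>c x y. x \<in> carrier A \<Longrightarrow> y \<in> carrier A \<Longrightarrow> (c \<odot> x) \<otimes> y = c \<odot> (x \<otimes> y)"
      "\<And>c x y. x \<in> carrier A \<Longrightarrow> y \<in> carrier A \<Longrightarrow> x \<otimes> (c \<odot> y) = c \<odot> (x \<otimes> y)"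
    and star: "\<And>x. x \<in> carrier A \<Longrightarrow> star A (star A x) = x"
      "\<And>x y. x \<in> carrier A \<Longrightarrow> y \<in> carrier A \<Longrightarrow> star A (x \<oplus> y) = star A x \<oplus> star A y"
      "\<And>x y. x \<in> carrier A \<Longrightarrow> y \<in> carrier A \<Longrightarrow> star A (x \<otimes> y) = star A y \<otimes> star A x"
      "\<And>c x. x \<in> carrier A \<Longrightarrow> star A (c \<odot> x) = cnj c \<odot> star A x"
  shows "star_algebra A"
proof -
  have inv: "\<exists>y\<in>carrier A. y \<oplus> x = \<zero>" if x: "x \<in> carrier A" for x
  proof (rule bexI)
    show "(-1) \<odot> x \<oplus> x = \<zero>"
      using scal(4)[OF x, of "-1" 1] scal(1,2)[OF x] by simp
  qed (use closed x in auto)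
  have grp: "abelian_group A"
    using closed add inv by (intro abelian_groupI) auto
  have ring: "ring A"
    using closed mult grp by (intro ringI monoidI) auto
  have module: "module complex_alg A"
    using closed scal grp cring_complex_alg by (intro moduleI) auto
  show ?thesis
    using closed mult star ring module by (intro star_algebra.intro star_algebra_axioms.intro) auto
qed

context star_algebra
begin

lemma smult_closed [simp, intro]: "x \<in> carrier A \<Longrightarrow> c \<odot> x \<in> carrier A"
  using module.smult_closed[OF module_complex] by simp

lemma smult_one [simp]: "x \<in> carrier A \<Longrightarrow> 1 \<odot> x = x"
  using module.smult_one[OF module_complex] by simp

lemma smult_smult: "x \<in> carrier A \<Longrightarrow> c \<odot> (d \<odot> x) = (c * d) \<odot> x"
  using module.smult_assoc1[OF module_complex] by simp

lemma smult_add_left: "x \<in> carrier A \<Longrightarrow> (c + d) \<odot> x = c \<odot> x \<oplus> d \<odot> x"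
  using module.smult_l_distr[OF module_complex] by simp

lemma smult_add_right:
  "x \<in> carrier A \<Longrightarrow> y \<in> carrier A \<Longrightarrow> c \<odot> (x \<oplus> y) = c \<odot> x \<oplus> c \<odot> y"
  using module.smult_r_distr[OF module_complex] by simp

lemma smult_zero_left [simp]: "x \<in> carrier A \<Longrightarrow> 0 \<odot> x = \<zero>"
  using module.smult_l_null[OF module_complex] by simp

lemma smult_zero_right [simp]: "c \<odot> \<zero> = \<zero>"
  using module.smult_r_null[OF module_complex] by simp

lemma uminus_eq_smult: "x \<in> carrier A \<Longrightarrow> \<ominus> x = (-1) \<odot> x"
  using smult_add_left[of x "-1" 1] by (intro minus_equality) auto

lemma smult_eq_zero_iff: "x \<in> carrier A \<Longrightarrow> c \<noteq> 0 \<Longrightarrow> c \<odot> x = \<zero> \<longleftrightarrow> x = \<zero>"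
  using smult_smult[of x "1 / c" c] by auto

lemma smult_finsum:
  "finite F \<Longrightarrow> f \<in> F \<rightarrow> carrier A \<Longrightarrow> c \<odot> (\<Oplus>i\<in>F. f i) = (\<Oplus>i\<in>F. c \<odot> f i)"
proof (induction F rule: finite_induct)
  case (insert i F)
  then show ?case
    by (auto simp: Pi_iff smult_add_right intro!: finsum_closed)
qed simp

lemma star_one [simp]: "star A \<one> = \<one>"
proof -
  have "star A \<one> = star A \<one> \<otimes> star A (star A \<one>)" by simp
  also have "\<dots> = star A (star A \<one> \<otimes> \<one>)" by (subst star_mult) auto
  finally show ?thesis by simp
qed

lemma star_zero [simp]: "star A \<zero> = \<zero>"
  using star_smult[of \<zero> 0] by simp

lemma star_nat_pow: "x \<in> carrier A \<Longrightarrow> star A (x [^] (n::nat)) = star A x [^] n"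
proof (induction n)
  case (Suc n)
  then show ?case by (simp add: star_mult nat_pow_Suc2[symmetric])
qed simp

lemma commute_star_unitary:
  assumes "x \<in> carrier A" "u \<in> carrier A" "u \<otimes> star A u = \<one>" "star A u \<otimes> u = \<one>" "x \<otimes> u = u \<otimes> x"
  shows "x \<otimes> star A u = star A u \<otimes> x"
proof -
  have "x \<otimes> star A u = (star A u \<otimes> u) \<otimes> (x \<otimes> star A u)" using assms by simp
  also have "\<dots> = star A u \<otimes> (u \<otimes> x) \<otimes> star A u" using assms(1,2) by (simp only: m_assoc m_closed star_closed)
  also have "\<dots> = star A u \<otimes> x \<otimes> (u \<otimes> star A u)"
    unfolding assms(5)[symmetric] using assms(1,2) by (simp only: m_assoc m_closed star_closed)
  finally show ?thesis using assms by simp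
qed

lemma unitary_pow:
  assumes u: "u \<in> carrier A" "u \<otimes> star A u = \<one>" "star A u \<otimes> u = \<one>"
  shows "u [^] (n::nat) \<otimes> star A (u [^] n) = \<one>" "star A (u [^] n) \<otimes> u [^] n = \<one>"
proof -
  have comm: "u \<otimes> star A u = star A u \<otimes> u" by (simp add: u)
  have "u [^] n \<otimes> star A u [^] n = (u \<otimes> star A u) [^] n"
    by (rule pow_mult_distrib[symmetric]) (use u comm in auto)
  then show "u [^] n \<otimes> star A (u [^] n) = \<one>" by (simp add: star_nat_pow u)
  have "star A u [^] n \<otimes> u [^] n = (star A u \<otimes> u) [^] n"
    by (rule pow_mult_distrib[symmetric]) (use u comm in auto)
  then show "star A (u [^] n) \<otimes> u [^] n = \<one>" by (simp add: star_nat_pow u)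
qed

end

subsection \<open>Homomorphisms\<close>

lemma star_alg_homI:
  assumes "\<And>x. x \<in> carrier A \<Longrightarrow> f x \<in> carrier B"
    and "\<And>x y. x \<in> carrier A \<Longrightarrow> y \<in> carrier A \<Longrightarrow> f (x \<otimes>\<^bsub>A\<^esub> y) = f x \<otimes>\<^bsub>B\<^esub> f y"
    and "\<And>x y. x \<in> carrier A \<Longrightarrow> y \<in> carrier A \<Longrightarrow> f (x \<oplus>\<^bsub>A\<^esub> y) = f x \<oplus>\<^bsub>B\<^esub> f y"
    and "f \<one>\<^bsub>A\<^esub> = \<one>\<^bsub>B\<^esub>"
    and "\<And>c x. x \<in> carrier A \<Longrightarrow> f (c \<odot>\<^bsub>A\<^esub> x) = c \<odot>\<^bsub>B\<^esub> f x"
    and "\<And>x. x \<in> carrier A \<Longrightarrow> f (star A x) = star B (f x)"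
  shows "f \<in> star_alg_hom A B"
  using assms by (auto simp: star_alg_hom_def intro!: ring_hom_memI)

lemma star_alg_homD:
  assumes "f \<in> star_alg_hom A B"
  shows star_alg_hom_closed: "x \<in> carrier A \<Longrightarrow> f x \<in> carrier B"
    and star_alg_hom_mult:
      "x \<in> carrier A \<Longrightarrow> y \<in> carrier A \<Longrightarrow> f (x \<otimes>\<^bsub>A\<^esub> y) = f x \<otimes>\<^bsub>B\<^esub> f y"
    and star_alg_hom_add:
      "x \<in> carrier A \<Longrightarrow> y \<in> carrier A \<Longrightarrow> f (x \<oplus>\<^bsub>A\<^esub> y) = f x \<oplus>\<^bsub>B\<^esub> f y"
    and star_alg_hom_one: "f \<one>\<^bsub>A\<^esub> = \<one>\<^bsub>B\<^esub>"
    and star_alg_hom_smult: "x \<in> carrier A \<Longrightarrow> f (c \<odot>\<^bsub>A\<^esub> x) = c \<odot>\<^bsub>B\<^esub> f x"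
    and star_alg_hom_star: "x \<in> carrier A \<Longrightarrow> f (star A x) = star B (f x)"
  using assms
  by (auto simp: star_alg_hom_def ring_hom_closed ring_hom_mult ring_hom_add ring_hom_one)

lemma star_alg_hom_zero:
  assumes "star_algebra A" "star_algebra B" "f \<in> star_alg_hom A B"
  shows "f \<zero>\<^bsub>A\<^esub> = \<zero>\<^bsub>B\<^esub>"
proof -
  interpret A: star_algebra A by fact
  interpret B: star_algebra B by fact
  show ?thesis
    using star_alg_hom_smult[OF assms(3), of "\<zero>\<^bsub>A\<^esub>" 0] star_alg_hom_closed[OF assms(3)] by simp
qed

lemma star_alg_hom_comp:
  "f \<in> star_alg_hom A B \<Longrightarrow> g \<in> star_alg_hom B C \<Longrightarrow> (\<lambda>x. g (f x)) \<in> star_alg_hom A C"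
  by (rule star_alg_homI) (simp_all add: star_alg_homD)

lemma star_alg_hom_pow:
  assumes "star_algebra A" "f \<in> star_alg_hom A B" "x \<in> carrier A"
  shows "f (x [^]\<^bsub>A\<^esub> (n::nat)) = f x [^]\<^bsub>B\<^esub> n"
proof -
  interpret A: star_algebra A by fact
  have *: "y [^]\<^bsub>B\<^esub> (0::nat) = \<one>\<^bsub>B\<^esub>" "y [^]\<^bsub>B\<^esub> Suc n = y [^]\<^bsub>B\<^esub> n \<otimes>\<^bsub>B\<^esub> y" for y n
    by (simp_all add: nat_pow_def)
  show ?thesis
    using assms(3) by (induction n) (simp_all add: star_alg_homD[OF assms(2)] *)
qed

lemma star_alg_hom_finsum:
  assumes "star_algebra A" "star_algebra B" "f \<in> star_alg_hom A B" "finite F"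
    and "g \<in> F \<rightarrow> carrier A"
  shows "f (finsum A g F) = finsum B (\<lambda>i. f (g i)) F"
proof -
  interpret A: star_algebra A by fact
  interpret B: star_algebra B by fact
  show ?thesis
    using assms(4,5)
  proof (induction F rule: finite_induct)
    case empty
    show ?case using star_alg_hom_zero[OF assms(1-3)] by simp
  next
    case (insert i F)
    then show ?case
      by (simp add: star_alg_homD[OF assms(3)] Pi_iff A.finsum_insert B.finsum_insert A.finsum_closed)
  qed
qed

inductive_set star_gen :: "('a, 'm) star_algebra_scheme \<Rightarrow> 'a set \<Rightarrow> 'a set"
  for A :: "('a, 'm) star_algebra_scheme" and G :: "'a set" where
  gen: "x \<in> G \<Longrightarrow> x \<in> star_gen A G"
| one: "\<one>\<^bsub>A\<^esub> \<in> star_gen A G"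
| add: "x \<in> star_gen A G \<Longrightarrow> y \<in> star_gen A G \<Longrightarrow> x \<oplus>\<^bsub>A\<^esub> y \<in> star_gen A G"
| mult: "x \<in> star_gen A G \<Longrightarrow> y \<in> star_gen A G \<Longrightarrow> x \<otimes>\<^bsub>A\<^esub> y \<in> star_gen A G"
| smult: "x \<in> star_gen A G \<Longrightarrow> c \<odot>\<^bsub>A\<^esub> x \<in> star_gen A G"
| star: "x \<in> star_gen A G \<Longrightarrow> star A x \<in> star_gen A G"

lemma star_gen_subset:
  assumes "star_algebra A" "G \<subseteq> carrier A"
  shows "star_gen A G \<subseteq> carrier A"
proof
  interpret star_algebra A by fact
  fix x assume "x \<in> star_gen A G"
  then show "x \<in> carrier A" by induction (use assms(2) in auto)
qed

lemma star_gen_pow: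
  assumes "star_algebra A" "x \<in> star_gen A G"
  shows "x [^]\<^bsub>A\<^esub> (n::nat) \<in> star_gen A G"
proof -
  interpret star_algebra A by fact
  show ?thesis using assms(2) by (induction n) (auto intro: star_gen.intros)
qed

lemma star_alg_hom_eq_on_gen:
  assumes "star_algebra A" "G \<subseteq> carrier A" "f \<in> star_alg_hom A B" "g \<in> star_alg_hom A B"
    and "\<And>x. x \<in> G \<Longrightarrow> f x = g x" and "x \<in> star_gen A G"
  shows "f x = g x"
  using assms(6)
proof induction
  case one then show ?case by (simp add: star_alg_homD(4)[OF assms(3)] star_alg_homD(4)[OF assms(4)])
qed (use star_gen_subset[OF assms(1,2)] assms(5) in
     \<open>auto simp: star_alg_homD[OF assms(3)] star_alg_homD[OF assms(4)] subset_iff\<close>)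

section \<open>Presented *-algebras\<close>

lemma pres_eq_imp_class_eq: "pres_eq R s t \<Longrightarrow> pres_class R s = pres_class R t"
  unfolding pres_class_def by (blast intro: pres_eq.sym pres_eq.trans)

lemma pres_eq_rep: "pres_eq R t (rep (pres_class R t))"
proof -
  have "rep (pres_class R t) \<in> pres_class R t"
    unfolding rep_def by (rule someI[of _ t]) (simp add: pres_class_def pres_eq.refl)
  then show ?thesis by (simp add: pres_class_def)
qed

lemma presented_simps:
  "carrier (presented R) = range (pres_class R)"
  "one (presented R) = pres_class R One"
  "zero (presented R) = pres_class R Zero"
  "pres_class R s \<otimes>\<^bsub>presented R\<^esub> pres_class R t = pres_class R (Mult s t)"
  "pres_class R s \<oplus>\<^bsub>presented R\<^esub> pres_class R t = pres_class R (Add s t)"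
  "c \<odot>\<^bsub>presented R\<^esub> pres_class R t = pres_class R (Scal c t)"
  "star (presented R) (pres_class R t) = pres_class R (Star t)"
  unfolding presented_def
  by (auto intro!: pres_eq_imp_class_eq
      intro: pres_eq.cong_mult pres_eq.cong_add pres_eq.cong_scal pres_eq.cong_star
        pres_eq.sym[OF pres_eq_rep])

lemma presented_star_algebra: "star_algebra (presented R)"
  by (rule star_algebraI; (unfold presented_simps(1))?; (elim rangeE)?; (hypsubst_thin)?;
      simp only: presented_simps(2-) rangeI;
      (rule pres_eq.intros(9-)[THEN pres_eq_imp_class_eq])?)

lemma presented_generated:
  "carrier (presented R) = star_gen (presented R) (range (\<lambda>g. pres_class R (Gen g)))"
proof
  show "star_gen (presented R) (range (\<lambda>g. pres_class R (Gen g))) \<subseteq> carrier (presented R)"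
    by (rule star_gen_subset[OF presented_star_algebra]) (auto simp: presented_simps)
  have "pres_class R t \<in> star_gen (presented R) (range (\<lambda>g. pres_class R (Gen g)))" for t
  proof (induction t)
    case Zero
    have "0 \<odot>\<^bsub>presented R\<^esub> \<one>\<^bsub>presented R\<^esub> = \<zero>\<^bsub>presented R\<^esub>"
      by (rule star_algebra.smult_zero_left[OF presented_star_algebra])
        (simp add: presented_simps)
    then show ?case using star_gen.smult[OF star_gen.one] by (metis presented_simps(3))
  qed (auto simp: presented_simps(4-7)[symmetric] presented_simps(2)[symmetric]
        intro: star_gen.intros)
  then show "carrier (presented R) \<subseteq> star_gen (presented R) (range (\<lambda>g. pres_class R (Gen g)))"
    by (auto simp: presented_simps)
qed

lemma eval_term_closed:
  assumes "star_algebra A" "\<And>g. \<phi> g \<in> carrier A"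
  shows "eval_term A \<phi> t \<in> carrier A"
proof -
  interpret star_algebra A by fact
  show ?thesis using assms(2) by (induction t) auto
qed

lemma eval_term_respects:
  assumes "star_algebra A" "\<And>g. \<phi> g \<in> carrier A"
    and rels: "\<And>s t. (s, t) \<in> R \<Longrightarrow> eval_term A \<phi> s = eval_term A \<phi> t"
    and "pres_eq R s t"
  shows "eval_term A \<phi> s = eval_term A \<phi> t"
proof -
  interpret star_algebra A by fact
  note [simp] = eval_term_closed[where \<phi> = \<phi>, OF assms(1,2)]
  show ?thesis
    using assms(4)
    by induction
      (simp_all add: rels a_ac m_assoc smult_smult smult_add_left smult_add_right
        l_distr r_distr smult_mult_left smult_mult_right star_add star_mult star_smult)
qed

text \<open>The universal property of a presented algebra.\<close>

lemma
  assumes "star_algebra A" "\<And>g. \<phi> g \<in> carrier A"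
    and rels: "\<And>s t. (s, t) \<in> R \<Longrightarrow> eval_term A \<phi> s = eval_term A \<phi> t"
  shows pres_map_class: "pres_map A \<phi> (pres_class R t) = eval_term A \<phi> t"
    and pres_hom: "pres_map A \<phi> \<in> star_alg_hom (presented R) A"
proof -
  show *: "pres_map A \<phi> (pres_class R t) = eval_term A \<phi> t" for t
    unfolding pres_map_def
    using eval_term_respects[where \<phi> = \<phi>, OF assms pres_eq.sym[OF pres_eq_rep]] .
  show "pres_map A \<phi> \<in> star_alg_hom (presented R) A"
    by (rule star_alg_homI)
      (auto simp: presented_simps * eval_term_closed[where \<phi> = \<phi>, OF assms(1,2)])
qed

lemma complex_alg_star_algebra: "star_algebra complex_alg"
  by (rule star_algebraI) (auto simp: algebra_simps)

section \<open>Tensor products of *-algebras\<close>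

lemma mset_concat_map_swap:
  "mset (concat (map (\<lambda>x. map (f x) ys) xs)) = mset (concat (map (\<lambda>y. map (\<lambda>x. f x y) xs) ys))"
proof (induction xs)
  case Nil
  show ?case by (induction ys) auto
next
  case (Cons x xs)
  have "mset (concat (map (\<lambda>y. map (\<lambda>x. f x y) (x # xs)) ys)) =
      mset (map (f x) ys) + mset (concat (map (\<lambda>y. map (\<lambda>x. f x y) xs) ys))"
    by (induction ys) auto
  with Cons show ?case by simp
qed

lemma (in abelian_monoid) list_sum_closed [simp]:
  "set xs \<subseteq> carrier G \<Longrightarrow> list_sum G xs \<in> carrier G"
  by (induction xs) (auto simp: list_sum_def)

lemma (in abelian_monoid) list_sum_append:
  "set xs \<subseteq> carrier G \<Longrightarrow> set ys \<subseteq> carrier G \<Longrightarrow>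
    list_sum G (xs @ ys) = list_sum G xs \<oplus> list_sum G ys"
proof (induction xs)
  case (Cons x xs)
  then have "list_sum G (xs @ ys) = list_sum G xs \<oplus> list_sum G ys" by simp
  with Cons.prems show ?case
    using list_sum_closed[of xs] list_sum_closed[of ys] by (simp add: list_sum_def a_assoc)
qed (use list_sum_closed[of ys] in \<open>simp add: list_sum_def\<close>)

lemma list_sum_simps [simp]:
  "list_sum A [] = \<zero>\<^bsub>A\<^esub>" "list_sum A (x # xs) = x \<oplus>\<^bsub>A\<^esub> list_sum A xs"
  by (simp_all add: list_sum_def)

locale tensor_pair = A: star_algebra A + B: star_algebra B
  for A :: "('a, 'm) star_algebra_scheme" and B :: "('b, 'n) star_algebra_scheme"
begin

abbreviation tensors :: "('a \<times> 'b) list set" where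
  "tensors \<equiv> {xs. set xs \<subseteq> carrier A \<times> carrier B}"

abbreviation T where "T \<equiv> tensor A B"

abbreviation cls where "cls \<equiv> tensor_class A B"

lemma tensor_eq_tensors: "tensor_eq A B xs ys \<Longrightarrow> xs \<in> tensors \<and> ys \<in> tensors"
  by (induction rule: tensor_eq.induct) auto

text \<open>Congruences of lists are proved up to permutation, so that reordering steps need not be
  derived from \<open>comm\<close> each time.\<close>

lemma tensor_eq_mset: "mset xs = mset ys \<Longrightarrow> xs \<in> tensors \<Longrightarrow> tensor_eq A B xs ys"
proof (induction xs arbitrary: ys)
  case Nil
  then show ?case by (auto intro: tensor_eq.refl)
next
  case (Cons x xs)
  have "x \<in> set ys" using mset_eq_setD[OF Cons.prems(1)] by auto
  then obtain ys1 ys2 where ys: "ys = ys1 @ x # ys2" by (auto dest: split_list)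
  have mem: "ys \<in> tensors" using Cons.prems(2) mset_eq_setD[OF Cons.prems(1)] by (simp only: mem_Collect_eq)
  note tensor_eq.trans [trans]
  have "tensor_eq A B ([x] @ xs) (([x] @ ys1) @ ys2)"
    unfolding append_assoc
    using Cons mem ys by (intro tensor_eq.append[OF tensor_eq.refl Cons.IH]) auto
  also have "tensor_eq A B (([x] @ ys1) @ ys2) ((ys1 @ [x]) @ ys2)"
    using mem ys Cons.prems by (intro tensor_eq.append[OF tensor_eq.comm tensor_eq.refl]) auto
  finally show ?case by (simp add: ys)
qed

lemma tensor_eq_map_add:
  assumes "\<And>y. y \<in> set ys \<Longrightarrow> tensor_eq A B [f y] [g y, h y]"
  shows "tensor_eq A B (map f ys) (map g ys @ map h ys)"
  using assms
proof (induction ys)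
  case (Cons y ys)
  note tensor_eq.trans [trans]
  have "tensor_eq A B (map f ys) (map g ys @ map h ys)" using Cons by auto
  then have "tensor_eq A B ([f y] @ map f ys) ([g y, h y] @ (map g ys @ map h ys))"
    using Cons.prems by (intro tensor_eq.append) simp_all
  also have "tensor_eq A B ([g y, h y] @ (map g ys @ map h ys)) (map g (y # ys) @ map h (y # ys))"
    using tensor_eq_tensors[OF calculation] by (intro tensor_eq_mset) simp_all
  finally show ?case by simp
qed (auto intro: tensor_eq.refl)

lemma tensor_eq_map_zero:
  assumes "\<And>y. y \<in> set ys \<Longrightarrow> tensor_eq A B [f y] []"
  shows "tensor_eq A B (map f ys) []"
  using assms
proof (induction ys)
  case (Cons y ys)
  then have "tensor_eq A B ([f y] @ map f ys) ([] @ [])" by (intro tensor_eq.append) simp_all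
  then show ?case by simp
qed (auto intro: tensor_eq.refl)

lemma cls_eqI:
  assumes eq: "tensor_eq A B xs ys"
  shows "cls xs = cls ys"
  unfolding tensor_class_def
proof (rule Collect_cong, rule iffI)
  show "tensor_eq A B ys zs" if "tensor_eq A B xs zs" for zs
    by (rule tensor_eq.trans[OF tensor_eq.sym[OF eq] that])
  show "tensor_eq A B xs zs" if "tensor_eq A B ys zs" for zs
    by (rule tensor_eq.trans[OF eq that])
qed

lemma tensor_eq_rep: "xs \<in> tensors \<Longrightarrow> tensor_eq A B xs (rep (cls xs))"
proof -
  assume "xs \<in> tensors"
  then have "xs \<in> cls xs" by (simp add: tensor_class_def tensor_eq.refl)
  then have "rep (cls xs) \<in> cls xs" unfolding rep_def by (rule someI)
  then show ?thesis by (simp add: tensor_class_def)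
qed

text \<open>A map that is additive in each argument and lets scalars pass from one argument to the
  other is well defined on the tensor product. This gives both the multiplication map of an
  algebra and the contractions of one tensor factor.\<close>

lemma tensor_eq_list_sum:
  assumes "tensor_eq A B xs ys" "abelian_group D"
    and closed: "\<And>v w. v \<in> carrier A \<Longrightarrow> w \<in> carrier B \<Longrightarrow> \<beta> v w \<in> carrier D"
    and "\<And>v v' w. v \<in> carrier A \<Longrightarrow> v' \<in> carrier A \<Longrightarrow> w \<in> carrier B \<Longrightarrow>
      \<beta> (v \<oplus>\<^bsub>A\<^esub> v') w = \<beta> v w \<oplus>\<^bsub>D\<^esub> \<beta> v' w"
    and "\<And>v w w'. v \<in> carrier A \<Longrightarrow> w \<in> carrier B \<Longrightarrow> w' \<in> carrier B \<Longrightarrow>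
      \<beta> v (w \<oplus>\<^bsub>B\<^esub> w') = \<beta> v w \<oplus>\<^bsub>D\<^esub> \<beta> v w'"
    and scal: "\<And>c v w. v \<in> carrier A \<Longrightarrow> w \<in> carrier B \<Longrightarrow> \<beta> (c \<odot>\<^bsub>A\<^esub> v) w = \<beta> v (c \<odot>\<^bsub>B\<^esub> w)"
  shows "list_sum D (map (\<lambda>(v, w). \<beta> v w) xs) = list_sum D (map (\<lambda>(v, w). \<beta> v w) ys)"
proof -
  interpret D: abelian_group D by fact
  have c: "set (map (\<lambda>(v, w). \<beta> v w) xs) \<subseteq> carrier D" if "xs \<in> tensors" for xs
    using that closed by auto
  have z: "\<beta> \<zero>\<^bsub>A\<^esub> w = \<zero>\<^bsub>D\<^esub>" if "w \<in> carrier B" for w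
    using assms(4)[of "\<zero>\<^bsub>A\<^esub>" "\<zero>\<^bsub>A\<^esub>" w] closed[of "\<zero>\<^bsub>A\<^esub>" w] that by simp
  show ?thesis
    using assms(1)
  proof induction
    case (append xs xs' ys ys')
    then show ?case
      using c tensor_eq_tensors[OF append(1)] tensor_eq_tensors[OF append(2)]
      by (simp add: D.list_sum_append del: set_map)
  next
    case (comm xs ys)
    then show ?case
      using c[of xs] c[of ys] by (simp add: D.list_sum_append D.a_comm del: set_map)
  qed (simp_all add: assms z)
qed

lemma tensor_eq_map:
  assumes "tensor_eq A B xs ys" "star_algebra C" "star_algebra D"
    and "\<And>v. v \<in> carrier A \<Longrightarrow> f v \<in> carrier C" "\<And>w. w \<in> carrier B \<Longrightarrow> g w \<in> carrier D"
    and "\<And>v v'. v \<in> carrier A \<Longrightarrow> v' \<in> carrier A \<Longrightarrow> f (v \<oplus>\<^bsub>A\<^esub> v') = f v \<oplus>\<^bsub>C\<^esub> f v'"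
    and "\<And>w w'. w \<in> carrier B \<Longrightarrow> w' \<in> carrier B \<Longrightarrow> g (w \<oplus>\<^bsub>B\<^esub> w') = g w \<oplus>\<^bsub>D\<^esub> g w'"
    and "\<And>c v. v \<in> carrier A \<Longrightarrow> f (c \<odot>\<^bsub>A\<^esub> v) = \<gamma> c \<odot>\<^bsub>C\<^esub> f v"
    and "\<And>c w. w \<in> carrier B \<Longrightarrow> g (c \<odot>\<^bsub>B\<^esub> w) = \<gamma> c \<odot>\<^bsub>D\<^esub> g w"
  shows "tensor_eq C D (map (\<lambda>(v, w). (f v, g w)) xs) (map (\<lambda>(v, w). (f v, g w)) ys)"
proof -
  interpret C: star_algebra C by fact
  interpret D: star_algebra D by fact
  have z: "f \<zero>\<^bsub>A\<^esub> = \<zero>\<^bsub>C\<^esub>"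
    using assms(6)[of "\<zero>\<^bsub>A\<^esub>" "\<zero>\<^bsub>A\<^esub>"] assms(4)[of "\<zero>\<^bsub>A\<^esub>"] by simp
  show ?thesis
    using assms(1)
  proof induction
    case (refl xs)
    then show ?case using assms(4,5) by (intro tensor_eq.refl) auto
  next
    case (comm xs ys)
    have "set (map (\<lambda>(v, w). (f v, g w)) zs) \<subseteq> carrier C \<times> carrier D"
      if "set zs \<subseteq> carrier A \<times> carrier B" for zs
      using that assms(4,5) by auto
    from this[OF comm(1)] this[OF comm(2)] show ?case
      unfolding map_append by (rule tensor_eq.comm)
  next
    case (append xs xs' ys ys')
    then show ?case by (simp add: tensor_eq.append)
  next
    case (sym xs ys)
    show ?case by (rule tensor_eq.sym[OF sym.IH])
  next
    case (trans xs ys zs)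
    show ?case by (rule tensor_eq.trans[OF trans.IH])
  qed (simp_all add: assms z tensor_eq.zero tensor_eq.add_left tensor_eq.add_right tensor_eq.scal)
qed

lemma tensor_list_mult_simps:
  "tensor_list_mult A B [] ys = []"
  "tensor_list_mult A B (x # xs) ys =
    map (\<lambda>(v', w'). (fst x \<otimes>\<^bsub>A\<^esub> v', snd x \<otimes>\<^bsub>B\<^esub> w')) ys @ tensor_list_mult A B xs ys"
  "tensor_list_mult A B (xs @ xs') ys = tensor_list_mult A B xs ys @ tensor_list_mult A B xs' ys"
  by (auto simp: tensor_list_mult_def split_def)

lemma tensor_list_mult_tensors:
  "xs \<in> tensors \<Longrightarrow> ys \<in> tensors \<Longrightarrow> tensor_list_mult A B xs ys \<in> tensors"
  by (induction xs) (auto simp: tensor_list_mult_simps)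

lemma tensor_eq_list_mult_right:
  assumes "xs \<in> tensors" "tensor_eq A B ys ys'"
  shows "tensor_eq A B (tensor_list_mult A B xs ys) (tensor_list_mult A B xs ys')"
  using assms(1)
proof (induction xs)
  case (Cons x xs)
  have "tensor_eq A B (map (\<lambda>(v', w'). (fst x \<otimes>\<^bsub>A\<^esub> v', snd x \<otimes>\<^bsub>B\<^esub> w')) ys)
      (map (\<lambda>(v', w'). (fst x \<otimes>\<^bsub>A\<^esub> v', snd x \<otimes>\<^bsub>B\<^esub> w')) ys')"
    using Cons.prems
    by (intro tensor_eq_map[where \<gamma> = id, OF assms(2) A.star_algebra_axioms B.star_algebra_axioms])
      (auto simp: A.r_distr B.r_distr A.smult_mult_right B.smult_mult_right)
  with Cons show ?case by (simp add: tensor_list_mult_simps tensor_eq.append)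
qed (auto simp: tensor_list_mult_simps intro: tensor_eq.refl)

lemma tensor_eq_list_mult_left:
  assumes "tensor_eq A B xs xs'" "ys \<in> tensors"
  shows "tensor_eq A B (tensor_list_mult A B xs ys) (tensor_list_mult A B xs' ys)"
proof -
  have mem: "fst y \<in> carrier A" "snd y \<in> carrier B" if "y \<in> set ys" for y
    using assms(2) that by auto
  show ?thesis
    using assms(1)
  proof induction
    case (refl xs)
    then show ?case using tensor_list_mult_tensors assms(2) by (auto intro!: tensor_eq.refl)
  next
    case (append xs xs' ys ys')
    then show ?case by (simp add: tensor_list_mult_simps tensor_eq.append)
  next
    case (comm xs xs')
    then show ?case
      using tensor_list_mult_tensors[of _ ys] assms(2)
      by (simp add: tensor_list_mult_simps tensor_eq.comm)
  next
    case (zero w)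
    then show ?case
      using tensor_eq_map_zero[of ys "\<lambda>y. (\<zero>\<^bsub>A\<^esub> \<otimes>\<^bsub>A\<^esub> fst y, w \<otimes>\<^bsub>B\<^esub> snd y)"] mem
      by (simp add: tensor_list_mult_simps split_def tensor_eq.zero)
  next
    case (add_left v v' w)
    have "tensor_eq A B (map (\<lambda>y. ((v \<oplus>\<^bsub>A\<^esub> v') \<otimes>\<^bsub>A\<^esub> fst y, w \<otimes>\<^bsub>B\<^esub> snd y)) ys)
        (map (\<lambda>y. (v \<otimes>\<^bsub>A\<^esub> fst y, w \<otimes>\<^bsub>B\<^esub> snd y)) ys @ map (\<lambda>y. (v' \<otimes>\<^bsub>A\<^esub> fst y, w \<otimes>\<^bsub>B\<^esub> snd y)) ys)"
      by (rule tensor_eq_map_add) (simp add: add_left mem A.l_distr tensor_eq.add_left)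
    then show ?case by (simp add: tensor_list_mult_simps split_def)
  next
    case (add_right v w w')
    have "tensor_eq A B (map (\<lambda>y. (v \<otimes>\<^bsub>A\<^esub> fst y, (w \<oplus>\<^bsub>B\<^esub> w') \<otimes>\<^bsub>B\<^esub> snd y)) ys)
        (map (\<lambda>y. (v \<otimes>\<^bsub>A\<^esub> fst y, w \<otimes>\<^bsub>B\<^esub> snd y)) ys @ map (\<lambda>y. (v \<otimes>\<^bsub>A\<^esub> fst y, w' \<otimes>\<^bsub>B\<^esub> snd y)) ys)"
      by (rule tensor_eq_map_add) (simp add: add_right mem B.l_distr tensor_eq.add_right)
    then show ?case by (simp add: tensor_list_mult_simps split_def)
  next
    case (scal v w c)
    have "tensor_eq A B (map (\<lambda>(v', w'). ((c \<odot>\<^bsub>A\<^esub> v) \<otimes>\<^bsub>A\<^esub> v', w \<otimes>\<^bsub>B\<^esub> w')) ys)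
        (map (\<lambda>(v', w'). (v \<otimes>\<^bsub>A\<^esub> v', (c \<odot>\<^bsub>B\<^esub> w) \<otimes>\<^bsub>B\<^esub> w')) ys)"
      using assms(2)
    proof (induction ys)
      case (Cons y ys)
      then obtain v' w' where y: "y = (v', w')" "v' \<in> carrier A" "w' \<in> carrier B" by auto
      have "tensor_eq A B [((c \<odot>\<^bsub>A\<^esub> v) \<otimes>\<^bsub>A\<^esub> v', w \<otimes>\<^bsub>B\<^esub> w')] [(v \<otimes>\<^bsub>A\<^esub> v', (c \<odot>\<^bsub>B\<^esub> w) \<otimes>\<^bsub>B\<^esub> w')]"
        using tensor_eq.scal[of "v \<otimes>\<^bsub>A\<^esub> v'" A "w \<otimes>\<^bsub>B\<^esub> w'" B c] y scal
        by (simp add: A.smult_mult_left B.smult_mult_left)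
      from tensor_eq.append[OF this Cons.IH] Cons.prems y show ?case by simp
    qed (auto intro: tensor_eq.refl)
    then show ?case by (simp add: tensor_list_mult_simps)
  next
    case (sym xs xs')
    show ?case by (rule tensor_eq.sym[OF sym.IH])
  next
    case (trans xs xs' xs'')
    show ?case by (rule tensor_eq.trans[OF trans.IH])
  qed
qed

lemma rep_tensors: "xs \<in> tensors \<Longrightarrow> rep (cls xs) \<in> tensors"
  using tensor_eq_tensors[OF tensor_eq_rep] by simp

text \<open>The operations of \<open>tensor A B\<close> pick representatives; by the preceding congruences any
  representative may be used.\<close>

lemma tensor_simps:
  "carrier T = cls ` tensors"
  "one T = cls [(\<one>\<^bsub>A\<^esub>, \<one>\<^bsub>B\<^esub>)]"
  "zero T = cls []"
  "xs \<in> tensors \<Longrightarrow> ys \<in> tensors \<Longrightarrow> cls xs \<otimes>\<^bsub>T\<^esub> cls ys = cls (tensor_list_mult A B xs ys)"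
  "xs \<in> tensors \<Longrightarrow> ys \<in> tensors \<Longrightarrow> cls xs \<oplus>\<^bsub>T\<^esub> cls ys = cls (xs @ ys)"
  "xs \<in> tensors \<Longrightarrow> c \<odot>\<^bsub>T\<^esub> cls xs = cls (map (\<lambda>(v, w). (c \<odot>\<^bsub>A\<^esub> v, w)) xs)"
  "xs \<in> tensors \<Longrightarrow> star T (cls xs) = cls (map (\<lambda>(v, w). (star A v, star B w)) xs)"
proof -
  note r = tensor_eq.sym[OF tensor_eq_rep]
  show "carrier T = cls ` tensors" "one T = cls [(\<one>\<^bsub>A\<^esub>, \<one>\<^bsub>B\<^esub>)]" "zero T = cls []"
    by (simp_all add: tensor_def tensor_elem_def)
  show "cls xs \<otimes>\<^bsub>T\<^esub> cls ys = cls (tensor_list_mult A B xs ys)"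
    if "xs \<in> tensors" "ys \<in> tensors" for xs ys
    using cls_eqI[OF tensor_eq.trans[OF
          tensor_eq_list_mult_left[OF r[OF that(1)] rep_tensors[OF that(2)]]
          tensor_eq_list_mult_right[OF that(1) r[OF that(2)]]]]
    by (simp add: tensor_def)
  show "cls xs \<oplus>\<^bsub>T\<^esub> cls ys = cls (xs @ ys)" if "xs \<in> tensors" "ys \<in> tensors"
    using cls_eqI[OF tensor_eq.append[OF r[OF that(1)] r[OF that(2)]]] by (simp add: tensor_def)
  show "c \<odot>\<^bsub>T\<^esub> cls xs = cls (map (\<lambda>(v, w). (c \<odot>\<^bsub>A\<^esub> v, w)) xs)" if "xs \<in> tensors"
  proof -
    have "tensor_eq A B (map (\<lambda>(v, w). (c \<odot>\<^bsub>A\<^esub> v, w)) (rep (cls xs))) (map (\<lambda>(v, w). (c \<odot>\<^bsub>A\<^esub> v, w)) xs)"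
      by (rule tensor_eq_map[where \<gamma> = id and g = "\<lambda>w. w",
            OF r[OF that] A.star_algebra_axioms B.star_algebra_axioms])
        (simp_all add: A.smult_add_right A.smult_smult mult.commute)
    from cls_eqI[OF this] show ?thesis by (simp add: tensor_def)
  qed
  show "star T (cls xs) = cls (map (\<lambda>(v, w). (star A v, star B w)) xs)" if "xs \<in> tensors"
  proof -
    have "tensor_eq A B (map (\<lambda>(v, w). (star A v, star B w)) (rep (cls xs)))
        (map (\<lambda>(v, w). (star A v, star B w)) xs)"
      by (rule tensor_eq_map[where \<gamma> = cnj,
            OF r[OF that] A.star_algebra_axioms B.star_algebra_axioms])
        (simp_all add: A.star_add B.star_add A.star_smult B.star_smult)
    from cls_eqI[OF this] show ?thesis by (simp add: tensor_def)
  qed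
qed


lemma tensor_list_mult_assoc:
  assumes "xs \<in> tensors" "ys \<in> tensors" "zs \<in> tensors"
  shows "tensor_list_mult A B (tensor_list_mult A B xs ys) zs =
    tensor_list_mult A B xs (tensor_list_mult A B ys zs)"
proof -
  have 1: "tensor_list_mult A B (map (\<lambda>(v', w'). (v \<otimes>\<^bsub>A\<^esub> v', w \<otimes>\<^bsub>B\<^esub> w')) ys) zs =
      map (\<lambda>(v', w'). (v \<otimes>\<^bsub>A\<^esub> v', w \<otimes>\<^bsub>B\<^esub> w')) (tensor_list_mult A B ys zs)"
    if "v \<in> carrier A" "w \<in> carrier B" for v w
    using assms(2)
  proof (induction ys)
    case (Cons y ys)
    have "(fst y \<in> carrier A \<and> snd y \<in> carrier B) \<and> (\<forall>z\<in>set zs. fst z \<in> carrier A \<and> snd z \<in> carrier B)"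
      using Cons.prems assms(3) by auto
    with that Cons show ?case
      by (auto simp: tensor_list_mult_simps split_def A.m_assoc B.m_assoc)
  qed (simp add: tensor_list_mult_simps)
  show ?thesis
    using assms(1)
  proof (induction xs)
    case (Cons x xs)
    then show ?case
      using 1[of "fst x" "snd x"] by (auto simp: tensor_list_mult_simps)
  qed (simp add: tensor_list_mult_simps)
qed

lemma tensor_list_mult_one:
  assumes "xs \<in> tensors"
  shows "tensor_list_mult A B [(\<one>\<^bsub>A\<^esub>, \<one>\<^bsub>B\<^esub>)] xs = xs" "tensor_list_mult A B xs [(\<one>\<^bsub>A\<^esub>, \<one>\<^bsub>B\<^esub>)] = xs"
  using assms by (induction xs) (auto simp: tensor_list_mult_simps)

lemma tensor_list_mult_append_right:
  assumes "xs \<in> tensors" "ys \<in> tensors" "zs \<in> tensors"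
  shows "tensor_eq A B (tensor_list_mult A B xs (ys @ zs))
    (tensor_list_mult A B xs ys @ tensor_list_mult A B xs zs)"
proof (rule tensor_eq_mset)
  show "mset (tensor_list_mult A B xs (ys @ zs)) =
      mset (tensor_list_mult A B xs ys @ tensor_list_mult A B xs zs)"
    by (induction xs) (auto simp: tensor_list_mult_simps)
  show "tensor_list_mult A B xs (ys @ zs) \<in> tensors"
    by (rule tensor_list_mult_tensors) (use assms in auto)
qed

lemma tensor_list_mult_star:
  assumes "xs \<in> tensors" "ys \<in> tensors"
  shows "tensor_eq A B (map (\<lambda>(v, w). (star A v, star B w)) (tensor_list_mult A B xs ys))
    (tensor_list_mult A B (map (\<lambda>(v, w). (star A v, star B w)) ys)
      (map (\<lambda>(v, w). (star A v, star B w)) xs))"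
proof (rule tensor_eq_mset)
  let ?s = "\<lambda>(v, w). (star A v, star B w)"
  let ?m = "\<lambda>x y. (star A (fst y) \<otimes>\<^bsub>A\<^esub> star A (fst x), star B (snd y) \<otimes>\<^bsub>B\<^esub> star B (snd x))"
  have "map ?s (tensor_list_mult A B xs ys) = concat (map (\<lambda>x. map (?m x) ys) xs)"
  proof -
    have "fst x \<in> carrier A" "snd x \<in> carrier B" if "x \<in> set xs \<or> x \<in> set ys" for x
      using that assms by auto
    then show ?thesis
      by (simp add: tensor_list_mult_def map_concat split_def A.star_mult B.star_mult comp_def
          cong: map_cong)
  qed
  moreover have "tensor_list_mult A B (map ?s ys) (map ?s xs) = concat (map (\<lambda>y. map (\<lambda>x. ?m x y) xs) ys)"
    by (simp add: tensor_list_mult_def split_def comp_def)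
  ultimately show "mset (map ?s (tensor_list_mult A B xs ys)) =
      mset (tensor_list_mult A B (map ?s ys) (map ?s xs))"
    by (simp only: mset_concat_map_swap[of ?m])
  show "map ?s (tensor_list_mult A B xs ys) \<in> tensors"
    using tensor_list_mult_tensors[OF assms] by (auto dest!: subsetD)
qed

lemma map_tensors:
  assumes "xs \<in> tensors" "\<And>v. v \<in> carrier A \<Longrightarrow> f v \<in> carrier A"
    "\<And>w. w \<in> carrier B \<Longrightarrow> g w \<in> carrier B"
  shows "map (\<lambda>(v, w). (f v, g w)) xs \<in> tensors"
  using assms by (induction xs) auto

lemma map_eq_tensors:
  assumes "xs \<in> tensors" "\<And>v w. v \<in> carrier A \<Longrightarrow> w \<in> carrier B \<Longrightarrow> f (v, w) = g (v, w)"
  shows "map f xs = map g xs"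
  using assms by (induction xs) auto

lemma append_tensors: "xs \<in> tensors \<Longrightarrow> ys \<in> tensors \<Longrightarrow> xs @ ys \<in> tensors"
  by simp

lemma tensor_star_algebra: "star_algebra T"
proof (rule star_algebraI, unfold tensor_simps(1))
  let ?s = "\<lambda>c. \<lambda>(v, w). (c \<odot>\<^bsub>A\<^esub> v, w)" and ?st = "\<lambda>(v, w). (star A v, star B w)"
  have nil: "[] \<in> tensors" and one: "[(\<one>\<^bsub>A\<^esub>, \<one>\<^bsub>B\<^esub>)] \<in> tensors" by auto
  note [simp del] = mem_Collect_eq
  note [simp] = nil one append_tensors tensor_list_mult_tensors map_tensors map_tensors[of _ _ "\<lambda>w. w"]
    tensor_simps(2-) tensor_list_mult_assoc tensor_list_mult_one
  show "\<zero>\<^bsub>T\<^esub> \<in> cls ` tensors" "\<one>\<^bsub>T\<^esub> \<in> cls ` tensors" by auto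
  fix X assume "X \<in> cls ` tensors"
  then obtain xs where X: "X = cls xs" and xs [simp]: "xs \<in> tensors" by auto
  have mem: "fst x \<in> carrier A" "snd x \<in> carrier B" if "x \<in> set xs" for x
    using that xs by (auto simp: mem_Collect_eq)
  show "c \<odot>\<^bsub>T\<^esub> X \<in> cls ` tensors" "star T X \<in> cls ` tensors" for c
    by (auto simp: X)
  show "\<zero>\<^bsub>T\<^esub> \<oplus>\<^bsub>T\<^esub> X = X" "\<one>\<^bsub>T\<^esub> \<otimes>\<^bsub>T\<^esub> X = X" "X \<otimes>\<^bsub>T\<^esub> \<one>\<^bsub>T\<^esub> = X"
    by (auto simp: X)
  have "map (\<lambda>(v, w). (1 \<odot>\<^bsub>A\<^esub> v, w)) xs = map id xs" by (rule map_eq_tensors[OF xs]) simp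
  then show "1 \<odot>\<^bsub>T\<^esub> X = X" by (simp add: X)
  have "map ?st (map ?st xs) = map id xs"
    unfolding map_map by (rule map_eq_tensors[OF xs]) simp
  then show "star T (star T X) = X" by (simp add: X del: map_map)
  show "(c * d) \<odot>\<^bsub>T\<^esub> X = c \<odot>\<^bsub>T\<^esub> (d \<odot>\<^bsub>T\<^esub> X)" for c d
    by (simp add: X, intro arg_cong[of _ _ cls] map_eq_tensors[OF xs]) (simp add: A.smult_smult)
  have "map ?st (map (\<lambda>(v, w). (c \<odot>\<^bsub>A\<^esub> v, w)) xs) =
      map (?s (cnj c)) (map ?st xs)" for c
    unfolding map_map by (rule map_eq_tensors[OF xs]) (simp add: A.star_smult)
  then show "star T (c \<odot>\<^bsub>T\<^esub> X) = cnj c \<odot>\<^bsub>T\<^esub> star T X" for c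
    by (simp add: X del: map_map)
  have "tensor_eq A B (map (\<lambda>(v, w). (0 \<odot>\<^bsub>A\<^esub> v, w)) xs) []"
    by (rule tensor_eq_map_zero) (simp add: split_def mem tensor_eq.zero)
  then show "0 \<odot>\<^bsub>T\<^esub> X = \<zero>\<^bsub>T\<^esub>" by (simp add: X cls_eqI)
  have "tensor_eq A B (map (?s (c + d)) xs)
      (map (\<lambda>(v, w). (c \<odot>\<^bsub>A\<^esub> v, w)) xs @ map (\<lambda>(v, w). (d \<odot>\<^bsub>A\<^esub> v, w)) xs)" for c d
    by (rule tensor_eq_map_add)
      (simp add: split_def mem A.smult_add_left tensor_eq.add_left)
  then show "(c + d) \<odot>\<^bsub>T\<^esub> X = c \<odot>\<^bsub>T\<^esub> X \<oplus>\<^bsub>T\<^esub> d \<odot>\<^bsub>T\<^esub> X" for c d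
    by (simp add: X cls_eqI)
  fix Y assume "Y \<in> cls ` tensors"
  then obtain ys where Y: "Y = cls ys" and ys [simp]: "ys \<in> tensors" by auto
  show "X \<oplus>\<^bsub>T\<^esub> Y \<in> cls ` tensors" "X \<otimes>\<^bsub>T\<^esub> Y \<in> cls ` tensors" by (auto simp: X Y)
  have "tensor_eq A B (xs @ ys) (ys @ xs)"
    using xs ys by (intro tensor_eq.comm) (simp_all add: mem_Collect_eq)
  then show "X \<oplus>\<^bsub>T\<^esub> Y = Y \<oplus>\<^bsub>T\<^esub> X" by (simp add: X Y cls_eqI)
  show "c \<odot>\<^bsub>T\<^esub> (X \<oplus>\<^bsub>T\<^esub> Y) = c \<odot>\<^bsub>T\<^esub> X \<oplus>\<^bsub>T\<^esub> c \<odot>\<^bsub>T\<^esub> Y"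
    "star T (X \<oplus>\<^bsub>T\<^esub> Y) = star T X \<oplus>\<^bsub>T\<^esub> star T Y" for c
    by (simp_all add: X Y)
  show "star T (X \<otimes>\<^bsub>T\<^esub> Y) = star T Y \<otimes>\<^bsub>T\<^esub> star T X"
    using tensor_list_mult_star[OF xs ys] by (simp add: X Y cls_eqI)
  have "tensor_list_mult A B (map (\<lambda>(v, w). (c \<odot>\<^bsub>A\<^esub> v, w)) xs) ys =
      map (\<lambda>(v, w). (c \<odot>\<^bsub>A\<^esub> v, w)) (tensor_list_mult A B xs ys)"
    "tensor_list_mult A B xs (map (\<lambda>(v, w). (c \<odot>\<^bsub>A\<^esub> v, w)) ys) =
      map (\<lambda>(v, w). (c \<odot>\<^bsub>A\<^esub> v, w)) (tensor_list_mult A B xs ys)" for c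
  proof -
    have m: "fst x \<in> carrier A" if "x \<in> set xs \<or> x \<in> set ys" for x
      using that xs ys by (auto simp: mem_Collect_eq)
    show "tensor_list_mult A B (map (\<lambda>(v, w). (c \<odot>\<^bsub>A\<^esub> v, w)) xs) ys =
      map (\<lambda>(v, w). (c \<odot>\<^bsub>A\<^esub> v, w)) (tensor_list_mult A B xs ys)"
      "tensor_list_mult A B xs (map (\<lambda>(v, w). (c \<odot>\<^bsub>A\<^esub> v, w)) ys) =
      map (\<lambda>(v, w). (c \<odot>\<^bsub>A\<^esub> v, w)) (tensor_list_mult A B xs ys)"
      using m by (simp_all add: tensor_list_mult_def map_concat split_def comp_def
          A.smult_mult_left A.smult_mult_right cong: map_cong)
  qed
  then show "(c \<odot>\<^bsub>T\<^esub> X) \<otimes>\<^bsub>T\<^esub> Y = c \<odot>\<^bsub>T\<^esub> (X \<otimes>\<^bsub>T\<^esub> Y)" "X \<otimes>\<^bsub>T\<^esub> (c \<odot>\<^bsub>T\<^esub> Y) = c \<odot>\<^bsub>T\<^esub> (X \<otimes>\<^bsub>T\<^esub> Y)" for c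
    by (simp_all add: X Y)
  fix Z assume "Z \<in> cls ` tensors"
  then obtain zs where Z: "Z = cls zs" and zs [simp]: "zs \<in> tensors" by auto
  show "(X \<oplus>\<^bsub>T\<^esub> Y) \<oplus>\<^bsub>T\<^esub> Z = X \<oplus>\<^bsub>T\<^esub> (Y \<oplus>\<^bsub>T\<^esub> Z)" "(X \<otimes>\<^bsub>T\<^esub> Y) \<otimes>\<^bsub>T\<^esub> Z = X \<otimes>\<^bsub>T\<^esub> (Y \<otimes>\<^bsub>T\<^esub> Z)"
    "(X \<oplus>\<^bsub>T\<^esub> Y) \<otimes>\<^bsub>T\<^esub> Z = X \<otimes>\<^bsub>T\<^esub> Z \<oplus>\<^bsub>T\<^esub> Y \<otimes>\<^bsub>T\<^esub> Z"
    by (simp_all add: X Y Z tensor_list_mult_simps)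
  show "X \<otimes>\<^bsub>T\<^esub> (Y \<oplus>\<^bsub>T\<^esub> Z) = X \<otimes>\<^bsub>T\<^esub> Y \<oplus>\<^bsub>T\<^esub> X \<otimes>\<^bsub>T\<^esub> Z"
    using tensor_list_mult_append_right[OF xs ys zs] by (simp add: X Y Z cls_eqI)
qed

end

context tensor_pair
begin

abbreviation elem where "elem \<equiv> tensor_elem A B"

lemma elem_closed [simp]: "v \<in> carrier A \<Longrightarrow> w \<in> carrier B \<Longrightarrow> elem v w \<in> carrier T"
  by (auto simp: tensor_elem_def tensor_simps(1))

lemma elem_mult:
  "v \<in> carrier A \<Longrightarrow> w \<in> carrier B \<Longrightarrow> v' \<in> carrier A \<Longrightarrow> w' \<in> carrier B \<Longrightarrow>
    elem v w \<otimes>\<^bsub>T\<^esub> elem v' w' = elem (v \<otimes>\<^bsub>A\<^esub> v') (w \<otimes>\<^bsub>B\<^esub> w')"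
  by (simp add: tensor_elem_def tensor_simps tensor_list_mult_simps)

lemma elem_add_left:
  "v \<in> carrier A \<Longrightarrow> v' \<in> carrier A \<Longrightarrow> w \<in> carrier B \<Longrightarrow>
    elem (v \<oplus>\<^bsub>A\<^esub> v') w = elem v w \<oplus>\<^bsub>T\<^esub> elem v' w"
  using cls_eqI[OF tensor_eq.add_left[of v A v' w B]]
  by (simp add: tensor_elem_def tensor_simps)

lemma elem_add_right:
  "v \<in> carrier A \<Longrightarrow> w \<in> carrier B \<Longrightarrow> w' \<in> carrier B \<Longrightarrow>
    elem v (w \<oplus>\<^bsub>B\<^esub> w') = elem v w \<oplus>\<^bsub>T\<^esub> elem v w'"
  using cls_eqI[OF tensor_eq.add_right[of v A w B w']]
  by (simp add: tensor_elem_def tensor_simps)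

lemma elem_smult_left:
  "v \<in> carrier A \<Longrightarrow> w \<in> carrier B \<Longrightarrow> elem (c \<odot>\<^bsub>A\<^esub> v) w = c \<odot>\<^bsub>T\<^esub> elem v w"
  by (simp add: tensor_elem_def tensor_simps)

lemma elem_smult_right:
  "v \<in> carrier A \<Longrightarrow> w \<in> carrier B \<Longrightarrow> elem v (c \<odot>\<^bsub>B\<^esub> w) = elem (c \<odot>\<^bsub>A\<^esub> v) w"
  using cls_eqI[OF tensor_eq.scal[of v A w B c]] by (simp add: tensor_elem_def)

lemma elem_star:
  "v \<in> carrier A \<Longrightarrow> w \<in> carrier B \<Longrightarrow> star T (elem v w) = elem (star A v) (star B w)"
  by (simp add: tensor_elem_def tensor_simps)

lemma elem_one: "elem \<one>\<^bsub>A\<^esub> \<one>\<^bsub>B\<^esub> = \<one>\<^bsub>T\<^esub>"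
  by (simp add: tensor_elem_def tensor_simps)

lemma elem_zero_left: "w \<in> carrier B \<Longrightarrow> elem \<zero>\<^bsub>A\<^esub> w = \<zero>\<^bsub>T\<^esub>"
  using cls_eqI[OF tensor_eq.zero[of w B A]] by (simp add: tensor_elem_def tensor_simps)

lemma elem_pow:
  assumes "v \<in> carrier A" "w \<in> carrier B"
  shows "elem v w [^]\<^bsub>T\<^esub> (n::nat) = elem (v [^]\<^bsub>A\<^esub> n) (w [^]\<^bsub>B\<^esub> n)"
proof -
  interpret T: star_algebra T by (rule tensor_star_algebra)
  show ?thesis using assms by (induction n) (simp_all add: elem_one elem_mult)
qed

lemma tensor_induct [consumes 1, case_names zero add]:
  assumes "X \<in> carrier T" "P \<zero>\<^bsub>T\<^esub>"
    and "\<And>v w X. v \<in> carrier A \<Longrightarrow> w \<in> carrier B \<Longrightarrow> X \<in> carrier T \<Longrightarrow> P X \<Longrightarrow> P (elem v w \<oplus>\<^bsub>T\<^esub> X)"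
  shows "P X"
proof -
  obtain xs where "X = cls xs" "xs \<in> tensors" using assms(1) by (auto simp: tensor_simps(1))
  moreover have "xs \<in> tensors \<Longrightarrow> P (cls xs)" for xs
  proof (induction xs)
    case Nil
    then show ?case using assms(2) by (simp add: tensor_simps)
  next
    case (Cons x xs)
    then have "P (elem (fst x) (snd x) \<oplus>\<^bsub>T\<^esub> cls xs)"
      by (intro assms(3)) (auto simp: tensor_simps(1))
    then show ?case using Cons.prems by (auto simp: tensor_elem_def tensor_simps)
  qed
  ultimately show ?thesis by simp
qed

text \<open>The contraction \<open>id \<otimes> \<phi>\<close> of \<open>A \<otimes> B\<close> onto \<open>A\<close> by a character \<open>\<phi>\<close> of \<open>B\<close>.\<close>

definition contract :: "('b \<Rightarrow> complex) \<Rightarrow> ('a \<times> 'b) list set \<Rightarrow> 'a" where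
  "contract \<phi> X = list_sum A (map (\<lambda>(v, w). \<phi> w \<odot>\<^bsub>A\<^esub> v) (rep X))"

context
  fixes \<phi> assumes \<phi>: "\<phi> \<in> star_alg_hom B complex_alg"
begin

lemma contract_cls:
  assumes "xs \<in> tensors"
  shows "contract \<phi> (cls xs) = list_sum A (map (\<lambda>(v, w). \<phi> w \<odot>\<^bsub>A\<^esub> v) xs)"
  unfolding contract_def
  by (rule tensor_eq_list_sum[OF tensor_eq.sym[OF tensor_eq_rep[OF assms]] A.is_abelian_group])
    (simp_all add: A.smult_add_right A.smult_add_left A.smult_smult star_alg_homD[OF \<phi>] mult.commute)

lemma contract_elem: "v \<in> carrier A \<Longrightarrow> w \<in> carrier B \<Longrightarrow> contract \<phi> (elem v w) = \<phi> w \<odot>\<^bsub>A\<^esub> v"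
  by (simp add: tensor_elem_def contract_cls)

lemma contract_zero: "contract \<phi> \<zero>\<^bsub>T\<^esub> = \<zero>\<^bsub>A\<^esub>"
  by (simp add: tensor_simps contract_cls)

lemma contract_closed: "X \<in> carrier T \<Longrightarrow> contract \<phi> X \<in> carrier A"
proof -
  assume "X \<in> carrier T"
  then obtain xs where X: "X = cls xs" "xs \<in> tensors" by (auto simp: tensor_simps(1))
  have "set (map (\<lambda>(v, w). \<phi> w \<odot>\<^bsub>A\<^esub> v) xs) \<subseteq> carrier A" using X(2) by auto
  then show ?thesis using X by (simp add: contract_cls del: set_map)
qed

lemma contract_add:
  assumes "X \<in> carrier T" "Y \<in> carrier T"
  shows "contract \<phi> (X \<oplus>\<^bsub>T\<^esub> Y) = contract \<phi> X \<oplus>\<^bsub>A\<^esub> contract \<phi> Y"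
proof -
  obtain xs ys where X: "X = cls xs" "xs \<in> tensors" and Y: "Y = cls ys" "ys \<in> tensors"
    using assms by (auto simp: tensor_simps(1))
  have "set (map (\<lambda>(v, w). \<phi> w \<odot>\<^bsub>A\<^esub> v) xs) \<subseteq> carrier A" "set (map (\<lambda>(v, w). \<phi> w \<odot>\<^bsub>A\<^esub> v) ys) \<subseteq> carrier A"
    using X(2) Y(2) by auto
  then show ?thesis
    using X Y by (simp add: contract_cls tensor_simps A.list_sum_append del: set_map)
qed

lemma contract_hom: "contract \<phi> \<in> star_alg_hom T A"
proof (rule star_alg_homI)
  interpret T: star_algebra T by (rule tensor_star_algebra)
  note [simp] = contract_closed contract_add contract_elem contract_zero star_alg_homD[OF \<phi>]
  show "contract \<phi> \<one>\<^bsub>T\<^esub> = \<one>\<^bsub>A\<^esub>" by (simp add: elem_one[symmetric])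
  fix X assume X: "X \<in> carrier T"
  from X show "contract \<phi> (c \<odot>\<^bsub>T\<^esub> X) = c \<odot>\<^bsub>A\<^esub> contract \<phi> X" for c
    by (induction rule: tensor_induct)
      (simp_all add: T.smult_add_right A.smult_add_right elem_smult_left[symmetric] A.smult_smult
        mult.commute)
  from X show "contract \<phi> (star T X) = star A (contract \<phi> X)"
    by (induction rule: tensor_induct)
      (simp_all add: T.star_add A.star_add elem_star A.star_smult)
  fix Y assume Y: "Y \<in> carrier T"
  have *: "contract \<phi> (elem v w \<otimes>\<^bsub>T\<^esub> Y) = contract \<phi> (elem v w) \<otimes>\<^bsub>A\<^esub> contract \<phi> Y"
    if "v \<in> carrier A" "w \<in> carrier B" for v w
    using Y
    by (induction rule: tensor_induct)
      (use that in \<open>simp_all add: T.r_distr A.r_distr elem_mult A.smult_mult_left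
          A.smult_mult_right A.smult_smult mult.commute\<close>)
  from X show "contract \<phi> (X \<otimes>\<^bsub>T\<^esub> Y) = contract \<phi> X \<otimes>\<^bsub>A\<^esub> contract \<phi> Y"
    by (induction rule: tensor_induct) (simp_all add: T.l_distr A.l_distr Y *)
qed (simp_all add: contract_closed contract_add)

end

lemma tensor_map_elem:
  assumes "star_algebra C" "star_algebra D" "f \<in> linear_maps A C" "g \<in> linear_maps B D"
    and "v \<in> carrier A" "w \<in> carrier B"
  shows "tensor_map C D f g (elem v w) = tensor_elem C D (f v) (g w)"
proof -
  interpret CD: tensor_pair C D
    by (rule tensor_pair.intro[OF assms(1,2)])
  have rep: "tensor_eq A B (rep (elem v w)) [(v, w)]"
    unfolding tensor_elem_def using assms(5,6) by (intro tensor_eq.sym[OF tensor_eq_rep]) simp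
  have "tensor_eq C D (map (\<lambda>(v, w). (f v, g w)) (rep (elem v w))) (map (\<lambda>(v, w). (f v, g w)) [(v, w)])"
    using assms(3,4)
    by (intro tensor_eq_map[where \<gamma> = id, OF rep assms(1,2)]) (auto simp: linear_maps_def Pi_iff)
  from CD.cls_eqI[OF this] show ?thesis by (simp add: tensor_map_def tensor_elem_def)
qed

end

lemma mult_map_elem:
  assumes "star_algebra A" "v \<in> carrier A" "w \<in> carrier A"
  shows "mult_map A (tensor_elem A A v w) = v \<otimes>\<^bsub>A\<^esub> w"
proof -
  interpret tensor_pair A A by (rule tensor_pair.intro[OF assms(1,1)])
  have rep: "tensor_eq A A (rep (elem v w)) [(v, w)]"
    unfolding tensor_elem_def using assms by (intro tensor_eq.sym[OF tensor_eq_rep]) simp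
  have "mult_map A (elem v w) = list_sum A (map (\<lambda>(v, w). v \<otimes>\<^bsub>A\<^esub> w) [(v, w)])"
    unfolding mult_map_def
    by (rule tensor_eq_list_sum[OF rep A.is_abelian_group])
      (simp_all add: A.l_distr A.r_distr A.smult_mult_left A.smult_mult_right)
  then show ?thesis using assms by simp
qed

section \<open>Separation of degrees\<close>

text \<open>The sums of elements of the \<open>M i\<close>. When each \<open>M i\<close> is closed under addition, the
  summands with the same index can be collected.\<close>

inductive_set graded_sums :: "('a, 'm) ring_scheme \<Rightarrow> ('i \<Rightarrow> 'a set) \<Rightarrow> 'a set"
  for R :: "('a, 'm) ring_scheme" and M :: "'i \<Rightarrow> 'a set" where
  zero: "\<zero>\<^bsub>R\<^esub> \<in> graded_sums R M"
| incl: "x \<in> M i \<Longrightarrow> x \<in> graded_sums R M"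
| add: "x \<in> graded_sums R M \<Longrightarrow> y \<in> graded_sums R M \<Longrightarrow> x \<oplus>\<^bsub>R\<^esub> y \<in> graded_sums R M"

lemma graded_sums_eq_finsum:
  fixes R (structure)
  assumes "abelian_group R" "\<And>i. M i \<subseteq> carrier R" "\<And>i. \<zero> \<in> M i"
    and "\<And>i x y. x \<in> M i \<Longrightarrow> y \<in> M i \<Longrightarrow> x \<oplus> y \<in> M i"
    and "v \<in> graded_sums R M"
  obtains F f where "finite F" "\<And>i. f i \<in> M i" "v = (\<Oplus>i\<in>F. f i)"
proof -
  interpret abelian_group R by fact
  have "\<exists>F f. finite F \<and> (\<forall>i. f i \<in> M i) \<and> (\<forall>i. i \<notin> F \<longrightarrow> f i = \<zero>) \<and> v = (\<Oplus>i\<in>F. f i)"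
    using assms(5)
  proof induction
    case zero
    show ?case by (rule exI[of _ "{}"], rule exI[of _ "\<lambda>_. \<zero>"]) (simp add: assms)
  next
    case (incl x i)
    then have "x \<in> carrier R" using assms(2) by blast
    then show ?case
      by (intro exI[of _ "{i}"] exI[of _ "\<lambda>j. if j = i then x else \<zero>"]) (simp add: assms incl)
  next
    case (add x y)
    then obtain F f G g where F: "finite F" "\<And>i. f i \<in> M i" "\<And>i. i \<notin> F \<Longrightarrow> f i = \<zero>" "x = (\<Oplus>i\<in>F. f i)"
      and G: "finite G" "\<And>i. g i \<in> M i" "\<And>i. i \<notin> G \<Longrightarrow> g i = \<zero>" "y = (\<Oplus>i\<in>G. g i)"
      by metis
    have c: "f i \<in> carrier R" "g i \<in> carrier R" for i
      using F(2) G(2) assms(2) by blast+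
    have "x = (\<Oplus>i\<in>F \<union> G. f i)" "y = (\<Oplus>i\<in>F \<union> G. g i)"
      unfolding F(4) G(4) using F G c
      by (auto intro!: add.finprod_mono_neutral_cong)
    then have "x \<oplus> y = (\<Oplus>i\<in>F \<union> G. f i \<oplus> g i)" using c by (simp add: finsum_addf)
    with F G show ?case
      by (intro exI[of _ "F \<union> G"] exI[of _ "\<lambda>i. f i \<oplus> g i"]) (simp add: assms)
  qed
  then show ?thesis using that by metis
qed

lemma cis_irrational_neq_one:
  assumes "\<theta> \<notin> \<rat>" "d \<noteq> (0::int)"
  shows "cis (d * (2 * pi * \<theta>)) \<noteq> 1"
proof
  assume "cis (d * (2 * pi * \<theta>)) = 1"
  then have "cos (d * (2 * pi * \<theta>)) = 1" by (metis cis.sel(1) one_complex.sel(1))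
  then obtain n :: int where "d * (2 * pi * \<theta>) = real_of_int n * 2 * pi" using cos_one_2pi_int by blast
  then have "\<theta> = n / d" using assms(2) by (simp add: field_simps)
  then show False using assms(1) by auto
qed

text \<open>The characters \<open>s \<mapsto> cis (d s)\<close> are linearly independent. The step compares the
  relation at \<open>s\<close> and at \<open>s + 2 \<pi> \<theta>\<close> to eliminate one of the summands.\<close>

lemma (in star_algebra) cis_separation:
  fixes F :: "int set" and \<theta> :: real
  assumes "\<theta> \<notin> \<rat>" "finite F" "f \<in> F \<rightarrow> carrier A"
    and "\<And>s::real. (\<Oplus>d\<in>F. cis (d * s) \<odot> f d) = \<zero>" and "d \<in> F"
  shows "f d = \<zero>"
  using assms(2-)
proof (induction F arbitrary: f d rule: finite_induct)
  case (insert m F)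
  define t where "t = 2 * pi * \<theta>"
  define c where "c d = cis ((d - m) * t) - 1" for d :: int
  have f: "f m \<in> carrier A" "\<And>d. d \<in> F \<Longrightarrow> f d \<in> carrier A" using insert.prems by auto
  have rel: "cis (m * s) \<odot> f m \<oplus> (\<Oplus>d\<in>F. cis (d * s) \<odot> f d) = \<zero>" for s :: real
    using insert.prems(2)[of s] insert.hyps f by (simp add: Pi_iff)
  have "(\<Oplus>d\<in>F. cis (d * s) \<odot> (c d \<odot> f d)) = \<zero>" for s :: real
  proof -
    have "\<zero> = cis (- (m * t)) \<odot> (cis (m * (s + t)) \<odot> f m \<oplus> (\<Oplus>d\<in>F. cis (d * (s + t)) \<odot> f d))"
      by (simp add: rel)
    also have "\<dots> = cis (m * s) \<odot> f m \<oplus> (\<Oplus>d\<in>F. (cis (- (m * t)) * cis (d * (s + t))) \<odot> f d)"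
      using f insert.hyps
      by (simp add: smult_add_right smult_smult smult_finsum Pi_iff cis_mult algebra_simps
          cong: finsum_cong)
    also have "\<dots> = cis (m * s) \<odot> f m \<oplus> (\<Oplus>d\<in>F. cis (d * s) \<odot> f d \<oplus> cis (d * s) \<odot> (c d \<odot> f d))"
      using f
      by (intro arg_cong2[of _ _ _ _ "add A"] finsum_cong' refl)
        (auto simp: smult_smult smult_add_left[symmetric] c_def cis_mult algebra_simps)
    also have "\<dots> = (cis (m * s) \<odot> f m \<oplus> (\<Oplus>d\<in>F. cis (d * s) \<odot> f d))
        \<oplus> (\<Oplus>d\<in>F. cis (d * s) \<odot> (c d \<odot> f d))"
      using f by (simp add: finsum_addf Pi_iff a_assoc)
    also have "\<dots> = (\<Oplus>d\<in>F. cis (d * s) \<odot> (c d \<odot> f d))"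
      using f by (simp add: rel Pi_iff)
    finally show ?thesis by simp
  qed
  then have "c d \<odot> f d = \<zero>" if "d \<in> F" for d
    using insert.IH[of "\<lambda>d. c d \<odot> f d" d] f that by auto
  moreover have "c d \<noteq> 0" if "d \<in> F" for d
    using cis_irrational_neq_one[OF assms(1), of "d - m"] that insert.hyps
    by (auto simp: c_def t_def)
  ultimately have F: "f d = \<zero>" if "d \<in> F" for d
    using that f smult_eq_zero_iff by blast
  have "f m = \<zero>" using rel[of 0] f F by (simp cong: finsum_cong)
  with F insert.prems show ?case by auto
qed simp

section \<open>The circle and its cyclic quotients\<close>

lemma eval_term_pow:
  assumes "star_algebra A" "eval_term A \<phi> t \<in> carrier A"
  shows "eval_term A \<phi> (term_pow t n) = eval_term A \<phi> t [^]\<^bsub>A\<^esub> n"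
proof -
  interpret star_algebra A by fact
  show ?thesis
  proof (induction n)
    case (Suc n)
    then show ?case using nat_pow_Suc2[OF assms(2), of n] by simp
  qed simp
qed

lemma complex_alg_pow: "x [^]\<^bsub>complex_alg\<^esub> (n::nat) = x ^ n"
  by (induction n) (simp_all add: nat_pow_def)

interpretation circle: star_algebra circle_alg
  unfolding circle_alg_def by (rule presented_star_algebra)

lemma circle_u_closed [simp, intro]: "circle_u \<in> carrier circle_alg"
  by (simp add: circle_u_def circle_alg_def presented_simps)

lemma circle_generated: "carrier circle_alg = star_gen circle_alg {circle_u}"
proof -
  have "range (\<lambda>g. pres_class circle_rels (Gen g)) = {circle_u}"
  proof -
    have *: "(UNIV :: u_gen set) = {U}" using u_gen.exhaust by blast
    show ?thesis unfolding * circle_u_def by simp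
  qed
  then show ?thesis using presented_generated[of circle_rels] by (simp add: circle_alg_def)
qed

lemma circle_u_unitary [simp]:
  "circle_u \<otimes>\<^bsub>circle_alg\<^esub> star circle_alg circle_u = \<one>\<^bsub>circle_alg\<^esub>"
  "star circle_alg circle_u \<otimes>\<^bsub>circle_alg\<^esub> circle_u = \<one>\<^bsub>circle_alg\<^esub>"
  unfolding circle_u_def circle_alg_def presented_simps
  by (rule pres_eq_imp_class_eq, rule pres_eq.rel, simp add: circle_rels_def)+

lemma circle_hom:
  assumes "star_algebra A" "x \<in> carrier A"
    and "x \<otimes>\<^bsub>A\<^esub> star A x = \<one>\<^bsub>A\<^esub>" "star A x \<otimes>\<^bsub>A\<^esub> x = \<one>\<^bsub>A\<^esub>"
  shows "pres_map A (\<lambda>_. x) \<in> star_alg_hom circle_alg A" "pres_map A (\<lambda>_. x) circle_u = x"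
proof -
  have rels: "eval_term A (\<lambda>_. x) s = eval_term A (\<lambda>_. x) t" if "(s, t) \<in> circle_rels" for s t
    using that assms by (auto simp: circle_rels_def)
  show "pres_map A (\<lambda>_. x) \<in> star_alg_hom circle_alg A"
    unfolding circle_alg_def by (rule pres_hom) (use assms rels in auto)
  show "pres_map A (\<lambda>_. x) circle_u = x"
    unfolding circle_u_def by (subst pres_map_class[where A = A]) (use assms rels in auto)
qed

lemma cis_mult_cnj [simp]: "cis t * cnj (cis t) = 1" "cnj (cis t) * cis t = 1"
  by (simp_all add: cis_cnj cis_mult)

definition circle_ev :: "real \<Rightarrow> u_gen sterm set \<Rightarrow> complex" where
  "circle_ev t = pres_map complex_alg (\<lambda>_. cis t)"

lemma circle_ev:
  "circle_ev t \<in> star_alg_hom circle_alg complex_alg" "circle_ev t circle_u = cis t"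
  unfolding circle_ev_def
  by (rule circle_hom[OF complex_alg_star_algebra]; simp)+

interpretation cyclic: star_algebra "cyclic_alg m" for m
  unfolding cyclic_alg_def by (rule presented_star_algebra)

lemma cyclic_u_closed [simp, intro]: "cyclic_u m \<in> carrier (cyclic_alg m)"
  by (simp add: cyclic_u_def cyclic_alg_def presented_simps)

lemma cyclic_u_unitary [simp]:
  "cyclic_u m \<otimes>\<^bsub>cyclic_alg m\<^esub> star (cyclic_alg m) (cyclic_u m) = \<one>\<^bsub>cyclic_alg m\<^esub>"
  "star (cyclic_alg m) (cyclic_u m) \<otimes>\<^bsub>cyclic_alg m\<^esub> cyclic_u m = \<one>\<^bsub>cyclic_alg m\<^esub>"
  unfolding cyclic_u_def cyclic_alg_def presented_simps
  by (rule pres_eq_imp_class_eq, rule pres_eq.rel, simp add: cyclic_rels_def circle_rels_def)+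

lemma cyclic_u_pow: "cyclic_u m [^]\<^bsub>cyclic_alg m\<^esub> m = \<one>\<^bsub>cyclic_alg m\<^esub>"
proof -
  have "cyclic_u m [^]\<^bsub>cyclic_alg m\<^esub> n = pres_class (cyclic_rels m) (term_pow (Gen U) n)" for n
  proof (induction n)
    case (Suc n)
    then show ?case
      using cyclic.nat_pow_Suc2[OF cyclic_u_closed, of m n]
      by (simp add: cyclic_u_def cyclic_alg_def presented_simps)
  qed (simp add: cyclic_alg_def presented_simps)
  moreover have "pres_class (cyclic_rels m) (term_pow (Gen U) m) = pres_class (cyclic_rels m) One"
    by (rule pres_eq_imp_class_eq, rule pres_eq.rel) (simp add: cyclic_rels_def)
  ultimately show ?thesis by (simp add: cyclic_alg_def presented_simps)
qed

lemma cyclic_ev: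
  assumes "0 < m"
  obtains \<phi> where "\<phi> \<in> star_alg_hom (cyclic_alg m) complex_alg" "\<phi> (cyclic_u m) = cis (2 * pi / m)"
proof
  let ?z = "cis (2 * pi / m)"
  have rels: "eval_term complex_alg (\<lambda>_. ?z) s = eval_term complex_alg (\<lambda>_. ?z) t"
    if "(s, t) \<in> cyclic_rels m" for s t
    using that assms
    by (auto simp: cyclic_rels_def circle_rels_def eval_term_pow[OF complex_alg_star_algebra]
        complex_alg_pow DeMoivre)
  show "pres_map complex_alg (\<lambda>_. ?z) \<in> star_alg_hom (cyclic_alg m) complex_alg"
    unfolding cyclic_alg_def by (rule pres_hom[OF complex_alg_star_algebra]) (use rels in auto)
  show "pres_map complex_alg (\<lambda>_. ?z) (cyclic_u m) = ?z"
    unfolding cyclic_u_def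
    by (subst pres_map_class[OF complex_alg_star_algebra]) (use rels in auto)
qed

lemma circle_comult: "comult circle_hopf circle_u = tensor_elem circle_alg circle_alg circle_u circle_u"
proof -
  interpret tensor_pair circle_alg circle_alg
    by (rule tensor_pair.intro; rule circle.star_algebra_axioms)
  show ?thesis
    unfolding circle_hopf_def
    by (simp, rule circle_hom(2)[OF tensor_star_algebra]) (simp_all add: elem_star elem_mult elem_one)
qed

text \<open>Since \<open>u\<close> is group-like, the values at \<open>u\<close> of a cleaving map and of its convolution inverse
  are inverse to each other.\<close>

lemma cleft_circle_unit:
  assumes "star_algebra A" "cleft circle_hopf A \<delta>"
  obtains v w where "v \<in> carrier A" "w \<in> carrier A" "v \<otimes>\<^bsub>A\<^esub> w = \<one>\<^bsub>A\<^esub>" "w \<otimes>\<^bsub>A\<^esub> v = \<one>\<^bsub>A\<^esub>"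
    "\<delta> v = tensor_elem A circle_alg v circle_u"
proof -
  interpret A: star_algebra A by fact
  interpret CC: tensor_pair circle_alg circle_alg
    by (rule tensor_pair.intro; rule circle.star_algebra_axioms)
  have alg [simp]: "alg circle_hopf = circle_alg" by (simp add: circle_hopf_def)
  have counit: "counit circle_hopf circle_u = 1"
    using circle_ev(2)[of 0] by (simp add: circle_hopf_def circle_ev_def)
  obtain j g where j: "j \<in> linear_maps circle_alg A" and g: "g \<in> linear_maps circle_alg A"
    and jg: "convolution circle_hopf A j g circle_u = \<one>\<^bsub>A\<^esub>" "convolution circle_hopf A g j circle_u = \<one>\<^bsub>A\<^esub>"
    and co: "\<delta> (j circle_u) = tensor_map A circle_alg j id (comult circle_hopf circle_u)"
    using assms(2) counit
    by (auto simp: cleft_def comodule_maps_def convolution_invertible_def)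
  have cl: "j circle_u \<in> carrier A" "g circle_u \<in> carrier A"
    using j g by (auto simp: linear_maps_def)
  have id: "id \<in> linear_maps circle_alg circle_alg" by (simp add: linear_maps_def)
  show thesis
  proof (rule that[OF cl])
    show "j circle_u \<otimes>\<^bsub>A\<^esub> g circle_u = \<one>\<^bsub>A\<^esub>" "g circle_u \<otimes>\<^bsub>A\<^esub> j circle_u = \<one>\<^bsub>A\<^esub>"
      using jg j g cl
      by (simp_all add: convolution_def circle_comult CC.tensor_map_elem[OF assms(1,1)]
          mult_map_elem[OF assms(1)])
    show "\<delta> (j circle_u) = tensor_elem A circle_alg (j circle_u) circle_u"
      using co j id
      by (simp add: circle_comult CC.tensor_map_elem[OF assms(1) circle.star_algebra_axioms])
  qed
qed

section \<open>Pairs of elements that satisfy the relations of the quantum sphere\<close>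

locale sphere_pair = star_algebra S for S (structure) +
  fixes a b and p q \<theta> :: real
  assumes a [simp, intro]: "a \<in> carrier S" and b [simp, intro]: "b \<in> carrier S"
    and ab: "a \<otimes> b = cis (2 * pi * \<theta>) \<odot> (b \<otimes> a)"
    and ab': "a \<otimes> star S b = cis (- (2 * pi * \<theta>)) \<odot> (star S b \<otimes> a)"
    and aa: "star S a \<otimes> a = (1 - p) \<odot> \<one> \<oplus> p \<odot> (a \<otimes> star S a)"
    and bb: "star S b \<otimes> b = (1 - q) \<odot> \<one> \<oplus> q \<odot> (b \<otimes> star S b)"
    and orth: "(\<one> \<oplus> (-1) \<odot> (a \<otimes> star S a)) \<otimes> (\<one> \<oplus> (-1) \<odot> (b \<otimes> star S b)) = \<zero>"

lemma (in star_algebra) add_smult_eq_iff: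
  assumes "x \<in> carrier A" "y \<in> carrier A" "z \<in> carrier A"
  shows "x \<oplus> (-1) \<odot> y = z \<longleftrightarrow> x = z \<oplus> y"
proof -
  have 1: "(-1) \<odot> y \<oplus> y = \<zero>" using assms smult_add_left[of y "-1" 1] by simp
  then have 2: "y \<oplus> (-1) \<odot> y = \<zero>" using assms by (simp add: a_comm)
  show ?thesis
  proof
    assume "x \<oplus> (-1) \<odot> y = z"
    then have "z \<oplus> y = x \<oplus> ((-1) \<odot> y \<oplus> y)" using assms a_assoc by auto
    then show "x = z \<oplus> y" using assms 1 by simp
  next
    assume "x = z \<oplus> y"
    then have "x \<oplus> (-1) \<odot> y = z \<oplus> (y \<oplus> (-1) \<odot> y)" using assms a_assoc by auto
    then show "x \<oplus> (-1) \<odot> y = z" using assms 2 by simp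
  qed
qed

lemma exp_cis:
  "exp (2 * complex_of_real pi * \<i> * complex_of_real \<theta>) = cis (2 * pi * \<theta>)"
  "exp (- (2 * complex_of_real pi * \<i> * complex_of_real \<theta>)) = cis (- (2 * pi * \<theta>))"
  by (simp_all add: cis_conv_exp mult_ac)

context
  fixes p q \<theta> :: real
begin

interpretation S: star_algebra "s3 p q \<theta>"
  unfolding s3_def by (rule presented_star_algebra)

lemma s3_sphere_pair: "sphere_pair (s3 p q \<theta>) (s3_a p q \<theta>) (s3_b p q \<theta>) p q \<theta>"
proof
  let ?S = "s3 p q \<theta>" and ?a = "s3_a p q \<theta>" and ?b = "s3_b p q \<theta>"
  have rel: "pres_class (s3_rels p q \<theta>) s = pres_class (s3_rels p q \<theta>) t" if "(s, t) \<in> s3_rels p q \<theta>" for s t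
    by (rule pres_eq_imp_class_eq, rule pres_eq.rel, rule that)
  show ab: "?a \<in> carrier ?S" "?b \<in> carrier ?S"
    by (simp_all add: s3_a_def s3_b_def s3_def presented_simps)
  note * = s3_a_def s3_b_def s3_def presented_simps
  have "star ?S ?a \<otimes>\<^bsub>?S\<^esub> ?a \<oplus>\<^bsub>?S\<^esub> (-1) \<odot>\<^bsub>?S\<^esub> (p \<odot>\<^bsub>?S\<^esub> (?a \<otimes>\<^bsub>?S\<^esub> star ?S ?a)) = (1 - p) \<odot>\<^bsub>?S\<^esub> \<one>\<^bsub>?S\<^esub>"
    unfolding * by (rule rel) (simp add: s3_rels_def Let_def)
  then show "star ?S ?a \<otimes>\<^bsub>?S\<^esub> ?a = (1 - p) \<odot>\<^bsub>?S\<^esub> \<one>\<^bsub>?S\<^esub> \<oplus>\<^bsub>?S\<^esub> p \<odot>\<^bsub>?S\<^esub> (?a \<otimes>\<^bsub>?S\<^esub> star ?S ?a)"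
    by (subst (asm) S.add_smult_eq_iff) (simp_all add: ab)
  have "star ?S ?b \<otimes>\<^bsub>?S\<^esub> ?b \<oplus>\<^bsub>?S\<^esub> (-1) \<odot>\<^bsub>?S\<^esub> (q \<odot>\<^bsub>?S\<^esub> (?b \<otimes>\<^bsub>?S\<^esub> star ?S ?b)) = (1 - q) \<odot>\<^bsub>?S\<^esub> \<one>\<^bsub>?S\<^esub>"
    unfolding * by (rule rel) (simp add: s3_rels_def Let_def)
  then show "star ?S ?b \<otimes>\<^bsub>?S\<^esub> ?b = (1 - q) \<odot>\<^bsub>?S\<^esub> \<one>\<^bsub>?S\<^esub> \<oplus>\<^bsub>?S\<^esub> q \<odot>\<^bsub>?S\<^esub> (?b \<otimes>\<^bsub>?S\<^esub> star ?S ?b)"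
    by (subst (asm) S.add_smult_eq_iff) (simp_all add: ab)
qed (unfold s3_a_def s3_b_def s3_def presented_simps,
    (rule pres_eq_imp_class_eq, rule pres_eq.rel, simp add: s3_rels_def Let_def exp_cis)+)

text \<open>The universal property of the quantum sphere.\<close>

lemma s3_hom:
  assumes "sphere_pair B \<alpha> \<beta> p q \<theta>"
  shows "pres_map B (case_s3_gen \<alpha> \<beta>) \<in> star_alg_hom (s3 p q \<theta>) B"
    and "pres_map B (case_s3_gen \<alpha> \<beta>) (s3_a p q \<theta>) = \<alpha>"
    and "pres_map B (case_s3_gen \<alpha> \<beta>) (s3_b p q \<theta>) = \<beta>"
proof -
  interpret B: sphere_pair B \<alpha> \<beta> p q \<theta> by fact
  have closed: "case_s3_gen \<alpha> \<beta> g \<in> carrier B" for g by (cases g) auto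
  have rels: "eval_term B (case_s3_gen \<alpha> \<beta>) s = eval_term B (case_s3_gen \<alpha> \<beta>) t"
    if "(s, t) \<in> s3_rels p q \<theta>" for s t
    using that B.ab B.ab' B.aa B.bb B.orth
    by (auto simp: s3_rels_def Let_def exp_cis B.add_smult_eq_iff)
  note * = B.star_algebra_axioms closed rels
  show "pres_map B (case_s3_gen \<alpha> \<beta>) \<in> star_alg_hom (s3 p q \<theta>) B"
    unfolding s3_def by (rule pres_hom[where \<phi> = "case_s3_gen \<alpha> \<beta>", OF *])
  show "pres_map B (case_s3_gen \<alpha> \<beta>) (s3_a p q \<theta>) = \<alpha>" "pres_map B (case_s3_gen \<alpha> \<beta>) (s3_b p q \<theta>) = \<beta>"
    unfolding s3_a_def s3_b_def by (subst pres_map_class[where \<phi> = "case_s3_gen \<alpha> \<beta>", OF *]; simp)+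
qed

lemma s3_generated: "carrier (s3 p q \<theta>) = star_gen (s3 p q \<theta>) {s3_a p q \<theta>, s3_b p q \<theta>}"
proof -
  have "range (\<lambda>g. pres_class (s3_rels p q \<theta>) (Gen g)) = {s3_a p q \<theta>, s3_b p q \<theta>}"
  proof -
    have *: "(UNIV :: s3_gen set) = {Ga, Gb}" using s3_gen.exhaust by blast
    show ?thesis unfolding * s3_a_def s3_b_def by simp
  qed
  then show ?thesis using presented_generated[of "s3_rels p q \<theta>"] by (simp add: s3_def)
qed

end

section \<open>A spanning set of the quantum sphere\<close>

context star_algebra
begin

text \<open>The defect of \<open>x\<close> from being a coisometry; on the sphere these are \<open>A\<close> and \<open>B\<close>.\<close>

definition defect :: "'a \<Rightarrow> 'a" where
  "defect x = \<one> \<oplus> (-1) \<odot> (x \<otimes> star A x)"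

text \<open>Powers with integer exponents, in which \<open>star\<close> replaces the inverse.\<close>

definition zpow :: "'a \<Rightarrow> int \<Rightarrow> 'a" where
  "zpow x i = (if 0 \<le> i then x [^] nat i else star A x [^] nat (- i))"

lemma defect_closed [simp, intro]: "x \<in> carrier A \<Longrightarrow> defect x \<in> carrier A"
  by (simp add: defect_def)

lemma zpow_closed [simp, intro]: "x \<in> carrier A \<Longrightarrow> zpow x i \<in> carrier A"
  by (simp add: zpow_def del: pow_nat)

lemma star_defect: "x \<in> carrier A \<Longrightarrow> star A (defect x) = defect x"
  by (simp add: defect_def star_add star_smult star_mult)

lemma one_minus_one_plus: "x \<in> carrier A \<Longrightarrow> \<one> \<oplus> (-1) \<odot> (\<one> \<oplus> (-1) \<odot> x) = x"
proof -
  assume x: "x \<in> carrier A"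
  have "\<one> \<oplus> (-1) \<odot> (\<one> \<oplus> (-1) \<odot> x) = (1 \<odot> \<one> \<oplus> (-1) \<odot> \<one>) \<oplus> x"
    using x by (simp add: smult_add_right smult_smult a_assoc)
  also have "\<dots> = x" using x by (simp only: smult_add_left[symmetric] one_closed) simp
  finally show ?thesis .
qed

lemma mult_star_eq: "x \<in> carrier A \<Longrightarrow> x \<otimes> star A x = \<one> \<oplus> (-1) \<odot> defect x"
  by (simp add: defect_def one_minus_one_plus)

lemma zpow_nonneg_Suc:
  "x \<in> carrier A \<Longrightarrow> 0 \<le> i \<Longrightarrow> x \<otimes> zpow x i = zpow x (i + 1)"
  using nat_pow_Suc2[of x "nat i"] by (simp add: zpow_def nat_add_distrib del: pow_nat)

lemma zpow_neg:
  assumes "x \<in> carrier A" "i < 0"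
  shows "zpow x i = star A x \<otimes> zpow x (i + 1)"
proof -
  have "nat (- i) = Suc (nat (- (i + 1)))" using assms(2) by simp
  then show ?thesis
    using assms nat_pow_Suc2[of "star A x" "nat (- (i + 1))"] by (auto simp: zpow_def simp del: pow_nat)
qed

lemma commute_pow:
  assumes "x \<in> carrier A" "y \<in> carrier A" "x \<otimes> y = c \<odot> (y \<otimes> x)"
  shows "x \<otimes> y [^] (n::nat) = (c ^ n) \<odot> (y [^] n \<otimes> x)"
proof (induction n)
  case (Suc n)
  have "x \<otimes> y [^] Suc n = (x \<otimes> y [^] n) \<otimes> y" using assms by (simp add: m_assoc)
  also have "\<dots> = (c ^ n) \<odot> (y [^] n \<otimes> (x \<otimes> y))"
    unfolding Suc using assms(1,2) by (simp add: smult_mult_left m_assoc)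
  also have "\<dots> = (c ^ Suc n) \<odot> (y [^] Suc n \<otimes> x)"
    unfolding assms(3) using assms(1,2) by (simp add: smult_mult_right smult_smult m_assoc mult.commute)
  finally show ?case .
qed (use assms in simp)

end

context sphere_pair
begin

text \<open>The relations are symmetric in \<open>a\<close> and \<open>b\<close> when \<open>\<theta>\<close> changes its sign. So facts about
  \<open>b\<close> are instances of facts about \<open>a\<close>.\<close>

lemma swap: "sphere_pair S b a q p (- \<theta>)"
proof
  show "b \<otimes> a = cis (2 * pi * - \<theta>) \<odot> (a \<otimes> b)"
    by (simp add: ab smult_smult cis_mult)
  have "b \<otimes> star S a = star S (a \<otimes> star S b)" by (simp add: star_mult)
  also have "\<dots> = cis (- (2 * pi * - \<theta>)) \<odot> (star S a \<otimes> b)"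
    by (simp add: ab' star_smult star_mult cis_cnj)
  finally show "b \<otimes> star S a = cis (- (2 * pi * - \<theta>)) \<odot> (star S a \<otimes> b)" .
  have "star S (defect a \<otimes> defect b) = \<zero>" using orth by (simp add: defect_def)
  then show "(\<one> \<oplus> (-1) \<odot> (b \<otimes> star S b)) \<otimes> (\<one> \<oplus> (-1) \<odot> (a \<otimes> star S a)) = \<zero>"
    by (simp add: star_mult star_defect) (simp add: defect_def)
qed (use aa bb in auto)

lemma star_a_a: "star S a \<otimes> a = \<one> \<oplus> (- p) \<odot> defect a"
proof -
  have "\<one> \<oplus> (- p) \<odot> defect a = (1 \<odot> \<one> \<oplus> (- p) \<odot> \<one>) \<oplus> p \<odot> (a \<otimes> star S a)"
    by (simp add: defect_def smult_add_right smult_smult a_assoc)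
  also have "\<dots> = star S a \<otimes> a"
    by (simp only: smult_add_left[symmetric] one_closed aa) simp
  finally show ?thesis ..
qed

lemma defect_a_a: "defect a \<otimes> a = p \<odot> (a \<otimes> defect a)"
proof -
  have "defect a \<otimes> a = a \<oplus> (-1) \<odot> (a \<otimes> (star S a \<otimes> a))"
    by (simp add: defect_def l_distr smult_mult_left m_assoc)
  also have "\<dots> = (1 \<odot> a \<oplus> (-1) \<odot> a) \<oplus> p \<odot> (a \<otimes> defect a)"
    by (simp add: star_a_a r_distr smult_mult_right smult_add_right smult_smult a_assoc)
  also have "\<dots> = p \<odot> (a \<otimes> defect a)"
    by (simp only: smult_add_left[symmetric] a) simp
  finally show ?thesis .
qed

lemma a_defect_b: "a \<otimes> defect b = defect b \<otimes> a"
proof -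
  have "a \<otimes> (b \<otimes> star S b) = (a \<otimes> b) \<otimes> star S b" by (simp add: m_assoc)
  also have "\<dots> = cis (2 * pi * \<theta>) \<odot> (b \<otimes> (a \<otimes> star S b))"
    by (simp add: ab smult_mult_left m_assoc)
  also have "\<dots> = (b \<otimes> star S b) \<otimes> a"
    by (simp add: ab' smult_mult_right smult_smult cis_mult m_assoc)
  finally show ?thesis
    by (simp add: defect_def r_distr l_distr smult_mult_left smult_mult_right)
qed

lemma star_a_defect:
  "star S a \<otimes> defect a = p \<odot> (defect a \<otimes> star S a)"
  "star S a \<otimes> defect b = defect b \<otimes> star S a"
  using arg_cong[OF defect_a_a, of "star S"] arg_cong[OF a_defect_b, of "star S"]
  by (simp_all add: star_mult star_smult star_defect)

text \<open>The polynomials in \<open>A\<close> and \<open>B\<close>.\<close>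

inductive_set pol :: "'a set" where
  one: "\<one> \<in> pol"
| A: "defect a \<in> pol"
| B: "defect b \<in> pol"
| add: "x \<in> pol \<Longrightarrow> y \<in> pol \<Longrightarrow> x \<oplus> y \<in> pol"
| mult: "x \<in> pol \<Longrightarrow> y \<in> pol \<Longrightarrow> x \<otimes> y \<in> pol"
| smult: "x \<in> pol \<Longrightarrow> c \<odot> x \<in> pol"

lemma pol_closed [simp]: "x \<in> pol \<Longrightarrow> x \<in> carrier S"
  by (induction rule: pol.induct) auto

lemma pol_zero: "\<zero> \<in> pol"
  using pol.smult[OF pol.one, of 0] by simp

text \<open>Elements that can be moved past polynomials in \<open>A\<close> and \<open>B\<close>, at the price of changing the
  polynomial.\<close>

definition normal :: "'a set" where
  "normal = {g \<in> carrier S. \<forall>P\<in>pol. \<exists>Q\<in>pol. g \<otimes> P = Q \<otimes> g}"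

lemma normalI:
  assumes g: "g \<in> carrier S" and A: "g \<otimes> defect a = c \<odot> (defect a \<otimes> g)"
    and B: "g \<otimes> defect b = d \<odot> (defect b \<otimes> g)"
  shows "g \<in> normal"
proof -
  have "\<exists>Q\<in>pol. g \<otimes> P = Q \<otimes> g" if "P \<in> pol" for P
    using that
  proof induction
    case one
    show ?case by (rule bexI[OF _ pol.one]) (use g in simp)
  next
    case A
    show ?case
      by (intro bexI[of _ "c \<odot> defect a"] pol.smult pol.A) (use g assms in \<open>simp add: smult_mult_left\<close>)
  next
    case B
    show ?case
      by (intro bexI[of _ "d \<odot> defect b"] pol.smult pol.B) (use g assms in \<open>simp add: smult_mult_left\<close>)
  next
    case (add x y)
    then obtain x' y' where "x' \<in> pol" "y' \<in> pol" "g \<otimes> x = x' \<otimes> g" "g \<otimes> y = y' \<otimes> g" by blast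
    with add g show ?case
      by (intro bexI[of _ "x' \<oplus> y'"] pol.add) (simp_all add: l_distr r_distr)
  next
    case (mult x y)
    then obtain x' y' where *: "x' \<in> pol" "y' \<in> pol" "g \<otimes> x = x' \<otimes> g" "g \<otimes> y = y' \<otimes> g" by blast
    have "g \<otimes> (x \<otimes> y) = (g \<otimes> x) \<otimes> y" using g mult by (simp add: m_assoc)
    also have "\<dots> = x' \<otimes> (g \<otimes> y)" using * g mult by (simp add: m_assoc)
    also have "\<dots> = (x' \<otimes> y') \<otimes> g" unfolding *(4) using * g by (simp add: m_assoc)
    finally show ?case using * by (intro bexI[of _ "x' \<otimes> y'"] pol.mult)
  next
    case (smult x c)
    then obtain x' where "x' \<in> pol" "g \<otimes> x = x' \<otimes> g" by blast
    with smult g show ?case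
      by (intro bexI[of _ "c \<odot> x'"] pol.smult) (simp_all add: smult_mult_left smult_mult_right)
  qed
  with g show ?thesis unfolding normal_def by blast
qed

lemma normal_closed [simp]: "g \<in> normal \<Longrightarrow> g \<in> carrier S"
  by (simp add: normal_def)

lemma normal_mult: "g \<in> normal \<Longrightarrow> h \<in> normal \<Longrightarrow> g \<otimes> h \<in> normal"
proof -
  assume g: "g \<in> normal" and h: "h \<in> normal"
  have "\<exists>Q\<in>pol. g \<otimes> h \<otimes> P = Q \<otimes> (g \<otimes> h)" if P: "P \<in> pol" for P
  proof -
    obtain Q where Q: "Q \<in> pol" "h \<otimes> P = Q \<otimes> h" using h P unfolding normal_def by blast
    obtain R where R: "R \<in> pol" "g \<otimes> Q = R \<otimes> g" using g Q unfolding normal_def by blast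
    have "g \<otimes> h \<otimes> P = g \<otimes> (h \<otimes> P)" using g h P by (simp add: m_assoc)
    also have "\<dots> = (g \<otimes> Q) \<otimes> h" using g h Q by (simp add: m_assoc)
    also have "\<dots> = R \<otimes> (g \<otimes> h)" using g h Q R by (simp add: m_assoc)
    finally show ?thesis using R by blast
  qed
  moreover have "g \<otimes> h \<in> carrier S" using g h by simp
  ultimately show ?thesis unfolding normal_def by blast
qed

lemma normal_pow: "g \<in> normal \<Longrightarrow> g [^] (n::nat) \<in> normal"
proof (induction n)
  case 0
  have "\<one> \<otimes> P = P \<otimes> \<one>" if "P \<in> pol" for P using that by simp
  then show ?case unfolding normal_def nat_pow_0 by blast
next
  case (Suc n)
  then show ?case by (simp add: normal_mult)
qed

lemma normal_letters:
  assumes "p \<noteq> 0" "q \<noteq> 0"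
  shows "a \<in> normal" "star S a \<in> normal" "b \<in> normal" "star S b \<in> normal"
proof -
  interpret swap: sphere_pair S b a q p "- \<theta>" by (rule swap)
  show "a \<in> normal"
    by (rule normalI[of _ "1 / p" 1]) (use assms in \<open>simp_all add: defect_a_a a_defect_b smult_smult\<close>)
  show "star S a \<in> normal"
    by (rule normalI[of _ p 1]) (simp_all add: star_a_defect)
  show "b \<in> normal"
    by (rule normalI[of _ 1 "1 / q"])
      (use assms in \<open>simp_all add: swap.defect_a_a swap.a_defect_b smult_smult\<close>)
  show "star S b \<in> normal"
    by (rule normalI[of _ 1 q]) (simp_all add: swap.star_a_defect)
qed

lemma normal_zpow:
  assumes "p \<noteq> 0" "q \<noteq> 0"
  shows "zpow a i \<in> normal" "zpow b i \<in> normal"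
  using normal_letters[OF assms] by (auto simp: zpow_def normal_pow simp del: pow_nat)

lemma a_zpow: "\<exists>P\<in>pol. a \<otimes> zpow a i = P \<otimes> zpow a (i + 1)"
proof (cases "0 \<le> i")
  case True
  then show ?thesis by (intro bexI[OF _ pol.one]) (simp add: zpow_nonneg_Suc)
next
  case False
  then have "a \<otimes> zpow a i = (a \<otimes> star S a) \<otimes> zpow a (i + 1)"
    by (simp add: zpow_neg m_assoc)
  then show ?thesis
    by (intro bexI[of _ "a \<otimes> star S a"]) (simp_all add: mult_star_eq pol.intros)
qed

lemma star_a_zpow: "\<exists>P\<in>pol. star S a \<otimes> zpow a i = P \<otimes> zpow a (i - 1)"
proof (cases "i \<le> 0")
  case True
  then show ?thesis
    using zpow_neg[of a "i - 1"] by (intro bexI[OF _ pol.one]) simp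
next
  case False
  then have "star S a \<otimes> zpow a i = (star S a \<otimes> a) \<otimes> zpow a (i - 1)"
    using zpow_nonneg_Suc[of a "i - 1"] by (simp add: m_assoc)
  then show ?thesis
    by (intro bexI[of _ "star S a \<otimes> a"]) (simp_all add: star_a_a pol.intros)
qed

lemma b_zpow_a: "\<exists>c. b \<otimes> zpow a i = c \<odot> (zpow a i \<otimes> b)"
proof -
  interpret swap: sphere_pair S b a q p "- \<theta>" by (rule swap)
  show ?thesis
    using commute_pow[OF _ _ swap.ab, of "nat i"] commute_pow[OF _ _ swap.ab', of "nat (- i)"]
    by (auto simp: zpow_def simp del: pow_nat)
qed

lemma star_b_zpow_a: "\<exists>c. star S b \<otimes> zpow a i = c \<odot> (zpow a i \<otimes> star S b)"
proof -
  have 1: "star S b \<otimes> a = cis (2 * pi * \<theta>) \<odot> (a \<otimes> star S b)"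
    by (simp add: ab' smult_smult cis_mult)
  have "star S b \<otimes> star S a = star S (a \<otimes> b)" by (simp add: star_mult)
  then have 2: "star S b \<otimes> star S a = cis (- (2 * pi * \<theta>)) \<odot> (star S a \<otimes> star S b)"
    by (simp add: ab star_mult star_smult cis_cnj)
  show ?thesis
    using commute_pow[OF _ _ 1, of "nat i"] commute_pow[OF _ _ 2, of "nat (- i)"]
    by (auto simp: zpow_def simp del: pow_nat)
qed

text \<open>The part of bidegree \<open>(i, j)\<close>.\<close>

definition bihom :: "int \<times> int \<Rightarrow> 'a set" where
  "bihom = (\<lambda>(i, j). {P \<otimes> zpow a i \<otimes> zpow b j | P. P \<in> pol})"

lemma bihomI: "P \<in> pol \<Longrightarrow> P \<otimes> zpow a i \<otimes> zpow b j \<in> bihom (i, j)"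
  by (auto simp: bihom_def)

lemma bihom_closed: "bihom ij \<subseteq> carrier S"
  by (auto simp: bihom_def)

lemma bihom_add: "x \<in> bihom ij \<Longrightarrow> y \<in> bihom ij \<Longrightarrow> x \<oplus> y \<in> bihom ij"
proof -
  assume "x \<in> bihom ij" "y \<in> bihom ij"
  then obtain P Q where "P \<in> pol" "Q \<in> pol" "x = P \<otimes> zpow a (fst ij) \<otimes> zpow b (snd ij)"
    "y = Q \<otimes> zpow a (fst ij) \<otimes> zpow b (snd ij)"
    by (auto simp: bihom_def split_def)
  then have "x \<oplus> y = (P \<oplus> Q) \<otimes> zpow a (fst ij) \<otimes> zpow b (snd ij)" "P \<oplus> Q \<in> pol"
    by (auto simp: l_distr intro: pol.intros)
  then show ?thesis using bihomI[of "P \<oplus> Q" "fst ij" "snd ij"] by simp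
qed

lemma bihom_smult: "x \<in> bihom ij \<Longrightarrow> c \<odot> x \<in> bihom ij"
proof -
  assume "x \<in> bihom ij"
  then obtain P where "P \<in> pol" "x = P \<otimes> zpow a (fst ij) \<otimes> zpow b (snd ij)"
    by (auto simp: bihom_def split_def)
  then have "c \<odot> x = (c \<odot> P) \<otimes> zpow a (fst ij) \<otimes> zpow b (snd ij)" "c \<odot> P \<in> pol"
    by (auto simp: smult_mult_left intro: pol.intros)
  then show ?thesis using bihomI[of "c \<odot> P" "fst ij" "snd ij"] by simp
qed

lemma bihom_zero: "\<zero> \<in> bihom ij"
  using bihomI[OF pol_zero, of "fst ij" "snd ij"] by simp

text \<open>Left multiplication by \<open>a\<close>, \<open>b\<close> or an adjoint shifts the bidegree. A letter \<open>g\<close> passes the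
  polynomial and, if it is \<open>b\<close> or \<open>b\<^sup>*\<close>, the power of \<open>a\<close>; it is then absorbed in the
  power of its own kind, which may leave a factor \<open>1 - A\<close>, \<open>1 - p A\<close>, \<open>1 - B\<close>
  or \<open>1 - q B\<close>.\<close>

lemma letter_bihom:
  assumes "p \<noteq> 0" "q \<noteq> 0" "g \<in> {a, star S a, b, star S b}" "x \<in> bihom ij"
  shows "\<exists>ij'. g \<otimes> x \<in> bihom ij'"
proof -
  interpret swap: sphere_pair S b a q p "- \<theta>" by (rule swap)
  have swap_pol: "P \<in> pol" if "P \<in> swap.pol" for P
    using that by induction (simp_all add: pol.intros)
  obtain i j where ij: "ij = (i, j)" by (cases ij)
  obtain P where P: "P \<in> pol" and x: "x = P \<otimes> zpow a i \<otimes> zpow b j"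
    using assms(4) unfolding ij bihom_def by auto
  have g: "g \<in> normal" "g \<in> carrier S" using assms(3) normal_letters[OF assms(1,2)] by auto
  then obtain Q where Q: "Q \<in> pol" "g \<otimes> P = Q \<otimes> g" using P unfolding normal_def by blast
  have gx: "g \<otimes> x = Q \<otimes> (g \<otimes> zpow a i) \<otimes> zpow b j"
  proof -
    have "g \<otimes> x = (g \<otimes> P) \<otimes> zpow a i \<otimes> zpow b j" using P g by (simp add: x m_assoc)
    then show ?thesis using Q g by (simp add: m_assoc)
  qed
  consider "g \<in> {a, star S a}" | "g \<in> {b, star S b}" using assms(3) by auto
  then show ?thesis
  proof cases
    case 1
    then have "\<exists>R\<in>pol. \<exists>i'. g \<otimes> zpow a i = R \<otimes> zpow a i'"
      using a_zpow[of i] star_a_zpow[of i] by blast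
    then obtain R i' where R: "R \<in> pol" "g \<otimes> zpow a i = R \<otimes> zpow a i'" by blast
    have "g \<otimes> x = (Q \<otimes> R) \<otimes> zpow a i' \<otimes> zpow b j"
      using Q R by (simp add: gx m_assoc)
    with bihomI[OF pol.mult[OF Q(1) R(1)], of i' j] show ?thesis by (intro exI) simp
  next
    case 2
    then obtain c where c: "g \<otimes> zpow a i = c \<odot> (zpow a i \<otimes> g)"
      using b_zpow_a[of i] star_b_zpow_a[of i] by blast
    from 2 have "\<exists>R\<in>pol. \<exists>j'. g \<otimes> zpow b j = R \<otimes> zpow b j'"
      using swap.a_zpow[of j] swap.star_a_zpow[of j] swap_pol by blast
    then obtain R j' where R: "R \<in> pol" "g \<otimes> zpow b j = R \<otimes> zpow b j'" by blast
    obtain R' where R': "R' \<in> pol" "zpow a i \<otimes> R = R' \<otimes> zpow a i"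
      using normal_zpow(1)[OF assms(1,2), of i] R(1) unfolding normal_def by blast
    have "g \<otimes> x = c \<odot> (Q \<otimes> (zpow a i \<otimes> (g \<otimes> zpow b j)))"
      using Q g by (simp add: gx c smult_mult_left smult_mult_right m_assoc)
    also have "\<dots> = c \<odot> (Q \<otimes> ((zpow a i \<otimes> R) \<otimes> zpow b j'))"
      using R by (simp add: m_assoc)
    also have "\<dots> = (c \<odot> (Q \<otimes> R')) \<otimes> zpow a i \<otimes> zpow b j'"
      unfolding R'(2) using Q R' by (simp add: m_assoc smult_mult_left)
    finally show ?thesis
      using bihomI[OF pol.smult[OF pol.mult[OF Q(1) R'(1)]], of c i j'] by (intro exI) simp
  qed
qed

lemma bihom_sums_closed: "v \<in> graded_sums S bihom \<Longrightarrow> v \<in> carrier S"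
  by (induction rule: graded_sums.induct) (use bihom_closed in auto)

lemma bihom_sums_smult: "v \<in> graded_sums S bihom \<Longrightarrow> c \<odot> v \<in> graded_sums S bihom"
proof (induction rule: graded_sums.induct)
  case (add x y)
  then show ?case by (auto simp: smult_add_right bihom_sums_closed intro: graded_sums.add)
qed (auto intro: graded_sums.zero graded_sums.incl bihom_smult)

lemma letter_bihom_sums:
  assumes "p \<noteq> 0" "q \<noteq> 0" "g \<in> {a, star S a, b, star S b}" "v \<in> graded_sums S bihom"
  shows "g \<otimes> v \<in> graded_sums S bihom"
  using assms(4)
proof induction
  case zero
  then show ?case using assms(3) graded_sums.zero[of S bihom] by auto
next
  case (incl x i)
  then show ?case using letter_bihom[OF assms(1-3)] graded_sums.incl by metis
next
  case (add x y)
  have "g \<in> carrier S" using assms(3) by auto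
  with add show ?case by (auto simp: r_distr bihom_sums_closed intro: graded_sums.add)
qed

text \<open>Every element is a sum of bihomogeneous ones \<open>P a\<^sup>i b\<^sup>j\<close>: left multiplication by a letter
  preserves such sums, hence so does left multiplication by any element \<open>s\<close>, and \<open>s = s 1\<close>. The
  adjoint of \<open>s\<close> is treated together with \<open>s\<close> because \<open>star\<close> turns left factors into right
  ones.\<close>

lemma star_gen_bihom_sums:
  assumes "p \<noteq> 0" "q \<noteq> 0" "s \<in> star_gen S {a, b}"
  shows "s \<in> graded_sums S bihom"
proof -
  let ?L = "{s \<in> carrier S. \<forall>v\<in>graded_sums S bihom. s \<otimes> v \<in> graded_sums S bihom}"
  have add: "x \<oplus> y \<in> ?L" if "x \<in> ?L" "y \<in> ?L" for x y
    using that by (auto simp: l_distr bihom_sums_closed intro: graded_sums.add)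
  have mult: "x \<otimes> y \<in> ?L" if "x \<in> ?L" "y \<in> ?L" for x y
    using that by (auto simp: m_assoc bihom_sums_closed)
  have smult: "c \<odot> x \<in> ?L" if "x \<in> ?L" for x c
    using that by (auto simp: smult_mult_left bihom_sums_closed bihom_sums_smult)
  have "s \<in> ?L \<and> star S s \<in> ?L"
    using assms(3)
  proof induction
    case (gen x)
    then show ?case using letter_bihom_sums[OF assms(1,2)] by auto
  next
    case one
    show ?case by (auto simp: bihom_sums_closed)
  next
    case (add x y)
    then have "star S (x \<oplus> y) = star S x \<oplus> star S y" by (simp add: star_add)
    with add.IH show ?case using \<open>\<And>x y. x \<in> ?L \<Longrightarrow> y \<in> ?L \<Longrightarrow> x \<oplus> y \<in> ?L\<close> by presburger
  next
    case (mult x y)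
    then have "star S (x \<otimes> y) = star S y \<otimes> star S x" by (simp add: star_mult)
    with mult.IH show ?case using \<open>\<And>x y. x \<in> ?L \<Longrightarrow> y \<in> ?L \<Longrightarrow> x \<otimes> y \<in> ?L\<close> by presburger
  next
    case (smult x c)
    then have "star S (c \<odot> x) = cnj c \<odot> star S x" by (simp add: star_smult)
    with smult.IH show ?case using \<open>\<And>x c. x \<in> ?L \<Longrightarrow> c \<odot> x \<in> ?L\<close> by presburger
  next
    case (star x)
    then have "star S (star S x) = x" by simp
    with star.IH show ?case by presburger
  qed
  moreover have "\<one> \<in> graded_sums S bihom"
    using graded_sums.incl[where M = bihom and i = "(0, 0)" and R = S, OF bihomI[OF pol.one]]
    by (simp add: zpow_def)
  ultimately have "s \<otimes> \<one> \<in> graded_sums S bihom" by blast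
  then show ?thesis using \<open>s \<in> ?L \<and> _\<close> by simp
qed

end

section \<open>New pairs from old ones\<close>

context star_algebra
begin

lemma smult_pow: "x \<in> carrier A \<Longrightarrow> (c \<odot> x) [^] (n::nat) = (c ^ n) \<odot> x [^] n"
  by (induction n) (simp_all add: smult_mult_left smult_mult_right smult_smult mult.commute)

lemma zpow_cis_smult: "x \<in> carrier A \<Longrightarrow> zpow (cis t \<odot> x) i = cis (i * t) \<odot> zpow x i"
  by (auto simp: zpow_def star_smult smult_pow DeMoivre cis_cnj simp del: pow_nat)

lemma zpow_mult_in_star_gen:
  assumes "x \<in> carrier A" "x [^] m \<in> star_gen A G"
  shows "zpow x (int m * i) \<in> star_gen A G"
proof -
  have 1: "x [^] (m * n) \<in> star_gen A G" for n :: nat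
    using star_gen_pow[OF star_algebra_axioms assms(2), of n] assms(1) by (simp add: nat_pow_pow)
  have 2: "star A x [^] (m * n) \<in> star_gen A G" for n :: nat
    using star_gen.star[OF 1[of n]] assms(1) by (simp add: star_nat_pow)
  show ?thesis
  proof (cases "0 \<le> i")
    case True
    then have "nat (int m * i) = m * nat i" by (simp add: nat_mult_distrib)
    then show ?thesis using True 1[of "nat i"] by (simp add: zpow_def del: pow_nat)
  next
    case False
    then have "nat (- (int m * i)) = m * nat (- i)" by (simp add: nat_mult_distrib flip: mult_minus_right)
    moreover have "zpow x (int m * i) = star A x [^] nat (- (int m * i))"
      using False by (auto simp: zpow_def zero_le_mult_iff simp del: pow_nat)
    ultimately show ?thesis using 2[of "nat (- i)"] by simp
  qed
qed

end

lemma star_alg_hom_zpow: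
  assumes "star_algebra A" "star_algebra B" "f \<in> star_alg_hom A B" "x \<in> carrier A"
  shows "f (star_algebra.zpow A x i) = star_algebra.zpow B (f x) i"
proof -
  interpret A: star_algebra A by fact
  interpret B: star_algebra B by fact
  show ?thesis
    using assms
    by (simp add: A.zpow_def B.zpow_def star_alg_hom_pow star_alg_hom_star del: pow_nat)
qed

lemma star_alg_hom_defect:
  assumes "star_algebra A" "star_algebra B" "f \<in> star_alg_hom A B" "x \<in> carrier A"
  shows "f (star_algebra.defect A x) = star_algebra.defect B (f x)"
proof -
  interpret A: star_algebra A by fact
  show ?thesis
    using assms by (simp add: star_algebra.defect_def star_alg_homD[OF assms(3)])
qed

context sphere_pair
begin

lemma smult_pair:
  assumes "c * cnj c = 1" "d * cnj d = 1"
  shows "sphere_pair S (c \<odot> a) (d \<odot> b) p q \<theta>"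
proof -
  have cd: "cnj c * c = 1" "cnj d * d = 1" using assms by (simp_all add: mult.commute)
  show ?thesis
    by unfold_locales
      (simp_all add: star_smult smult_mult_left smult_mult_right smult_smult assms cd
        ab ab' aa bb orth mult_ac)
qed

lemma tensor_pair:
  assumes "star_algebra H" "g \<in> carrier H" "h \<in> carrier H"
    and g: "g \<otimes>\<^bsub>H\<^esub> star H g = \<one>\<^bsub>H\<^esub>" "star H g \<otimes>\<^bsub>H\<^esub> g = \<one>\<^bsub>H\<^esub>"
    and h: "h \<otimes>\<^bsub>H\<^esub> star H h = \<one>\<^bsub>H\<^esub>" "star H h \<otimes>\<^bsub>H\<^esub> h = \<one>\<^bsub>H\<^esub>"
    and gh: "g \<otimes>\<^bsub>H\<^esub> h = h \<otimes>\<^bsub>H\<^esub> g" "g \<otimes>\<^bsub>H\<^esub> star H h = star H h \<otimes>\<^bsub>H\<^esub> g"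
  shows "sphere_pair (tensor S H) (tensor_elem S H a g) (tensor_elem S H b h) p q \<theta>"
proof -
  interpret SH: tensor_pair S H by (rule tensor_pair.intro[OF star_algebra_axioms assms(1)])
  interpret T: star_algebra "tensor S H" by (rule SH.tensor_star_algebra)
  note [simp] = assms(2,3) g h SH.elem_star SH.elem_mult
  note lin = SH.elem_one[symmetric] SH.elem_smult_left[symmetric] SH.elem_add_left[symmetric]
  show ?thesis
  proof
    show "tensor_elem S H a g \<in> carrier (tensor S H)" "tensor_elem S H b h \<in> carrier (tensor S H)"
      by simp_all
    have "defect a \<otimes> defect b = \<zero>" using orth by (simp add: defect_def)
    then show "(\<one>\<^bsub>tensor S H\<^esub> \<oplus>\<^bsub>tensor S H\<^esub> (-1) \<odot>\<^bsub>tensor S H\<^esub>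
          (tensor_elem S H a g \<otimes>\<^bsub>tensor S H\<^esub> star (tensor S H) (tensor_elem S H a g)))
        \<otimes>\<^bsub>tensor S H\<^esub> (\<one>\<^bsub>tensor S H\<^esub> \<oplus>\<^bsub>tensor S H\<^esub> (-1) \<odot>\<^bsub>tensor S H\<^esub>
          (tensor_elem S H b h \<otimes>\<^bsub>tensor S H\<^esub> star (tensor S H) (tensor_elem S H b h)))
        = \<zero>\<^bsub>tensor S H\<^esub>"
      by (simp add: lin defect_def SH.elem_zero_left)
  qed (simp_all add: lin ab ab' aa bb gh)
qed

end

section \<open>The algebra of coinvariants\<close>

lemma coinvariants_simps [simp]:
  "one (coinvariants A H \<delta>) = one A" "zero (coinvariants A H \<delta>) = zero A"
  "monoid.mult (coinvariants A H \<delta>) = monoid.mult A" "add (coinvariants A H \<delta>) = add A"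
  "module.smult (coinvariants A H \<delta>) = module.smult A" "star (coinvariants A H \<delta>) = star A"
  "carrier (coinvariants A H \<delta>) = {v \<in> carrier A. \<delta> v = tensor_elem A H v \<one>\<^bsub>H\<^esub>}"
  by (simp_all add: coinvariants_def)

lemma coinvariants_star_algebra:
  assumes "star_algebra A" "star_algebra H" "\<delta> \<in> star_alg_hom A (tensor A H)"
  shows "star_algebra (coinvariants A H \<delta>)"
proof -
  interpret AH: tensor_pair A H by (rule tensor_pair.intro[OF assms(1,2)])
  show ?thesis
    using star_alg_hom_zero[OF assms(1) AH.tensor_star_algebra assms(3)]
    by (intro star_algebraI)
      (simp_all add: star_alg_homD[OF assms(3)] AH.elem_one AH.elem_zero_left AH.elem_add_left
        AH.elem_smult_left AH.elem_mult AH.elem_star AH.A.a_ac AH.A.smult_smult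
        AH.A.smult_add_left AH.A.smult_add_right AH.A.m_assoc AH.A.l_distr AH.A.r_distr
        AH.A.smult_mult_left AH.A.smult_mult_right AH.A.star_add AH.A.star_mult AH.A.star_smult)
qed

section \<open>Homomorphisms from graphs\<close>

text \<open>The *-subalgebra of \<open>A \<times> B\<close> generated by prescribed pairs. If it is the graph of a
  function on \<open>A\<close>, that function is the only homomorphism with the prescribed values.\<close>

inductive_set hom_graph ::
    "('a, 'm) star_algebra_scheme \<Rightarrow> ('b, 'n) star_algebra_scheme \<Rightarrow> ('a \<times> 'b) set \<Rightarrow> ('a \<times> 'b) set"
  for A :: "('a, 'm) star_algebra_scheme" and B :: "('b, 'n) star_algebra_scheme" and G where
  gen: "vX \<in> G \<Longrightarrow> vX \<in> hom_graph A B G"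
| one: "(\<one>\<^bsub>A\<^esub>, \<one>\<^bsub>B\<^esub>) \<in> hom_graph A B G"
| add: "(v, X) \<in> hom_graph A B G \<Longrightarrow> (w, Y) \<in> hom_graph A B G \<Longrightarrow>
    (v \<oplus>\<^bsub>A\<^esub> w, X \<oplus>\<^bsub>B\<^esub> Y) \<in> hom_graph A B G"
| mult: "(v, X) \<in> hom_graph A B G \<Longrightarrow> (w, Y) \<in> hom_graph A B G \<Longrightarrow>
    (v \<otimes>\<^bsub>A\<^esub> w, X \<otimes>\<^bsub>B\<^esub> Y) \<in> hom_graph A B G"
| smult: "(v, X) \<in> hom_graph A B G \<Longrightarrow> (c \<odot>\<^bsub>A\<^esub> v, c \<odot>\<^bsub>B\<^esub> X) \<in> hom_graph A B G"
| star: "(v, X) \<in> hom_graph A B G \<Longrightarrow> (star A v, star B X) \<in> hom_graph A B G"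

lemma hom_graph_closed:
  assumes "star_algebra A" "star_algebra B" "G \<subseteq> carrier A \<times> carrier B"
  shows "hom_graph A B G \<subseteq> carrier A \<times> carrier B"
proof -
  interpret A: star_algebra A by fact
  interpret B: star_algebra B by fact
  have "vX \<in> carrier A \<times> carrier B" if "vX \<in> hom_graph A B G" for vX
    using that by induction (use assms(3) in auto)
  then show ?thesis by blast
qed

lemma hom_in_graph:
  assumes "star_algebra A" "fst ` G \<subseteq> carrier A" "f \<in> star_alg_hom A B"
    and "\<And>v X. (v, X) \<in> G \<Longrightarrow> f v = X" "v \<in> star_gen A (fst ` G)"
  shows "(v, f v) \<in> hom_graph A B G"
  using assms(5)
proof induction
  case (gen x)
  then show ?case using assms(4) by (force intro: hom_graph.gen)
qed (use star_gen_subset[OF assms(1,2)] in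
    \<open>simp_all add: star_alg_homD[OF assms(3)] hom_graph.intros subset_iff\<close>)

lemma hom_of_graph:
  assumes "star_algebra A" "star_algebra B" "G \<subseteq> carrier A \<times> carrier B"
    and gen: "carrier A = star_gen A (fst ` G)"
    and unique: "\<And>v X Y. (v, X) \<in> hom_graph A B G \<Longrightarrow> (v, Y) \<in> hom_graph A B G \<Longrightarrow> X = Y"
  shows "\<exists>!f. f \<in> star_alg_hom A B \<inter> extensional (carrier A) \<and> (\<forall>(v, X)\<in>G. f v = X)"
proof -
  interpret A: star_algebra A by fact
  define f where "f = (\<lambda>v\<in>carrier A. THE X. (v, X) \<in> hom_graph A B G)"
  have "\<exists>X. (v, X) \<in> hom_graph A B G" if "v \<in> carrier A" for v
    using that unfolding gen
  proof induction
    case (gen x)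
    then obtain X where "(x, X) \<in> G" by auto
    then show ?case by (blast intro: hom_graph.gen)
  qed (meson hom_graph.intros)+
  then have f: "(v, f v) \<in> hom_graph A B G" if "v \<in> carrier A" for v
    using that unique unfolding f_def by (simp, intro theI'[of "\<lambda>X. (v, X) \<in> hom_graph A B G"]) blast
  note f_eq = unique[OF f]
  have hom: "f \<in> star_alg_hom A B"
  proof (rule star_alg_homI)
    show "f x \<in> carrier B" if "x \<in> carrier A" for x
      using f[OF that] hom_graph_closed[OF assms(1-3)] by auto
  qed (intro f_eq hom_graph.intros f; simp)+
  show ?thesis
  proof (rule ex1I[of _ f])
    show "f \<in> star_alg_hom A B \<inter> extensional (carrier A) \<and> (\<forall>(v, X)\<in>G. f v = X)"
    proof -
      have "f v = X" if "(v, X) \<in> G" for v X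
        using that assms(3) by (intro f_eq hom_graph.gen) auto
      moreover have "f \<in> extensional (carrier A)" by (simp add: f_def)
      ultimately show ?thesis using hom by auto
    qed
  next
    fix g assume g: "g \<in> star_alg_hom A B \<inter> extensional (carrier A) \<and> (\<forall>(v, X)\<in>G. g v = X)"
    have "(v, g v) \<in> hom_graph A B G" if "v \<in> carrier A" for v
      by (rule hom_in_graph[OF assms(1)]) (use g assms(3) that gen in auto)
    then have "f v = g v" if "v \<in> carrier A" for v using f_eq that by blast
    moreover have "f \<in> extensional (carrier A)" by (simp add: f_def)
    ultimately show "g = f" using g by (intro extensionalityI[of g "carrier A"]) auto
  qed
qed

section \<open>Evaluations separate the tensor products with the circle\<close>

text \<open>The circle is a degenerate sphere with \<open>b = 0\<close>, so its elements are combinations of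
  powers of \<open>u\<close>.\<close>

lemma circle_one_minus_one:
  "\<one>\<^bsub>circle_alg\<^esub> \<oplus>\<^bsub>circle_alg\<^esub> (-1) \<odot>\<^bsub>circle_alg\<^esub> \<one>\<^bsub>circle_alg\<^esub> = \<zero>\<^bsub>circle_alg\<^esub>"
  by (simp add: circle.add_smult_eq_iff)

lemma circle_sphere_pair: "sphere_pair circle_alg circle_u \<zero>\<^bsub>circle_alg\<^esub> 1 1 0"
  by unfold_locales (simp_all add: circle_one_minus_one)

lemma circle_spanned:
  assumes "c \<in> carrier circle_alg"
  shows "c \<in> graded_sums circle_alg (\<lambda>d. {z \<odot>\<^bsub>circle_alg\<^esub> circle.zpow circle_u d | z. True})"
proof -
  interpret sphere_pair circle_alg circle_u "\<zero>\<^bsub>circle_alg\<^esub>" 1 1 0 by (rule circle_sphere_pair)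
  let ?C = circle_alg
  let ?M = "\<lambda>d. {z \<odot>\<^bsub>?C\<^esub> circle.zpow circle_u d | z. True}"
  have defect: "circle.defect circle_u = \<zero>\<^bsub>?C\<^esub>" "circle.defect \<zero>\<^bsub>?C\<^esub> = \<one>\<^bsub>?C\<^esub>"
    by (simp_all add: circle.defect_def circle_one_minus_one)
  have pol_scalar: "\<exists>z. P = z \<odot>\<^bsub>?C\<^esub> \<one>\<^bsub>?C\<^esub>" if "P \<in> pol" for P
    using that
  proof induction
    case one show ?case by (rule exI[of _ 1]) simp
  next
    case A show ?case by (rule exI[of _ 0]) (simp add: defect)
  next
    case B show ?case by (rule exI[of _ 1]) (simp add: defect)
  next
    case (add x y)
    then obtain z z' where "x = z \<odot>\<^bsub>?C\<^esub> \<one>\<^bsub>?C\<^esub>" "y = z' \<odot>\<^bsub>?C\<^esub> \<one>\<^bsub>?C\<^esub>" by blast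
    then show ?case by (intro exI[of _ "z + z'"]) (simp add: circle.smult_add_left)
  next
    case (mult x y)
    then obtain z z' where "x = z \<odot>\<^bsub>?C\<^esub> \<one>\<^bsub>?C\<^esub>" "y = z' \<odot>\<^bsub>?C\<^esub> \<one>\<^bsub>?C\<^esub>" by blast
    then show ?case by (intro exI[of _ "z * z'"]) (simp add: circle.smult_mult_left circle.smult_smult)
  next
    case (smult x c)
    then obtain z where "x = z \<odot>\<^bsub>?C\<^esub> \<one>\<^bsub>?C\<^esub>" by blast
    then show ?case by (intro exI[of _ "c * z"]) (simp add: circle.smult_smult)
  qed
  have zero_pow: "circle.zpow \<zero>\<^bsub>?C\<^esub> j \<in> {\<zero>\<^bsub>?C\<^esub>, \<one>\<^bsub>?C\<^esub>}" for j
  proof -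
    have "\<zero>\<^bsub>?C\<^esub> [^]\<^bsub>?C\<^esub> n \<in> {\<zero>\<^bsub>?C\<^esub>, \<one>\<^bsub>?C\<^esub>}" for n :: nat
      by (cases n) simp_all
    then show ?thesis unfolding circle.zpow_def circle.star_zero by (cases "0 \<le> j") (simp_all only: if_True if_False)
  qed
  have bihom_in: "x \<in> ?M (fst ij)" if x: "x \<in> bihom ij" for x ij
  proof -
    obtain i j where ij: "ij = (i, j)" by (cases ij)
    obtain P where P: "P \<in> pol" "x = P \<otimes>\<^bsub>?C\<^esub> circle.zpow circle_u i \<otimes>\<^bsub>?C\<^esub> circle.zpow \<zero>\<^bsub>?C\<^esub> j"
      using x unfolding ij bihom_def prod.case by blast
    obtain z where "P = z \<odot>\<^bsub>?C\<^esub> \<one>\<^bsub>?C\<^esub>" using pol_scalar[OF P(1)] by blast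
    then have "x = z \<odot>\<^bsub>?C\<^esub> circle.zpow circle_u i \<or> x = 0 \<odot>\<^bsub>?C\<^esub> circle.zpow circle_u i"
    proof -
      assume z: "P = z \<odot>\<^bsub>?C\<^esub> \<one>\<^bsub>?C\<^esub>"
      have 1: "P \<otimes>\<^bsub>?C\<^esub> circle.zpow circle_u i = z \<odot>\<^bsub>?C\<^esub> circle.zpow circle_u i"
        by (simp add: z circle.smult_mult_left)
      from zero_pow[of j] consider "circle.zpow \<zero>\<^bsub>?C\<^esub> j = \<zero>\<^bsub>?C\<^esub>"
        | "circle.zpow \<zero>\<^bsub>?C\<^esub> j = \<one>\<^bsub>?C\<^esub>" by blast
      then show ?thesis by cases (simp_all add: P(2) 1)
    qed
    then show ?thesis unfolding ij fst_conv by blast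
  qed
  have "x \<in> graded_sums ?C ?M" if "x \<in> graded_sums ?C bihom" for x
    using that
  proof induction
    case (incl x ij)
    then have "x \<in> ?M (fst ij)" using bihom_in by blast
    then show ?case by (rule graded_sums.incl)
  qed (simp_all add: graded_sums.zero graded_sums.add)
  moreover have "c \<in> graded_sums ?C bihom"
  proof (rule star_gen_bihom_sums)
    have "x \<in> star_gen ?C {circle_u, \<zero>\<^bsub>?C\<^esub>}" if "x \<in> star_gen ?C {circle_u}" for x
      using that by induction (simp_all add: star_gen.intros)
    then show "c \<in> star_gen ?C {circle_u, \<zero>\<^bsub>?C\<^esub>}"
      using assms circle_generated by simp
  qed simp_all
  ultimately show ?thesis by blast
qed

lemma circle_ev_zpow: "circle_ev t (circle.zpow circle_u d) = cis (d * t)"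
proof -
  have "circle_ev t (circle.zpow circle_u d) = star_algebra.zpow complex_alg (cis t) d"
    using star_alg_hom_zpow[OF circle.star_algebra_axioms complex_alg_star_algebra circle_ev(1)]
    by (simp add: circle_ev(2))
  also have "\<dots> = cis (d * t)"
    using star_algebra.zpow_cis_smult[OF complex_alg_star_algebra, of 1 t d]
    by (simp add: star_algebra.zpow_def[OF complex_alg_star_algebra] complex_alg_pow)
  finally show ?thesis .
qed

text \<open>An element of \<open>A \<otimes> O(U(1))\<close> is a finite sum of \<open>v\<^sub>d \<otimes> u\<^sup>d\<close>, and its
  contraction at \<open>t\<close> is the trigonometric polynomial with coefficients \<open>v\<^sub>d\<close>.\<close>

lemma contract_circle_ev_eq_zero:
  fixes \<theta> :: real
  assumes "star_algebra A" "\<theta> \<notin> \<rat>" "X \<in> carrier (tensor A circle_alg)"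
    and "\<And>t. tensor_pair.contract A (circle_ev t) X = \<zero>\<^bsub>A\<^esub>"
  shows "X = \<zero>\<^bsub>tensor A circle_alg\<^esub>"
proof -
  interpret tensor_pair A circle_alg
    by (rule tensor_pair.intro[OF assms(1) circle.star_algebra_axioms])
  interpret T: star_algebra T by (rule tensor_star_algebra)
  let ?u = "circle.zpow circle_u"
  let ?M = "\<lambda>d. {elem v (?u d) | v. v \<in> carrier A}"
  have elem_zero: "elem v \<zero>\<^bsub>circle_alg\<^esub> = \<zero>\<^bsub>T\<^esub>" if "v \<in> carrier A" for v
    using elem_smult_right[of v "\<zero>\<^bsub>circle_alg\<^esub>" 0] that by (simp add: elem_zero_left)
  have elem: "elem v c \<in> graded_sums T ?M" if v: "v \<in> carrier A" and c: "c \<in> carrier circle_alg" for v c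
  proof -
    have "c \<in> carrier circle_alg \<and> elem v c \<in> graded_sums T ?M"
      using circle_spanned[OF c]
    proof induction
      case zero
      show ?case using v by (simp add: elem_zero graded_sums.zero)
    next
      case (incl x d)
      then obtain z where x: "x = z \<odot>\<^bsub>circle_alg\<^esub> ?u d" by blast
      then have "elem v x = elem (z \<odot>\<^bsub>A\<^esub> v) (?u d)" using v by (simp add: elem_smult_right)
      then have "elem v x \<in> ?M d" using v by blast
      with x show ?case by (simp add: graded_sums.incl[where M = ?M and i = d])
    next
      case (add x y)
      then show ?case using v by (simp add: elem_add_right graded_sums.add)
    qed
    then show ?thesis ..
  qed
  have "X \<in> graded_sums T ?M"
    using assms(3)
    by (induction rule: tensor_induct) (simp_all add: graded_sums.zero graded_sums.add elem)
  then obtain F f where F: "finite F" "\<And>d. f d \<in> ?M d" "X = finsum T f F"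
  proof (rule graded_sums_eq_finsum[rotated 4])
    show "abelian_group T" by (rule T.is_abelian_group)
    show "?M d \<subseteq> carrier T" for d by auto
    show "\<zero>\<^bsub>T\<^esub> \<in> ?M d" for d using elem_zero_left[of "?u d"] by force
    show "x \<oplus>\<^bsub>T\<^esub> y \<in> ?M d" if "x \<in> ?M d" "y \<in> ?M d" for d x y
      using that by (auto simp: elem_add_left[symmetric])
  qed auto
  then have "\<forall>d. \<exists>v. v \<in> carrier A \<and> f d = elem v (?u d)" by blast
  then obtain g where g: "\<And>d. g d \<in> carrier A" "\<And>d. f d = elem (g d) (?u d)" by metis
  have "(\<Oplus>\<^bsub>A\<^esub>d\<in>F. cis (d * t) \<odot>\<^bsub>A\<^esub> g d) = \<zero>\<^bsub>A\<^esub>" for t :: real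
  proof -
    have "contract (circle_ev t) X = (\<Oplus>\<^bsub>A\<^esub>d\<in>F. contract (circle_ev t) (f d))"
      unfolding F(3)
      by (rule star_alg_hom_finsum[OF tensor_star_algebra assms(1) contract_hom[OF circle_ev(1)] F(1)])
        (simp add: g)
    then show ?thesis
      using assms(4)[of t] g by (simp add: contract_elem[OF circle_ev(1)] circle_ev_zpow)
  qed
  then have "g d = \<zero>\<^bsub>A\<^esub>" if "d \<in> F" for d
    by (intro A.cis_separation[OF assms(2) F(1) _ _ that, of g]) (simp_all add: g)
  then have "f d = \<zero>\<^bsub>T\<^esub>" if "d \<in> F" for d using g(2) that by (simp add: elem_zero_left)
  then show ?thesis unfolding F(3) by (simp cong: T.finsum_cong)
qed

lemma contract_circle_ev_eq:
  fixes \<theta> :: real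
  assumes "star_algebra A" "\<theta> \<notin> \<rat>"
    and X: "X \<in> carrier (tensor A circle_alg)" and Y: "Y \<in> carrier (tensor A circle_alg)"
    and eq: "\<And>t. tensor_pair.contract A (circle_ev t) X = tensor_pair.contract A (circle_ev t) Y"
  shows "X = Y"
proof -
  interpret tensor_pair A circle_alg
    by (rule tensor_pair.intro[OF assms(1) circle.star_algebra_axioms])
  interpret T: star_algebra T by (rule tensor_star_algebra)
  have "contract (circle_ev t) (X \<oplus>\<^bsub>T\<^esub> (-1) \<odot>\<^bsub>T\<^esub> Y) = \<zero>\<^bsub>A\<^esub>" for t
    using X Y eq A.smult_add_left[of "contract (circle_ev t) Y" 1 "-1"]
    by (simp add: star_alg_homD[OF contract_hom[OF circle_ev(1)]])
  then have "X \<oplus>\<^bsub>T\<^esub> (-1) \<odot>\<^bsub>T\<^esub> Y = \<zero>\<^bsub>T\<^esub>"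
    using X Y by (intro contract_circle_ev_eq_zero[OF assms(1,2)]) auto
  then show ?thesis using X Y by (simp add: T.add_smult_eq_iff)
qed

section \<open>The gauge action on the sphere and the coaction on its coinvariants\<close>

lemma tensor_defect:
  assumes "star_algebra A" "star_algebra B" "v \<in> carrier A" "g \<in> carrier B"
    and "g \<otimes>\<^bsub>B\<^esub> star B g = \<one>\<^bsub>B\<^esub>"
  shows "star_algebra.defect (tensor A B) (tensor_elem A B v g) =
    tensor_elem A B (star_algebra.defect A v) \<one>\<^bsub>B\<^esub>"
proof -
  interpret tensor_pair A B by (rule tensor_pair.intro[OF assms(1,2)])
  interpret T: star_algebra T by (rule tensor_star_algebra)
  show ?thesis
    using assms(3-)
    by (simp add: T.defect_def A.defect_def elem_star elem_mult elem_add_left elem_smult_left elem_one)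
qed

locale quantum_sphere =
  fixes p q \<theta> :: real and k l :: nat
  assumes params: "0 < p" "p < 1" "0 < q" "q < 1" "\<theta> \<notin> \<rat>" and kl: "0 < k" "0 < l" "coprime k l"
begin

abbreviation S where "S \<equiv> s3 p q \<theta>"
abbreviation a where "a \<equiv> s3_a p q \<theta>"
abbreviation b where "b \<equiv> s3_b p q \<theta>"
abbreviation H where "H \<equiv> cyclic_alg (k * l)"
abbreviation \<A> where "\<A> \<equiv> A_alg p q \<theta> k l"

sublocale sphere_pair S a b p q \<theta>
  by (rule s3_sphere_pair)

lemma s3_A_eq: "s3_A p q \<theta> = defect a" and s3_B_eq: "s3_B p q \<theta> = defect b"
  by (simp_all add: s3_A_def s3_B_def defect_def a_minus_def uminus_eq_smult)

subsection \<open>The gauge action\<close>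

definition gauge :: "real \<Rightarrow> s3_gen sterm set \<Rightarrow> s3_gen sterm set" where
  "gauge s = pres_map S (case_s3_gen (cis (real k * s) \<odot>\<^bsub>S\<^esub> a) (cis (real l * s) \<odot>\<^bsub>S\<^esub> b))"

lemma gauge: "gauge s \<in> star_alg_hom S S" "gauge s a = cis (real k * s) \<odot>\<^bsub>S\<^esub> a"
  "gauge s b = cis (real l * s) \<odot>\<^bsub>S\<^esub> b"
  unfolding gauge_def by (rule s3_hom[OF smult_pair]; simp)+

lemma gauge_defect: "gauge s (defect a) = defect a" "gauge s (defect b) = defect b"
  using star_alg_hom_defect[OF star_algebra_axioms star_algebra_axioms gauge(1)]
  by (simp_all add: gauge defect_def star_smult smult_mult_left smult_mult_right smult_smult)

lemma gauge_pol: "P \<in> pol \<Longrightarrow> gauge s P = P"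
  by (induction rule: pol.induct)
    (simp_all add: gauge_defect star_alg_homD[OF gauge(1)] star_alg_hom_one[OF gauge(1)])

definition deg :: "int \<times> int \<Rightarrow> int" where
  "deg ij = int k * fst ij + int l * snd ij"

lemma gauge_bihom:
  fixes s :: real
  assumes v: "v \<in> bihom ij"
  shows "gauge s v = cis (deg ij * s) \<odot>\<^bsub>S\<^esub> v"
proof -
  obtain i j where ij: "ij = (i, j)" by (cases ij)
  obtain P where P: "P \<in> pol" "v = P \<otimes>\<^bsub>S\<^esub> zpow a i \<otimes>\<^bsub>S\<^esub> zpow b j"
    using v unfolding ij bihom_def prod.case by blast
  have "gauge s v = P \<otimes>\<^bsub>S\<^esub> zpow (cis (real k * s) \<odot>\<^bsub>S\<^esub> a) i \<otimes>\<^bsub>S\<^esub> zpow (cis (real l * s) \<odot>\<^bsub>S\<^esub> b) j"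
    using P by (simp add: star_alg_hom_mult[OF gauge(1)] gauge_pol gauge
        star_alg_hom_zpow[OF star_algebra_axioms star_algebra_axioms gauge(1)])
  also have "\<dots> = cis (deg ij * s) \<odot>\<^bsub>S\<^esub> v"
    using P by (simp add: zpow_cis_smult smult_mult_left smult_mult_right smult_smult cis_mult
        ij deg_def algebra_simps)
  finally show ?thesis .
qed

text \<open>The elements of degree \<open>d\<close>, described by the spanning set. By \<open>gauge_homog\<close> and
  \<open>homog_if_gauge\<close> they are the spectral subspace of the gauge action.\<close>

definition homog :: "int \<Rightarrow> s3_gen sterm set set" where
  "homog d = graded_sums S (\<lambda>ij. if deg ij = d then bihom ij else {})"

lemma homog_closed: "v \<in> homog d \<Longrightarrow> v \<in> carrier S"
  unfolding homog_def
proof (induction rule: graded_sums.induct)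
  case (incl x ij)
  then show ?case using bihom_closed[of ij] by (auto split: if_splits)
qed auto

lemma gauge_homog:
  fixes s :: real
  assumes "v \<in> homog d"
  shows "gauge s v = cis (d * s) \<odot>\<^bsub>S\<^esub> v"
proof -
  from assms have "v \<in> carrier S \<and> gauge s v = cis (d * s) \<odot>\<^bsub>S\<^esub> v"
    unfolding homog_def
  proof (induction rule: graded_sums.induct)
    case zero
    show ?case
      using star_alg_hom_zero[OF star_algebra_axioms star_algebra_axioms gauge(1)] by simp
  next
    case (incl x ij)
    then have x: "x \<in> bihom ij" "deg ij = d" by (auto split: if_splits)
    then show ?case using gauge_bihom[OF x(1), of s] bihom_closed[of ij] by (simp add: subset_iff)
  next
    case (add x y)
    then show ?case by (simp add: star_alg_hom_add[OF gauge(1)] smult_add_right)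
  qed
  then show ?thesis ..
qed

lemma homog_decomposition:
  assumes "v \<in> carrier S"
  obtains F f where "finite F" "\<And>d. f d \<in> homog d" "v = finsum S f F"
proof (rule graded_sums_eq_finsum[of S homog v])
  show "abelian_group S" by (rule is_abelian_group)
  show "homog d \<subseteq> carrier S" for d using homog_closed by blast
  show "\<zero>\<^bsub>S\<^esub> \<in> homog d" for d unfolding homog_def by (rule graded_sums.zero)
  show "x \<oplus>\<^bsub>S\<^esub> y \<in> homog d" if "x \<in> homog d" "y \<in> homog d" for d x y
    using that unfolding homog_def by (rule graded_sums.add)
  have "v \<in> graded_sums S bihom"
    using params assms by (intro star_gen_bihom_sums) (simp_all add: s3_generated)
  then show "v \<in> graded_sums S homog"
  proof induction
    case zero
    show ?case by (rule graded_sums.zero)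
  next
    case (incl x ij)
    then have "x \<in> homog (deg ij)"
      unfolding homog_def by (intro graded_sums.incl[where i = ij]) simp
    then show ?case by (rule graded_sums.incl)
  next
    case (add x y)
    show ?case by (rule graded_sums.add[OF add.IH])
  qed
qed (use that in blast)

lemma gauge_finsum:
  fixes s :: real and F :: "int set"
  assumes "finite F" "\<And>d. f d \<in> homog d"
  shows "gauge s (finsum S f F) = (\<Oplus>\<^bsub>S\<^esub>d\<in>F. cis (d * s) \<odot>\<^bsub>S\<^esub> f d)"
proof -
  have fc: "f d \<in> carrier S" for d using assms(2) homog_closed by blast
  have "gauge s (finsum S f F) = (\<Oplus>\<^bsub>S\<^esub>d\<in>F. gauge s (f d))"
    using fc by (intro star_alg_hom_finsum[OF star_algebra_axioms star_algebra_axioms gauge(1) assms(1)]) auto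
  also have "\<dots> = (\<Oplus>\<^bsub>S\<^esub>d\<in>F. cis (d * s) \<odot>\<^bsub>S\<^esub> f d)"
    using fc gauge_homog[OF assms(2)] by (intro finsum_cong') auto
  finally show ?thesis .
qed

text \<open>Decompose \<open>v\<close> into components \<open>f d\<close> and subtract \<open>v\<close> in degree \<open>m\<close>. The gauge action on
  the result is a vanishing trigonometric polynomial, so \<open>v = f m\<close>.\<close>

lemma homog_if_gauge:
  assumes v: "v \<in> carrier S" and ev: "\<And>s::real. gauge s v = cis (m * s) \<odot>\<^bsub>S\<^esub> v"
  shows "v \<in> homog m"
proof -
  obtain F f where F: "finite F" "\<And>d. f d \<in> homog d" "v = finsum S f F"
    using homog_decomposition[OF v] by metis
  have fc: "f d \<in> carrier S" for d using F(2) homog_closed by blast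
  define f' where "f' d = (if d \<in> F then f d else \<zero>\<^bsub>S\<^esub>)" for d
  define g where "g d = f' d \<oplus>\<^bsub>S\<^esub> (if d = m then (-1) \<odot>\<^bsub>S\<^esub> v else \<zero>\<^bsub>S\<^esub>)" for d
  have c: "f' d \<in> carrier S" "g d \<in> carrier S" for d using fc v by (auto simp: f'_def g_def)
  have "(\<Oplus>\<^bsub>S\<^esub>d\<in>insert m F. cis (d * s) \<odot>\<^bsub>S\<^esub> g d) = \<zero>\<^bsub>S\<^esub>" for s :: real
  proof -
    have "(\<Oplus>\<^bsub>S\<^esub>d\<in>insert m F. cis (d * s) \<odot>\<^bsub>S\<^esub> g d) =
        (\<Oplus>\<^bsub>S\<^esub>d\<in>insert m F. cis (d * s) \<odot>\<^bsub>S\<^esub> f' d \<oplus>\<^bsub>S\<^esub>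
          (if m = d then cis (m * s) \<odot>\<^bsub>S\<^esub> ((-1) \<odot>\<^bsub>S\<^esub> v) else \<zero>\<^bsub>S\<^esub>))"
      using c v by (intro finsum_cong') (auto simp: g_def smult_add_right)
    also have "\<dots> = (\<Oplus>\<^bsub>S\<^esub>d\<in>insert m F. cis (d * s) \<odot>\<^bsub>S\<^esub> f' d) \<oplus>\<^bsub>S\<^esub>
        (\<Oplus>\<^bsub>S\<^esub>d\<in>insert m F. if m = d then cis (m * s) \<odot>\<^bsub>S\<^esub> ((-1) \<odot>\<^bsub>S\<^esub> v) else \<zero>\<^bsub>S\<^esub>)"
      using c v by (intro finsum_addf) auto
    also have "(\<Oplus>\<^bsub>S\<^esub>d\<in>insert m F. cis (d * s) \<odot>\<^bsub>S\<^esub> f' d) = (\<Oplus>\<^bsub>S\<^esub>d\<in>F. cis (d * s) \<odot>\<^bsub>S\<^esub> f d)"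
      using F(1) fc by (intro add.finprod_mono_neutral_cong) (auto simp: f'_def)
    also have "\<dots> = cis (m * s) \<odot>\<^bsub>S\<^esub> v"
      using gauge_finsum[OF F(1,2), of s] ev[of s] by (simp add: F(3))
    also have "(\<Oplus>\<^bsub>S\<^esub>d\<in>insert m F. if m = d then cis (m * s) \<odot>\<^bsub>S\<^esub> ((-1) \<odot>\<^bsub>S\<^esub> v) else \<zero>\<^bsub>S\<^esub>)
        = (-1) \<odot>\<^bsub>S\<^esub> (cis (m * s) \<odot>\<^bsub>S\<^esub> v)"
      using add.finprod_singleton[of m "insert m F" "\<lambda>_. cis (m * s) \<odot>\<^bsub>S\<^esub> ((-1) \<odot>\<^bsub>S\<^esub> v)"] F(1) v
      by (simp add: smult_smult)
    also have "cis (m * s) \<odot>\<^bsub>S\<^esub> v \<oplus>\<^bsub>S\<^esub> (-1) \<odot>\<^bsub>S\<^esub> (cis (m * s) \<odot>\<^bsub>S\<^esub> v) = \<zero>\<^bsub>S\<^esub>"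
      using v by (simp add: add_smult_eq_iff)
    finally show ?thesis .
  qed
  then have "g m = \<zero>\<^bsub>S\<^esub>"
    using F(1) c by (intro cis_separation[OF params(5), of "insert m F" g]) auto
  then have "f' m = v" using c v by (simp add: g_def add_smult_eq_iff)
  moreover have "f' m \<in> homog m"
  proof -
    have "\<zero>\<^bsub>S\<^esub> \<in> homog m" unfolding homog_def by (rule graded_sums.zero)
    then show ?thesis using F(2) by (simp add: f'_def)
  qed
  ultimately show ?thesis by simp
qed

subsection \<open>The coinvariants are generated by \<open>x\<close>, \<open>y\<close>, \<open>z\<close> and \<open>w\<close>\<close>

interpretation SH: tensor_pair S H
  by (rule tensor_pair.intro[OF star_algebra_axioms cyclic.star_algebra_axioms])

abbreviation coact where "coact \<equiv> cyclic_coaction p q \<theta> k l"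

lemma cyclic_coaction:
  defines "u \<equiv> cyclic_u (k * l)"
  shows "coact \<in> star_alg_hom S SH.T"
    and "coact a = SH.elem a (u [^]\<^bsub>H\<^esub> k)"
    and "coact b = SH.elem b (u [^]\<^bsub>H\<^esub> l)"
proof -
  have u: "u \<in> carrier H" by (simp add: u_def)
  note unitary = cyclic.unitary_pow[OF cyclic_u_closed cyclic_u_unitary, of "k * l", folded u_def]
  have comm: "u [^]\<^bsub>H\<^esub> k \<otimes>\<^bsub>H\<^esub> u [^]\<^bsub>H\<^esub> l = u [^]\<^bsub>H\<^esub> l \<otimes>\<^bsub>H\<^esub> u [^]\<^bsub>H\<^esub> k"
    using u by (simp add: cyclic.nat_pow_mult add.commute)
  have comm': "u [^]\<^bsub>H\<^esub> k \<otimes>\<^bsub>H\<^esub> star H (u [^]\<^bsub>H\<^esub> l) = star H (u [^]\<^bsub>H\<^esub> l) \<otimes>\<^bsub>H\<^esub> u [^]\<^bsub>H\<^esub> k"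
    using u by (intro cyclic.commute_star_unitary unitary comm) auto
  have pair: "sphere_pair SH.T (SH.elem a (u [^]\<^bsub>H\<^esub> k))
      (SH.elem b (u [^]\<^bsub>H\<^esub> l)) p q \<theta>"
    using u by (intro tensor_pair cyclic.star_algebra_axioms unitary comm comm') auto
  have eq: "coact = pres_map SH.T
      (case_s3_gen (SH.elem a (u [^]\<^bsub>H\<^esub> k)) (SH.elem b (u [^]\<^bsub>H\<^esub> l)))"
    by (simp add: cyclic_coaction_def Let_def u_def)
  show "coact \<in> star_alg_hom S SH.T"
    "coact a = SH.elem a (u [^]\<^bsub>H\<^esub> k)"
    "coact b = SH.elem b (u [^]\<^bsub>H\<^esub> l)"
    unfolding eq by (rule s3_hom[OF pair])+
qed

sublocale \<A>: star_algebra \<A>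
  unfolding A_alg_def
  by (rule coinvariants_star_algebra[OF star_algebra_axioms cyclic.star_algebra_axioms cyclic_coaction(1)])

lemma \<A>_simps [simp]:
  "one \<A> = \<one>\<^bsub>S\<^esub>" "zero \<A> = \<zero>\<^bsub>S\<^esub>" "monoid.mult \<A> = monoid.mult S" "add \<A> = add S" "module.smult \<A> = module.smult S"
  "star \<A> = star S"
  by (simp_all add: A_alg_def)

lemma \<A>_carrier: "carrier \<A> = {v \<in> carrier S. coact v = SH.elem v \<one>\<^bsub>H\<^esub>}"
  by (simp add: A_alg_def)

abbreviation gens :: "s3_gen sterm set set" where
  "gens \<equiv> {a [^]\<^bsub>S\<^esub> l, b [^]\<^bsub>S\<^esub> k, defect a, defect b}"

lemma gens_in_\<A>: "gens \<subseteq> carrier \<A>"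
proof -
  let ?u = "cyclic_u (k * l)"
  have u: "(?u [^]\<^bsub>H\<^esub> k) [^]\<^bsub>H\<^esub> l = \<one>\<^bsub>H\<^esub>" "(?u [^]\<^bsub>H\<^esub> l) [^]\<^bsub>H\<^esub> k = \<one>\<^bsub>H\<^esub>"
    using cyclic_u_pow[of "k * l"] by (simp_all add: cyclic.nat_pow_pow mult.commute)
  have "coact (a [^]\<^bsub>S\<^esub> l) = SH.elem (a [^]\<^bsub>S\<^esub> l) \<one>\<^bsub>H\<^esub>" "coact (b [^]\<^bsub>S\<^esub> k) = SH.elem (b [^]\<^bsub>S\<^esub> k) \<one>\<^bsub>H\<^esub>"
    by (simp_all add: star_alg_hom_pow[OF star_algebra_axioms cyclic_coaction(1)]
        cyclic_coaction(2,3) SH.elem_pow u)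
  moreover have "coact (defect a) = SH.elem (defect a) \<one>\<^bsub>H\<^esub>" "coact (defect b) = SH.elem (defect b) \<one>\<^bsub>H\<^esub>"
    using star_alg_hom_defect[OF star_algebra_axioms SH.tensor_star_algebra cyclic_coaction(1)]
    by (simp_all add: cyclic_coaction(2,3) cyclic.unitary_pow
        tensor_defect[OF star_algebra_axioms cyclic.star_algebra_axioms])
  ultimately show ?thesis by (simp add: \<A>_carrier)
qed

lemma star_gen_gens_\<A>: "star_gen \<A> gens \<subseteq> carrier \<A>"
  by (rule star_gen_subset[OF \<A>.star_algebra_axioms gens_in_\<A>])

text \<open>Coprimality enters here: if \<open>k l\<close> divides \<open>k i + l j\<close>, then \<open>l\<close> divides \<open>i\<close> and
  \<open>k\<close> divides \<open>j\<close>.\<close>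

lemma homog_in_star_gen:
  assumes "v \<in> homog d" "int (k * l) dvd d"
  shows "v \<in> star_gen S gens"
  using assms(1) unfolding homog_def
proof (induction rule: graded_sums.induct)
  case zero
  show ?case using star_gen.smult[OF star_gen.one[of S gens], where c = 0] by simp
next
  case (add x y)
  show ?case by (rule star_gen.add[OF add.IH])
next
  case (incl x ij)
  then have x: "x \<in> bihom ij" and d: "deg ij = d" by (auto split: if_splits)
  obtain i j where ij: "ij = (i, j)" by (cases ij)
  have kl_dvd: "int k dvd int k * i + int l * j" "int l dvd int k * i + int l * j"
    using assms(2) d by (auto simp: ij deg_def intro: dvd_mult_left dvd_mult_right)
  have cop: "coprime (int k) (int l)" using kl(3) by simp
  have "int k dvd int l * j" using kl_dvd(1) by (simp add: dvd_add_right_iff)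
  then have "int k dvd j" using cop by (simp add: coprime_dvd_mult_right_iff)
  then obtain j' where j: "j = int k * j'" ..
  have "int l dvd int k * i" using kl_dvd(2) by (simp add: dvd_add_left_iff)
  then have "int l dvd i" using cop by (simp add: coprime_dvd_mult_right_iff coprime_commute)
  then obtain i' where i: "i = int l * i'" ..
  obtain P where P: "P \<in> pol" "x = P \<otimes>\<^bsub>S\<^esub> zpow a i \<otimes>\<^bsub>S\<^esub> zpow b j"
    using x unfolding ij bihom_def prod.case by blast
  have "P \<in> star_gen S gens"
    using P(1) by induction (simp_all add: star_gen.intros)
  moreover have "zpow a i \<in> star_gen S gens" "zpow b j \<in> star_gen S gens"
    unfolding i j by (rule zpow_mult_in_star_gen; simp add: star_gen.gen)+
  ultimately show ?case unfolding P(2) by (intro star_gen.mult)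
qed

text \<open>Evaluating the coaction at a primitive root of unity shows that a coinvariant element only
  has components whose degree is a multiple of \<open>k l\<close>.\<close>

lemma \<A>_subset_star_gen:
  assumes v: "v \<in> carrier \<A>"
  shows "v \<in> star_gen S gens"
proof -
  define t where "t = 2 * pi / (k * l)"
  have vS: "v \<in> carrier S" using v by (simp add: \<A>_carrier)
  obtain \<phi> where \<phi>: "\<phi> \<in> star_alg_hom H complex_alg" "\<phi> (cyclic_u (k * l)) = cis t"
    using cyclic_ev[of "k * l"] kl unfolding t_def by auto
  have \<phi>_pow: "\<phi> (cyclic_u (k * l) [^]\<^bsub>H\<^esub> n) = cis (real n * t)" for n :: nat
    by (simp add: star_alg_hom_pow[OF cyclic.star_algebra_axioms \<phi>(1)] \<phi>(2) complex_alg_pow DeMoivre)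
  have contract_eq: "SH.contract \<phi> (coact x) = gauge t x" if "x \<in> carrier S" for x
  proof (rule star_alg_hom_eq_on_gen[where f = "\<lambda>x. SH.contract \<phi> (coact x)"])
    show "star_algebra S" by (rule star_algebra_axioms)
    show "{a, b} \<subseteq> carrier S" by simp
    show "(\<lambda>x. SH.contract \<phi> (coact x)) \<in> star_alg_hom S S"
      by (rule star_alg_hom_comp[OF cyclic_coaction(1) SH.contract_hom[OF \<phi>(1)]])
    show "gauge t \<in> star_alg_hom S S" by (rule gauge(1))
    show "SH.contract \<phi> (coact x) = gauge t x" if "x \<in> {a, b}" for x
      using that by (auto simp: cyclic_coaction(2,3) SH.contract_elem[OF \<phi>(1)] \<phi>_pow gauge(2,3))
    show "x \<in> star_gen S {a, b}" using that by (simp add: s3_generated)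
  qed
  have gauge_v: "gauge t v = v"
    using contract_eq[OF vS] v
    by (simp add: \<A>_carrier SH.contract_elem[OF \<phi>(1)] star_alg_hom_one[OF \<phi>(1)])
  obtain F f where F: "finite F" "\<And>d. f d \<in> homog d" "v = finsum S f F"
    using homog_decomposition[OF vS] by metis
  have fc: "f d \<in> carrier S" for d using F(2) homog_closed by blast
  define c where "c d = cis (real_of_int d * t) - 1" for d
  have "(\<Oplus>\<^bsub>S\<^esub>d\<in>F. cis (d * s) \<odot>\<^bsub>S\<^esub> (c d \<odot>\<^bsub>S\<^esub> f d)) = \<zero>\<^bsub>S\<^esub>" for s :: real
  proof -
    have "gauge s (gauge t v) = (\<Oplus>\<^bsub>S\<^esub>d\<in>F. gauge s (cis (d * t) \<odot>\<^bsub>S\<^esub> f d))"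
      unfolding F(3) gauge_finsum[OF F(1,2)] using fc
      by (intro star_alg_hom_finsum[OF star_algebra_axioms star_algebra_axioms gauge(1) F(1)]) auto
    also have "\<dots> = (\<Oplus>\<^bsub>S\<^esub>d\<in>F. cis (d * (s + t)) \<odot>\<^bsub>S\<^esub> f d)"
      using fc
      by (intro finsum_cong')
        (auto simp: star_alg_hom_smult[OF gauge(1)] gauge_homog[OF F(2)] smult_smult cis_mult
          algebra_simps)
    also have "\<dots> = gauge (s + t) v"
      unfolding F(3) gauge_finsum[OF F(1,2)] ..
    finally have "gauge (s + t) v = gauge s (gauge t v)" ..
    then have eq: "gauge (s + t) v = gauge s v" by (simp add: gauge_v)
    have "gauge (s + t) v = (\<Oplus>\<^bsub>S\<^esub>d\<in>F. cis (d * s) \<odot>\<^bsub>S\<^esub> (c d \<odot>\<^bsub>S\<^esub> f d) \<oplus>\<^bsub>S\<^esub> cis (d * s) \<odot>\<^bsub>S\<^esub> f d)"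
      unfolding F(3) gauge_finsum[OF F(1,2)] using fc
      by (intro finsum_cong')
        (auto simp: smult_smult smult_add_left[symmetric] c_def cis_mult algebra_simps)
    also have "\<dots> = (\<Oplus>\<^bsub>S\<^esub>d\<in>F. cis (d * s) \<odot>\<^bsub>S\<^esub> (c d \<odot>\<^bsub>S\<^esub> f d)) \<oplus>\<^bsub>S\<^esub> gauge s v"
      unfolding F(3) gauge_finsum[OF F(1,2)] using fc by (simp add: finsum_addf)
    finally show ?thesis
      using fc vS star_alg_hom_closed[OF gauge(1)]
      by (simp add: eq add.r_cancel_one' Pi_iff)
  qed
  then have "c d \<odot>\<^bsub>S\<^esub> f d = \<zero>\<^bsub>S\<^esub>" if "d \<in> F" for d
    using fc by (intro cis_separation[OF params(5) F(1) _ _ that, of "\<lambda>d. c d \<odot>\<^bsub>S\<^esub> f d"]) auto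
  then have zero: "f d = \<zero>\<^bsub>S\<^esub>" if "d \<in> F" "c d \<noteq> 0" for d
    using that fc smult_eq_zero_iff by blast
  have dvd: "int (k * l) dvd d" if "c d = 0" for d
  proof -
    have "cis (d * t) = 1" using that by (simp add: c_def)
    then have "cos (d * t) = 1" by (metis cis.sel(1) one_complex.sel(1))
    then obtain n :: int where "d * t = real_of_int n * 2 * pi" using cos_one_2pi_int by blast
    then have "real_of_int d = real_of_int n * real (k * l)"
      using kl unfolding t_def by (simp add: field_simps)
    then have "real_of_int d = real_of_int (n * int (k * l))" by simp
    then have "d = n * int (k * l)" by (simp only: of_int_eq_iff)
    then show ?thesis by simp
  qed
  have zero_gen: "\<zero>\<^bsub>S\<^esub> \<in> star_gen S gens"
    using star_gen.smult[OF star_gen.one[of S gens], where c = 0] by simp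
  have gen: "f d \<in> star_gen S gens" if "d \<in> F" for d
    using zero[OF that] dvd[of d] homog_in_star_gen[OF F(2)] zero_gen by metis
  show ?thesis
    unfolding F(3) using F(1) gen
  proof (induction F rule: finite_induct)
    case (insert d F)
    then show ?case using fc by (simp add: Pi_iff star_gen.add)
  qed (simp add: zero_gen)
qed

lemma \<A>_generated: "carrier \<A> = star_gen \<A> gens"
proof
  have "v \<in> star_gen \<A> gens" if "v \<in> star_gen S gens" for v
    using that
  proof induction
    case gen then show ?case by (rule star_gen.gen)
  next
    case one show ?case using star_gen.one[of \<A> gens] by simp
  next
    case add then show ?case using star_gen.add[of _ \<A> gens] by simp
  next
    case mult then show ?case using star_gen.mult[of _ \<A> gens] by simp
  next
    case smult then show ?case using star_gen.smult[of _ \<A> gens] by simp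
  next
    case star then show ?case using star_gen.star[of _ \<A> gens] by simp
  qed
  then show "carrier \<A> \<subseteq> star_gen \<A> gens" using \<A>_subset_star_gen by blast
qed (rule star_gen_gens_\<A>)

subsection \<open>The coaction of the circle\<close>

interpretation AC: tensor_pair \<A> circle_alg
  by (rule tensor_pair.intro[OF \<A>.star_algebra_axioms circle.star_algebra_axioms])

abbreviation rho_gens where
  "rho_gens \<equiv> {(a [^]\<^bsub>S\<^esub> l, tensor_elem \<A> circle_alg (a [^]\<^bsub>S\<^esub> l) circle_u),
    (b [^]\<^bsub>S\<^esub> k, tensor_elem \<A> circle_alg (b [^]\<^bsub>S\<^esub> k) circle_u),
    (defect a, tensor_elem \<A> circle_alg (defect a) \<one>\<^bsub>circle_alg\<^esub>),
    (defect b, tensor_elem \<A> circle_alg (defect b) \<one>\<^bsub>circle_alg\<^esub>)}"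

abbreviation rho_graph where "rho_graph \<equiv> hom_graph \<A> (tensor \<A> circle_alg) rho_gens"

lemma rho_gens_closed: "rho_gens \<subseteq> carrier \<A> \<times> carrier AC.T"
  using gens_in_\<A> by simp

text \<open>Evaluating the circle at \<open>cis (k l s)\<close> turns the coaction into the gauge action.\<close>

lemma contract_rho_graph:
  assumes "(v, X) \<in> rho_graph"
  shows "AC.contract (circle_ev (real (k * l) * s)) X = gauge s v"
proof -
  let ?c = "AC.contract (circle_ev (real (k * l) * s))"
  note c = AC.contract_hom[OF circle_ev(1), of "real (k * l) * s"]
  have closed: "v \<in> carrier S" "X \<in> carrier AC.T"
    if "(v, X) \<in> rho_graph" for v X
    using that hom_graph_closed[OF \<A>.star_algebra_axioms AC.tensor_star_algebra rho_gens_closed]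
    by (auto simp: \<A>_carrier)
  have gen: "?c X = gauge s v" if "(v, X) \<in> rho_gens" for v X
  proof -
    have "?c (AC.elem x circle_u) = cis (real (k * l) * s) \<odot>\<^bsub>S\<^esub> x"
      "?c (AC.elem x \<one>\<^bsub>circle_alg\<^esub>) = x" if "x \<in> carrier \<A>" for x
      using that \<A>.smult_one[OF that]
      by (simp_all add: AC.contract_elem[OF circle_ev(1)] circle_ev(2) star_alg_hom_one[OF circle_ev(1)])
    moreover have "gauge s (a [^]\<^bsub>S\<^esub> l) = cis (real (k * l) * s) \<odot>\<^bsub>S\<^esub> a [^]\<^bsub>S\<^esub> l"
      "gauge s (b [^]\<^bsub>S\<^esub> k) = cis (real (k * l) * s) \<odot>\<^bsub>S\<^esub> b [^]\<^bsub>S\<^esub> k"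
      by (simp_all add: star_alg_hom_pow[OF star_algebra_axioms gauge(1)] gauge(2,3) smult_pow
          DeMoivre mult_ac)
    ultimately show ?thesis using that gens_in_\<A> by (auto simp: gauge_defect)
  qed
  have "?c (snd vX) = gauge s (fst vX)" if "vX \<in> rho_graph" for vX
    using that
  proof induction
    case (gen vX)
    then show ?case using \<open>\<And>v X. (v, X) \<in> rho_gens \<Longrightarrow> ?c X = gauge s v\<close>[of "fst vX" "snd vX"] by (simp del: of_nat_mult)
  next
    case one
    show ?case using star_alg_hom_one[OF c] star_alg_hom_one[OF gauge(1)] by simp
  qed (simp_all add: closed star_alg_homD[OF c] star_alg_homD[OF gauge(1)] del: of_nat_mult)
  from this[OF assms] show ?thesis by simp
qed

lemma rho_graph_functional:
  assumes "(v, X) \<in> rho_graph"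
    and "(v, Y) \<in> rho_graph"
  shows "X = Y"
proof (rule contract_circle_ev_eq[OF \<A>.star_algebra_axioms params(5)])
  show "X \<in> carrier AC.T" "Y \<in> carrier AC.T"
    using assms hom_graph_closed[OF \<A>.star_algebra_axioms AC.tensor_star_algebra rho_gens_closed]
    by auto
  fix t :: real
  have "real (k * l) * (t / real (k * l)) = t" using kl by simp
  then show "AC.contract (circle_ev t) X = AC.contract (circle_ev t) Y"
    using contract_rho_graph[OF assms(1), of "t / real (k * l)"]
      contract_rho_graph[OF assms(2), of "t / real (k * l)"] by metis
qed

lemma rho_candidates_eq:
  "f \<in> rho_candidates p q \<theta> k l \<longleftrightarrow>
    f \<in> star_alg_hom \<A> AC.T \<inter> extensional (carrier \<A>) \<and> (\<forall>(v, X)\<in>rho_gens. f v = X)"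
  by (simp add: rho_candidates_def Let_def s3_A_eq s3_B_eq)

text \<open>Since \<open>rho\<close> is a definite description, its defining values are only available once there is
  exactly one candidate.\<close>

lemma rho:
  "rho p q \<theta> k l \<in> star_alg_hom \<A> AC.T"
  "(v, X) \<in> rho_gens \<Longrightarrow> rho p q \<theta> k l v = X"
proof -
  have fst: "fst ` rho_gens = gens" by simp
  have "\<exists>!f. f \<in> rho_candidates p q \<theta> k l"
    unfolding rho_candidates_eq
    by (rule hom_of_graph[OF \<A>.star_algebra_axioms AC.tensor_star_algebra rho_gens_closed _
          rho_graph_functional]) (simp_all only: fst \<A>_generated[symmetric])
  from theI'[OF this] have "rho p q \<theta> k l \<in> rho_candidates p q \<theta> k l"
    unfolding rho_def .
  then show "rho p q \<theta> k l \<in> star_alg_hom \<A> AC.T"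
    "(v, X) \<in> rho_gens \<Longrightarrow> rho p q \<theta> k l v = X"
    unfolding rho_candidates_eq by blast+
qed

lemma gauge_if_rho:
  assumes v: "v \<in> carrier \<A>" and rho_v: "rho p q \<theta> k l v = AC.elem v circle_u"
  shows "gauge s v = cis (real (k * l) * s) \<odot>\<^bsub>S\<^esub> v"
proof -
  have fst: "fst ` rho_gens = gens" by simp
  have "(v, rho p q \<theta> k l v) \<in> rho_graph"
    by (rule hom_in_graph[OF \<A>.star_algebra_axioms])
      (use rho v in \<open>simp_all only: fst \<A>_generated[symmetric] gens_in_\<A>\<close>)
  from contract_rho_graph[OF this, of s] show ?thesis
    using v by (simp add: rho_v AC.contract_elem[OF circle_ev(1)] circle_ev(2))
qed

end

section \<open>Representations by weighted shifts\<close>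

type_synonym seq = "int \<Rightarrow> complex"

text \<open>Linear operators that preserve the sequences supported on the natural numbers.\<close>

definition ops :: "(seq \<Rightarrow> seq) set" where
  "ops = {T. (\<forall>f g. T (\<lambda>i. f i + g i) = (\<lambda>i. T f i + T g i)) \<and> (\<forall>c f. T (\<lambda>i. c * f i) = (\<lambda>i. c * T f i)) \<and>
    (\<forall>f. (\<forall>i<0. f i = 0) \<longrightarrow> (\<forall>i<0. T f i = 0))}"

text \<open>An operator together with a second one that plays the role of its adjoint; \<open>star\<close> exchanges
  them. In this way any algebra of operators becomes a *-algebra, and representations with polynomial
  instead of square root weights are available.\<close>

definition op_alg :: "((seq \<Rightarrow> seq) \<times> (seq \<Rightarrow> seq)) star_algebra" where
  "op_alg = \<lparr>carrier = ops \<times> ops,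
     monoid.mult = (\<lambda>X Y. (\<lambda>f. fst X (fst Y f), \<lambda>f. snd Y (snd X f))),
     one = (\<lambda>f. f, \<lambda>f. f), zero = (\<lambda>f i. 0, \<lambda>f i. 0),
     add = (\<lambda>X Y. (\<lambda>f i. fst X f i + fst Y f i, \<lambda>f i. snd X f i + snd Y f i)),
     module.smult = (\<lambda>c X. (\<lambda>f i. c * fst X f i, \<lambda>f i. cnj c * snd X f i)),
     star = (\<lambda>X. (snd X, fst X))\<rparr>"

lemma op_alg_simps [simp]:
  "carrier op_alg = ops \<times> ops"
  "X \<otimes>\<^bsub>op_alg\<^esub> Y = (\<lambda>f. fst X (fst Y f), \<lambda>f. snd Y (snd X f))"
  "one op_alg = (\<lambda>f. f, \<lambda>f. f)" "zero op_alg = (\<lambda>f i. 0, \<lambda>f i. 0)"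
  "X \<oplus>\<^bsub>op_alg\<^esub> Y = (\<lambda>f i. fst X f i + fst Y f i, \<lambda>f i. snd X f i + snd Y f i)"
  "c \<odot>\<^bsub>op_alg\<^esub> X = (\<lambda>f i. c * fst X f i, \<lambda>f i. cnj c * snd X f i)"
  "star op_alg X = (snd X, fst X)"
  by (simp_all add: op_alg_def)

lemma ops_add: "T \<in> ops \<Longrightarrow> T (\<lambda>i. f i + g i) = (\<lambda>i. T f i + T g i)"
  and ops_scale: "T \<in> ops \<Longrightarrow> T (\<lambda>i. c * f i) = (\<lambda>i. c * T f i)"
  and ops_support: "T \<in> ops \<Longrightarrow> (\<And>i. i < 0 \<Longrightarrow> f i = 0) \<Longrightarrow> i < 0 \<Longrightarrow> T f i = 0"
  unfolding ops_def by blast+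

lemma opsI:
  assumes "\<And>f g i. T (\<lambda>i. f i + g i) i = T f i + T g i" "\<And>c f i. T (\<lambda>i. c * f i) i = c * T f i"
    and "\<And>f i. (\<And>i. i < 0 \<Longrightarrow> f i = 0) \<Longrightarrow> i < 0 \<Longrightarrow> T f i = 0"
  shows "T \<in> ops"
  using assms by (auto simp: ops_def fun_eq_iff)

lemma op_alg_star_algebra: "star_algebra op_alg"
proof -
  have [simp]: "(\<lambda>f. f) \<in> ops" "(\<lambda>f i. 0) \<in> ops"
    by (auto intro: opsI)
  have [simp]: "(\<lambda>f i. T f i + U f i) \<in> ops" if "T \<in> ops" "U \<in> ops" for T U
    using that by (intro opsI) (simp_all add: ops_add ops_scale ops_support algebra_simps)
  have [simp]: "(\<lambda>f. T (U f)) \<in> ops" if "T \<in> ops" "U \<in> ops" for T U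
    using that by (intro opsI) (simp_all add: ops_add ops_scale ops_support)
  have [simp]: "(\<lambda>f i. c * T f i) \<in> ops" if "T \<in> ops" for T c
    using that by (intro opsI) (simp_all add: ops_add ops_scale ops_support algebra_simps)
  show ?thesis
    by (rule star_algebraI) (auto simp: ops_add ops_scale algebra_simps)
qed

interpretation op_alg: star_algebra op_alg
  by (rule op_alg_star_algebra)

lemma fst_op_finsum:
  "finite F \<Longrightarrow> (\<And>s. s \<in> F \<Longrightarrow> g s \<in> carrier op_alg) \<Longrightarrow>
    fst (finsum op_alg g F) f n = (\<Sum>s\<in>F. fst (g s) f n)"
proof (induction F rule: finite_induct)
  case (insert s F)
  then have "finsum op_alg g (insert s F) = g s \<oplus>\<^bsub>op_alg\<^esub> finsum op_alg g F"
    by (intro op_alg.finsum_insert) auto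
  with insert show ?case by simp
qed simp

abbreviation rpow :: "real \<Rightarrow> int \<Rightarrow> complex"  (infixr "\<up>" 80) where
  "r \<up> n \<equiv> complex_of_real r powi n"

definition rotation :: "real \<Rightarrow> (seq \<Rightarrow> seq) \<times> (seq \<Rightarrow> seq)" where
  "rotation \<theta> = (\<lambda>f i. cis (2 * pi * \<theta> * i) * f i, \<lambda>f i. cis (- (2 * pi * \<theta> * i)) * f i)"

text \<open>The weights are those of the usual representation of the quantum disc, moved to the
  adjoint of the shift so that they depend polynomially on \<open>r\<^sup>i\<close>. The vanishing weight at
  \<open>-1\<close> keeps the support in the natural numbers.\<close>

definition shift :: "real \<Rightarrow> (seq \<Rightarrow> seq) \<times> (seq \<Rightarrow> seq)" where
  "shift r = (\<lambda>f i. f (i - 1), \<lambda>f i. (1 - r \<up> (i + 1)) * f (i + 1))"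

lemma rotation_closed: "rotation \<theta> \<in> carrier op_alg"
  by (auto simp: rotation_def algebra_simps intro!: opsI)

lemma shift_closed: "shift r \<in> carrier op_alg"
proof -
  have "(1 - r \<up> (i + 1)) * f (i + 1) = 0"
    if "\<And>i. i < 0 \<Longrightarrow> f i = 0" "i < 0" for f :: seq and i
    using that by (cases "i = -1") auto
  then show ?thesis by (auto simp: shift_def algebra_simps intro!: opsI)
qed

lemma cis_cancel: "cis x * (cis (- x) * z) = z" "cis (- x) * (cis x * z) = z"
proof -
  have "(cis x * cis (- x)) * z = z" "(cis (- x) * cis x) * z = z" by (simp_all add: cis_mult)
  then show "cis x * (cis (- x) * z) = z" "cis (- x) * (cis x * z) = z" by (simp_all only: mult.assoc)
qed

lemma rotation_shift_pair:
  assumes "0 < r"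
  shows "sphere_pair op_alg (rotation \<theta>) (shift r) p r \<theta>"
proof
  let ?E = op_alg
  have r: "r \<up> (i + 1) = r * r \<up> i" for i :: int
    using assms by (simp add: power_int_add)
  have r': "complex_of_real r * r \<up> (i - 1) = r \<up> i" for i :: int
    using r[of "i - 1"] by simp
  show "rotation \<theta> \<in> carrier op_alg" "shift r \<in> carrier op_alg"
    by (rule rotation_closed shift_closed)+
  show "rotation \<theta> \<otimes>\<^bsub>?E\<^esub> shift r = cis (2 * pi * \<theta>) \<odot>\<^bsub>?E\<^esub> (shift r \<otimes>\<^bsub>?E\<^esub> rotation \<theta>)"
    by (simp add: rotation_def shift_def fun_eq_iff cis_cnj cis_mult algebra_simps)
  show "rotation \<theta> \<otimes>\<^bsub>?E\<^esub> star ?E (shift r) =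
      cis (- (2 * pi * \<theta>)) \<odot>\<^bsub>?E\<^esub> (star ?E (shift r) \<otimes>\<^bsub>?E\<^esub> rotation \<theta>)"
    by (simp add: rotation_def shift_def fun_eq_iff cis_cnj cis_mult algebra_simps)
  show "star ?E (rotation \<theta>) \<otimes>\<^bsub>?E\<^esub> rotation \<theta> = (1 - p) \<odot>\<^bsub>?E\<^esub> \<one>\<^bsub>?E\<^esub> \<oplus>\<^bsub>?E\<^esub>
      p \<odot>\<^bsub>?E\<^esub> (rotation \<theta> \<otimes>\<^bsub>?E\<^esub> star ?E (rotation \<theta>))"
    by (simp add: rotation_def fun_eq_iff cis_cancel ring_distribs)
  show "star ?E (shift r) \<otimes>\<^bsub>?E\<^esub> shift r = (1 - r) \<odot>\<^bsub>?E\<^esub> \<one>\<^bsub>?E\<^esub> \<oplus>\<^bsub>?E\<^esub>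
      r \<odot>\<^bsub>?E\<^esub> (shift r \<otimes>\<^bsub>?E\<^esub> star ?E (shift r))"
    by (simp add: shift_def fun_eq_iff r r' algebra_simps)
  show "(\<one>\<^bsub>?E\<^esub> \<oplus>\<^bsub>?E\<^esub> (-1) \<odot>\<^bsub>?E\<^esub> (rotation \<theta> \<otimes>\<^bsub>?E\<^esub> star ?E (rotation \<theta>))) \<otimes>\<^bsub>?E\<^esub>
      (\<one>\<^bsub>?E\<^esub> \<oplus>\<^bsub>?E\<^esub> (-1) \<odot>\<^bsub>?E\<^esub> (shift r \<otimes>\<^bsub>?E\<^esub> star ?E (shift r))) = \<zero>\<^bsub>?E\<^esub>"
    by (simp add: rotation_def shift_def fun_eq_iff cis_cancel)
qed

lemma defect_rotation: "fst (op_alg.defect (rotation \<theta>)) f n = 0"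
  by (simp add: op_alg.defect_def rotation_def cis_cancel)

lemma defect_shift: "fst (op_alg.defect (shift r)) f n = r \<up> n * f n"
  by (simp add: op_alg.defect_def shift_def algebra_simps)

lemma fst_zpow_rotation: "fst (op_alg.zpow (rotation \<theta>) i) f n = cis (2 * pi * \<theta> * i * n) * f n"
proof -
  have 1: "fst (rotation \<theta> [^]\<^bsub>op_alg\<^esub> m) f n = cis (2 * pi * \<theta> * real m * n) * f n" for m f
  proof (induction m arbitrary: f)
    case (Suc m)
    then show ?case by (simp add: op_alg.nat_pow_Suc) (simp add: rotation_def cis_mult algebra_simps)
  qed simp
  have 2: "fst (star op_alg (rotation \<theta>) [^]\<^bsub>op_alg\<^esub> m) f n = cis (- (2 * pi * \<theta> * real m * n)) * f n" for m f
  proof (induction m arbitrary: f)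
    case (Suc m)
    then show ?case by (simp add: op_alg.nat_pow_Suc) (simp add: rotation_def cis_mult algebra_simps)
  qed simp
  show ?thesis using 1[of "nat i"] 2[of "nat (- i)"] by (simp add: op_alg.zpow_def del: pow_nat op_alg_simps)
qed

lemma fst_zpow_shift:
  assumes "0 < r"
  shows "\<exists>R. poly R 0 = 1 \<and>
    (\<forall>f n. fst (op_alg.zpow (shift r) j) f n = poly R (r \<up> n) * f (n - j))"
proof (cases "0 \<le> j")
  case True
  have "fst (shift r [^]\<^bsub>op_alg\<^esub> m) f n = f (n - int m)" for m f n
  proof (induction m arbitrary: f)
    case (Suc m)
    then show ?case by (simp add: op_alg.nat_pow_Suc) (simp add: shift_def algebra_simps)
  qed simp
  from this[of "nat j"] True show ?thesis
    by (intro exI[of _ 1]) (simp add: op_alg.zpow_def del: pow_nat)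
next
  case False
  have "\<exists>R. poly R 0 = 1 \<and> (\<forall>f n. fst (star op_alg (shift r) [^]\<^bsub>op_alg\<^esub> m) f n =
      poly R (r \<up> n) * f (n + int m))" for m
  proof (induction m)
    case (Suc m)
    then obtain R where R: "poly R 0 = 1" "\<And>f n. fst (star op_alg (shift r) [^]\<^bsub>op_alg\<^esub> m) f n =
        poly R (r \<up> n) * f (n + int m)" by blast
    have pow: "r \<up> (n + int m + 1) = r \<up> n * complex_of_real r ^ Suc m" for n
    proof -
      have "r \<up> (n + int (Suc m)) = r \<up> n * complex_of_real r ^ Suc m"
        using assms by (subst power_int_add) (simp_all only: power_int_of_nat, simp)
      then show ?thesis by (simp add: algebra_simps)
    qed
    have "fst (star op_alg (shift r) [^]\<^bsub>op_alg\<^esub> Suc m) f n =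
        poly (R * [:1, - (complex_of_real r ^ Suc m):]) (r \<up> n) * f (n + int (Suc m))" for f n
    proof -
      have "fst (star op_alg (shift r) [^]\<^bsub>op_alg\<^esub> Suc m) f n =
          fst (star op_alg (shift r) [^]\<^bsub>op_alg\<^esub> m) (snd (shift r) f) n"
        by (simp add: op_alg.nat_pow_Suc)
      also have "\<dots> = poly R (r \<up> n) *
          ((1 - r \<up> (n + int m + 1)) * f (n + int m + 1))"
        unfolding R(2) by (simp add: shift_def)
      finally show ?thesis unfolding pow by (simp add: algebra_simps)
    qed
    with R(1) show ?case by (intro exI[of _ "R * [:1, - (complex_of_real r ^ Suc m):]"]) simp
  qed (intro exI[of _ 1], simp)
  from this[of "nat (- j)"] False show ?thesis
    by (simp add: op_alg.zpow_def del: pow_nat op_alg_simps)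
qed

section \<open>Invertible band operators\<close>

text \<open>A band operator whose entries on each diagonal are, up to phases, values of a polynomial at
  the powers of \<open>r\<close>.\<close>

definition band_op :: "real \<Rightarrow> int set \<Rightarrow> (int \<Rightarrow> complex poly) \<Rightarrow> (int \<Rightarrow> int) \<Rightarrow> (seq \<Rightarrow> seq) \<Rightarrow> bool" where
  "band_op r I h \<nu> T \<longleftrightarrow> finite I \<and> inj_on \<nu> I \<and> T \<in> ops \<and> (\<exists>\<omega>. (\<forall>s n. cmod (\<omega> s n) = 1) \<and>
    (\<forall>f n. T f n = (\<Sum>s\<in>I. poly (h s) (r \<up> n) * \<omega> s n * f (n - \<nu> s))))"

lemma band_opE:
  assumes "band_op r I h \<nu> T"
  obtains \<omega> where "\<And>s n. cmod (\<omega> s n) = 1"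
    "\<And>f n. T f n = (\<Sum>s\<in>I. poly (h s) (r \<up> n) * \<omega> s n * f (n - \<nu> s))"
proof -
  from assms have "\<exists>\<omega>. (\<forall>s n. cmod (\<omega> s n) = 1) \<and>
      (\<forall>f n. T f n = (\<Sum>s\<in>I. poly (h s) (r \<up> n) * \<omega> s n * f (n - \<nu> s)))"
    unfolding band_op_def by (elim conjE)
  then obtain \<omega> where \<omega>: "\<forall>s n. cmod (\<omega> s n) = 1"
      "\<forall>f n. T f n = (\<Sum>s\<in>I. poly (h s) (r \<up> n) * \<omega> s n * f (n - \<nu> s))"
    by (elim exE conjE)
  show thesis by (rule that[OF \<omega>(1)[rule_format] \<omega>(2)[rule_format]])
qed

lemma ex_maximizer:
  fixes f :: "'b \<Rightarrow> int"
  assumes "finite S" "S \<noteq> {}"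
  shows "\<exists>x\<in>S. \<forall>y\<in>S. f y \<le> f x"
proof -
  have "Max (f ` S) \<in> f ` S" using assms by (intro Max_in) auto
  then obtain x where x: "x \<in> S" "Max (f ` S) = f x" by blast
  have "f y \<le> f x" if "y \<in> S" for y
    unfolding x(2)[symmetric] using assms(1) that by (intro Max_ge) auto
  with x(1) show ?thesis by blast
qed

definition unit_seq :: "int \<Rightarrow> seq" where
  "unit_seq c n = (if n = c then 1 else 0)"

lemma finite_poly_roots_powi:
  assumes "0 < r" "r < (1::real)" "h \<noteq> 0"
  shows "finite {n::int. poly h (r \<up> (n + d)) = 0}"
proof (rule finite_imageD)
  show "finite ((\<lambda>n. r \<up> (n + d)) ` {n. poly h (r \<up> (n + d)) = 0})"
    by (rule finite_subset[OF _ poly_roots_finite[OF assms(3)]]) auto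
  show "inj_on (\<lambda>n. r \<up> (n + d)) {n. poly h (r \<up> (n + d)) = 0}"
  proof (rule inj_onI)
    fix m n assume "r \<up> (m + d) = r \<up> (n + d)"
    then have "complex_of_real (r powi (m + d)) = complex_of_real (r powi (n + d))"
      by (simp add: of_real_power_int)
    then have "r powi (m + d) = r powi (n + d)" by (simp only: of_real_eq_iff)
    then show "m = n"
      using assms power_int_strict_decreasing[of "m + d" "n + d" r]
        power_int_strict_decreasing[of "n + d" "m + d" r]
      by (cases m n rule: linorder_cases) auto
  qed
qed

text \<open>In a product the entries on the outermost diagonals are products of entries on the outermost
  diagonals of the factors, and these do not vanish far out. The sign \<open>\<epsilon>\<close> selects the upper
  or the lower end.\<close>

lemma extreme_bands_cancel:
  fixes \<epsilon> :: int
  assumes r: "0 < r" "r < 1" and T: "band_op r I h \<nu> T" and T': "band_op r J g \<mu> T'"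
    and inv: "\<And>f. T (T' f) = f"
    and s: "s \<in> I" "h s \<noteq> 0" "\<And>s'. s' \<in> I \<Longrightarrow> h s' \<noteq> 0 \<Longrightarrow> \<epsilon> * \<nu> s' \<le> \<epsilon> * \<nu> s"
    and t: "t \<in> J" "g t \<noteq> 0" "\<And>t'. t' \<in> J \<Longrightarrow> g t' \<noteq> 0 \<Longrightarrow> \<epsilon> * \<mu> t' \<le> \<epsilon> * \<mu> t"
    and \<epsilon>: "\<epsilon> \<in> {1, -1}"
  shows "\<nu> s + \<mu> t = 0"
proof -
  obtain \<omega> where \<omega>: "\<And>s n. cmod (\<omega> s n) = 1"
    "\<And>f n. T f n = (\<Sum>s\<in>I. poly (h s) (r \<up> n) * \<omega> s n * f (n - \<nu> s))"
    by (rule band_opE[OF T]) (rule that)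
  obtain \<omega>' where \<omega>': "\<And>s n. cmod (\<omega>' s n) = 1"
    "\<And>f n. T' f n = (\<Sum>s\<in>J. poly (g s) (r \<up> n) * \<omega>' s n * f (n - \<mu> s))"
    by (rule band_opE[OF T']) (rule that)
  have fin: "finite I" "finite J" and inj: "inj_on \<nu> I" "inj_on \<mu> J"
    using T T' by (auto simp: band_op_def)
  have "finite ({n. poly (h s) (r \<up> (n + (\<nu> s + \<mu> t))) = 0} \<union>
      {n. poly (g t) (r \<up> (n + \<mu> t)) = 0})"
    using finite_poly_roots_powi[OF r] s(2) t(2) by simp
  from ex_new_if_finite[OF infinite_UNIV_int this] obtain c where
    c: "poly (h s) (r \<up> (c + (\<nu> s + \<mu> t))) \<noteq> 0"
      "poly (g t) (r \<up> (c + \<mu> t)) \<noteq> 0" by auto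
  define N where "N = c + (\<nu> s + \<mu> t)"
  have far: "T' (unit_seq c) (N - \<nu> s') = 0" if "s' \<in> I" "h s' \<noteq> 0" "s' \<noteq> s" for s'
    unfolding \<omega>'(2)
  proof (rule sum.neutral, rule ballI)
    fix t' assume t': "t' \<in> J"
    have "\<nu> s' \<noteq> \<nu> s" using inj(1) that s(1) by (auto simp: inj_on_def)
    then have "\<epsilon> * \<nu> s' < \<epsilon> * \<nu> s" using s(3)[OF that(1,2)] \<epsilon> by auto
    moreover have "g t' = 0 \<or> \<epsilon> * \<mu> t' \<le> \<epsilon> * \<mu> t" using t(3)[OF t'] by blast
    ultimately have "g t' = 0 \<or> N - \<nu> s' - \<mu> t' \<noteq> c" using \<epsilon> by (auto simp: N_def)
    then show "poly (g t') (r \<up> (N - \<nu> s')) * \<omega>' t' (N - \<nu> s') *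
        unit_seq c (N - \<nu> s' - \<mu> t') = 0"
      by (auto simp: unit_seq_def)
  qed
  have near: "T' (unit_seq c) (N - \<nu> s) = poly (g t) (r \<up> (c + \<mu> t)) * \<omega>' t (c + \<mu> t)"
  proof -
    have "T' (unit_seq c) (N - \<nu> s) = (\<Sum>t'\<in>J. if t' = t then
        poly (g t) (r \<up> (c + \<mu> t)) * \<omega>' t (c + \<mu> t) else 0)"
      unfolding \<omega>'(2) using inj(2) t(1)
      by (intro sum.cong) (auto simp: N_def unit_seq_def inj_on_def)
    then show ?thesis using fin t(1) by simp
  qed
  have "T (T' (unit_seq c)) N = (\<Sum>s'\<in>I. if s' = s then
      poly (h s) (r \<up> N) * \<omega> s N * T' (unit_seq c) (N - \<nu> s) else 0)"
  proof -
    have "poly (h x) (r \<up> N) * \<omega> x N * T' (unit_seq c) (N - \<nu> x) =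
        (if x = s then poly (h s) (r \<up> N) * \<omega> s N * T' (unit_seq c) (N - \<nu> s) else 0)"
      if "x \<in> I" for x
      using far[OF that] by (cases "x = s"; cases "h x = 0") simp_all
    then show ?thesis unfolding \<omega>(2)[of "T' (unit_seq c)"] by (rule sum.cong[OF HOL.refl])
  qed
  also have "\<dots> \<noteq> 0"
  proof -
    have "\<omega> s N \<noteq> 0" using \<omega>(1)[of s N] by (metis norm_zero zero_neq_one)
    moreover have "\<omega>' t (c + \<mu> t) \<noteq> 0" using \<omega>'(1)[of t "c + \<mu> t"] by (metis norm_zero zero_neq_one)
    ultimately show ?thesis using fin(1) s(1) c unfolding near N_def[symmetric] by simp
  qed
  finally have "unit_seq c N \<noteq> 0" by (simp add: inv)
  then show ?thesis by (simp add: unit_seq_def N_def split: if_splits)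
qed

text \<open>If a band operator and its inverse are both of this kind, the outermost diagonals coincide, so
  that only one diagonal is left. It is the main one because both operators preserve the support in
  the natural numbers: otherwise one of them would move the first unit vector out of it.\<close>

lemma invertible_band_op:
  assumes r: "0 < r" "r < 1" and T: "band_op r I h \<nu> T" and T': "band_op r J g \<mu> T'"
    and inv: "\<And>f. T (T' f) = f" "\<And>f. T' (T f) = f"
  shows "\<And>s. s \<in> I \<Longrightarrow> \<nu> s \<noteq> 0 \<Longrightarrow> h s = 0" and "\<exists>s\<in>I. \<nu> s = 0 \<and> poly (h s) 0 \<noteq> 0"
proof -
  obtain \<omega> where \<omega>: "\<And>s n. cmod (\<omega> s n) = 1"
    "\<And>f n. T f n = (\<Sum>s\<in>I. poly (h s) (r \<up> n) * \<omega> s n * f (n - \<nu> s))"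
    by (rule band_opE[OF T]) (rule that)
  obtain \<omega>' where \<omega>': "\<And>s n. cmod (\<omega>' s n) = 1"
    "\<And>f n. T' f n = (\<Sum>s\<in>J. poly (g s) (r \<up> n) * \<omega>' s n * f (n - \<mu> s))"
    by (rule band_opE[OF T']) (rule that)
  have fin: "finite I" "finite J" and inj: "inj_on \<nu> I" "inj_on \<mu> J" and ops: "T \<in> ops" "T' \<in> ops"
    using T T' by (auto simp: band_op_def)
  let ?I = "{s \<in> I. h s \<noteq> 0}" and ?J = "{t \<in> J. g t \<noteq> 0}"
  have one: "unit_seq 0 0 = 1" by (simp add: unit_seq_def)
  have I_ne: "?I \<noteq> {}"
  proof
    assume "?I = {}"
    then have "T (T' (unit_seq 0)) 0 = 0" unfolding \<omega>(2)[of "T' (unit_seq 0)"] by (intro sum.neutral) auto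
    then show False by (simp add: inv one)
  qed
  have J_ne: "?J \<noteq> {}"
  proof
    assume "?J = {}"
    then have "T' (T (unit_seq 0)) 0 = 0" unfolding \<omega>'(2)[of "T (unit_seq 0)"] by (intro sum.neutral) auto
    then show False by (simp add: inv one)
  qed
  have ext: "\<exists>s\<in>?I. \<exists>t\<in>?J. (\<forall>s'\<in>?I. \<epsilon> * \<nu> s' \<le> \<epsilon> * \<nu> s) \<and> (\<forall>t'\<in>?J. \<epsilon> * \<mu> t' \<le> \<epsilon> * \<mu> t) \<and> \<nu> s + \<mu> t = 0"
    if \<epsilon>: "\<epsilon> \<in> {1, -1}" and ne: "?I \<noteq> {}" "?J \<noteq> {}" for \<epsilon> :: int
  proof -
    obtain s where s: "s \<in> ?I" "\<forall>s'\<in>?I. \<epsilon> * \<nu> s' \<le> \<epsilon> * \<nu> s"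
      using ex_maximizer[OF _ ne(1), of "\<lambda>s. \<epsilon> * \<nu> s"] fin by auto
    obtain t where t: "t \<in> ?J" "\<forall>t'\<in>?J. \<epsilon> * \<mu> t' \<le> \<epsilon> * \<mu> t"
      using ex_maximizer[OF _ ne(2), of "\<lambda>t. \<epsilon> * \<mu> t"] fin by auto
    have "\<nu> s + \<mu> t = 0"
      by (rule extreme_bands_cancel[OF r T T' inv(1) _ _ _ _ _ _ \<epsilon>]) (use s t in simp_all)
    with s t show ?thesis by blast
  qed
  obtain s0 t0 where 0: "s0 \<in> ?I" "t0 \<in> ?J" "\<And>s. s \<in> ?I \<Longrightarrow> \<nu> s \<le> \<nu> s0"
      "\<And>t. t \<in> ?J \<Longrightarrow> \<mu> t \<le> \<mu> t0" "\<nu> s0 + \<mu> t0 = 0"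
    using ext[of 1, OF _ I_ne J_ne] by (simp only: insertI1 mult_1_left) blast
  obtain s1 t1 where 1: "s1 \<in> ?I" "t1 \<in> ?J" "\<And>s. s \<in> ?I \<Longrightarrow> \<nu> s1 \<le> \<nu> s"
      "\<And>t. t \<in> ?J \<Longrightarrow> \<mu> t1 \<le> \<mu> t" "\<nu> s1 + \<mu> t1 = 0"
    using ext[of "-1", OF _ I_ne J_ne]
    by (simp only: insertI1 insertI2 mult_minus_left mult_1_left neg_le_iff_le) blast
  \<comment> \<open>the two ends of the band of \<open>T\<close> coincide, and so do those of \<open>T'\<close>\<close>
  define M where "M = \<nu> s0"
  have "\<nu> s = M" if "s \<in> ?I" for s
    using 0(3)[OF that] 1(3)[OF that] 0(4)[OF 1(2)] 0(5) 1(5) 0(3)[OF 1(1)] unfolding M_def by linarith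
  then have I: "s = s0" if "s \<in> I" "h s \<noteq> 0" for s
    using that inj(1) 0(1) by (auto simp: inj_on_def)
  have "\<mu> t = - M" if "t \<in> ?J" for t
    using 0(4)[OF that] 1(4)[OF that] 0(5) 1(5) 0(3)[OF 1(1)] 0(4)[OF 1(2)] unfolding M_def by linarith
  then have J: "t = t0" if "t \<in> J" "g t \<noteq> 0" for t
    using that inj(2) 0(2) by (auto simp: inj_on_def)
  have \<mu>: "\<mu> t0 = - M" using 0(5) by (simp add: M_def)
  have I0: "h s = 0" if "s \<in> I" "s \<noteq> s0" for s using I that by blast
  have J0: "g t = 0" if "t \<in> J" "t \<noteq> t0" for t using J that by blast
  have Tf: "T f n = poly (h s0) (r \<up> n) * \<omega> s0 n * f (n - M)" for f n
  proof -
    have "T f n = (\<Sum>s\<in>I. if s = s0 then poly (h s0) (r \<up> n) * \<omega> s0 n * f (n - M) else 0)"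
      unfolding \<omega>(2) by (intro sum.cong) (auto simp: M_def I0)
    then show ?thesis using fin 0(1) by simp
  qed
  have T'f: "T' f n = poly (g t0) (r \<up> n) * \<omega>' t0 n * f (n + M)" for f n
  proof -
    have "T' f n = (\<Sum>t\<in>J. if t = t0 then poly (g t0) (r \<up> n) * \<omega>' t0 n * f (n + M) else 0)"
      unfolding \<omega>'(2) by (intro sum.cong) (auto simp: \<mu> J0)
    then show ?thesis using fin 0(2) by simp
  qed
  have prod: "poly (h s0) (r \<up> n) * \<omega> s0 n *
      (poly (g t0) (r \<up> (n - M)) * \<omega>' t0 (n - M)) = 1" for n
    using fun_cong[OF inv(1)[of "\<lambda>_. 1"], of n] by (simp add: Tf T'f)
  have "M = 0"
  proof (rule ccontr)
    assume "M \<noteq> 0"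
    then consider "M < 0" | "- M < 0" by linarith
    then show False
    proof cases
      case 1
      have "T (unit_seq 0) M = 0" by (rule ops_support[OF ops(1) _ 1]) (simp add: unit_seq_def)
      then show False using prod[of M] by (auto simp: Tf one)
    next
      case 2
      have "T' (unit_seq 0) (- M) = 0" by (rule ops_support[OF ops(2) _ 2]) (simp add: unit_seq_def)
      then show False using prod[of 0] by (auto simp: T'f one)
    qed
  qed
  then show "h s = 0" if "s \<in> I" "\<nu> s \<noteq> 0" for s using I[OF that(1)] that(2) by (auto simp: M_def)
  \<comment> \<open>the diagonal entries of \<open>T\<close> and \<open>T'\<close> are inverse to each other; let \<open>r\<^sup>n\<close> tend to \<open>0\<close>\<close>
  have lim: "(\<lambda>n. cmod (poly f (complex_of_real r ^ n))) \<longlonglongrightarrow> cmod (poly f 0)" for f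
    using r by (intro tendsto_norm tendsto_poly LIMSEQ_power_zero) simp
  have "cmod (poly (h s0) (complex_of_real r ^ n)) * cmod (poly (g t0) (complex_of_real r ^ n)) = 1" for n
    using arg_cong[OF prod[of "int n"], of cmod] \<omega>(1) \<omega>'(1) \<open>M = 0\<close> by (simp add: norm_mult)
  then have "cmod (poly (h s0) 0) * cmod (poly (g t0) 0) = 1"
    using tendsto_mult[OF lim[of "h s0"] lim[of "g t0"]] by (simp add: LIMSEQ_const_iff)
  then have "poly (h s0) 0 \<noteq> 0" by auto
  then show "\<exists>s\<in>I. \<nu> s = 0 \<and> poly (h s) 0 \<noteq> 0" using 0(1) \<open>M = 0\<close> by (auto simp: M_def)
qed

section \<open>The quantum sphere has no invertible elements of degree \<open>k l\<close>\<close>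

context quantum_sphere
begin

text \<open>Since \<open>k\<close> and \<open>l\<close> are coprime, the bidegrees \<open>(i, j)\<close> with \<open>k i + l j = c k l\<close> are the
  pairs \<open>(l s, k (c - s))\<close>.\<close>

lemma homog_multiple:
  fixes c :: int
  assumes v: "v \<in> homog (c * int (k * l))"
  obtains I F where "finite I" "\<And>s. F s \<in> pol"
    "v = (\<Oplus>\<^bsub>S\<^esub>s\<in>I. F s \<otimes>\<^bsub>S\<^esub> zpow a (int l * s) \<otimes>\<^bsub>S\<^esub> zpow b (int k * (c - s)))"
proof -
  let ?M = "\<lambda>s. bihom (int l * s, int k * (c - s))"
  have "v \<in> graded_sums S ?M"
    using v unfolding homog_def
  proof (induction rule: graded_sums.induct)
    case zero
    show ?case by (rule graded_sums.zero)
  next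
    case (add x y)
    show ?case by (rule graded_sums.add[OF add.IH])
  next
    case (incl x ij)
    then have x: "x \<in> bihom ij" and d: "deg ij = c * int (k * l)" by (auto split: if_splits)
    obtain i j where ij: "ij = (i, j)" by (cases ij)
    have eq: "int k * i + int l * j = c * (int k * int l)" using d by (simp add: ij deg_def)
    then have "int k * i = int l * (c * int k - j)" by (simp add: algebra_simps)
    then have "int l dvd int k * i" by simp
    moreover have "coprime (int l) (int k)" using kl(3) by (simp add: coprime_commute)
    ultimately have "int l dvd i" by (simp add: coprime_dvd_mult_right_iff)
    then obtain s where s: "i = int l * s" ..
    have "int l * j = int l * (int k * (c - s))" using eq by (simp add: s algebra_simps)
    then have "j = int k * (c - s)" using kl(2) by simp
    then have "x \<in> ?M s" using x by (simp add: ij s)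
    then show ?case by (rule graded_sums.incl)
  qed
  then obtain I f where If: "finite I" "\<And>s. f s \<in> ?M s" "v = finsum S f I"
    by (rule graded_sums_eq_finsum[of S ?M v, rotated 4])
      (rule that is_abelian_group bihom_closed bihom_zero bihom_add; assumption?)+
  have "\<forall>s. \<exists>P. P \<in> pol \<and> f s = P \<otimes>\<^bsub>S\<^esub> zpow a (int l * s) \<otimes>\<^bsub>S\<^esub> zpow b (int k * (c - s))"
    using If(2) unfolding bihom_def prod.case by blast
  then obtain F where F: "\<And>s. F s \<in> pol"
    "\<And>s. f s = F s \<otimes>\<^bsub>S\<^esub> zpow a (int l * s) \<otimes>\<^bsub>S\<^esub> zpow b (int k * (c - s))"
    by metis
  have "v = (\<Oplus>\<^bsub>S\<^esub>s\<in>I. F s \<otimes>\<^bsub>S\<^esub> zpow a (int l * s) \<otimes>\<^bsub>S\<^esub> zpow b (int k * (c - s)))"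
    by (simp only: If(3) F(2)[symmetric])
  then show thesis by (rule that[OF If(1) F(1)])
qed

text \<open>The first representation factors through the quotient by \<open>A\<close>, in which \<open>a\<close> is unitary, the
  second one through the quotient by \<open>B\<close>.\<close>

definition rep1 :: "s3_gen sterm set \<Rightarrow> (seq \<Rightarrow> seq) \<times> (seq \<Rightarrow> seq)" where
  "rep1 = pres_map op_alg (case_s3_gen (rotation \<theta>) (shift q))"

definition rep2 :: "s3_gen sterm set \<Rightarrow> (seq \<Rightarrow> seq) \<times> (seq \<Rightarrow> seq)" where
  "rep2 = pres_map op_alg (case_s3_gen (shift p) (rotation (- \<theta>)))"

lemma rep1: "rep1 \<in> star_alg_hom S op_alg" "rep1 a = rotation \<theta>" "rep1 b = shift q"
  unfolding rep1_def by (rule s3_hom[OF rotation_shift_pair[OF params(3)]])+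

lemma rep2: "rep2 \<in> star_alg_hom S op_alg" "rep2 a = shift p" "rep2 b = rotation (- \<theta>)"
proof -
  have "sphere_pair op_alg (shift p) (rotation (- \<theta>)) p q (- (- \<theta>))"
    by (rule sphere_pair.swap[OF rotation_shift_pair[OF params(1)]])
  then have pair: "sphere_pair op_alg (shift p) (rotation (- \<theta>)) p q \<theta>" by simp
  show "rep2 \<in> star_alg_hom S op_alg" "rep2 a = shift p" "rep2 b = rotation (- \<theta>)"
    unfolding rep2_def by (rule s3_hom[OF pair])+
qed

text \<open>A polynomial in \<open>A\<close> and \<open>B\<close> becomes one in \<open>B\<close> where \<open>A = 0\<close> and one in
  \<open>A\<close> where \<open>B = 0\<close>. The two have the same constant term; this is all that connects the
  two representations.\<close>

definition acts_by :: "s3_gen sterm set \<Rightarrow> complex poly \<Rightarrow> complex poly \<Rightarrow> bool" where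
  "acts_by P P1 P2 \<longleftrightarrow> poly P1 0 = poly P2 0 \<and>
    (\<forall>f n. fst (rep1 P) f n = poly P1 (q \<up> n) * f n) \<and>
    (\<forall>f n. fst (rep2 P) f n = poly P2 (p \<up> n) * f n)"

lemma pol_acts_by:
  assumes "P \<in> pol"
  shows "\<exists>P1 P2. acts_by P P1 P2"
  using assms
proof induction
  case one
  have "acts_by \<one>\<^bsub>S\<^esub> 1 1"
    by (simp add: acts_by_def star_alg_hom_one[OF rep1(1)] star_alg_hom_one[OF rep2(1)])
  then show ?case by blast
next
  case A
  have "acts_by (defect a) 0 [:0, 1:]"
    by (simp add: acts_by_def star_alg_hom_defect[OF star_algebra_axioms op_alg_star_algebra] rep1 rep2
        defect_rotation defect_shift)
  then show ?case by blast
next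
  case B
  have "acts_by (defect b) [:0, 1:] 0"
    by (simp add: acts_by_def star_alg_hom_defect[OF star_algebra_axioms op_alg_star_algebra] rep1 rep2
        defect_rotation defect_shift)
  then show ?case by blast
next
  case (add x y)
  then obtain P1 P2 Q1 Q2 where "acts_by x P1 P2" "acts_by y Q1 Q2" by blast
  with add.hyps have "acts_by (x \<oplus>\<^bsub>S\<^esub> y) (P1 + Q1) (P2 + Q2)"
    by (simp add: acts_by_def star_alg_hom_add[OF rep1(1)] star_alg_hom_add[OF rep2(1)] ring_distribs)
  then show ?case by blast
next
  case (mult x y)
  then obtain P1 P2 Q1 Q2 where "acts_by x P1 P2" "acts_by y Q1 Q2" by blast
  with mult.hyps have "acts_by (x \<otimes>\<^bsub>S\<^esub> y) (P1 * Q1) (P2 * Q2)"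
    by (simp add: acts_by_def star_alg_hom_mult[OF rep1(1)] star_alg_hom_mult[OF rep2(1)])
  then show ?case by blast
next
  case (smult x c)
  then obtain P1 P2 where "acts_by x P1 P2" by blast
  with smult.hyps have "acts_by (c \<odot>\<^bsub>S\<^esub> x) (Polynomial.smult c P1) (Polynomial.smult c P2)"
    by (simp add: acts_by_def star_alg_hom_smult[OF rep1(1)] star_alg_hom_smult[OF rep2(1)])
  then show ?case by blast
qed

text \<open>The two representations of an element of degree \<open>c k l\<close> are band operators, whose diagonals
  are indexed by the same set in opposite directions and have the same constant terms.\<close>

lemma homog_band_ops:
  fixes c :: int
  assumes v: "v \<in> homog (c * int (k * l))"
  obtains I h1 h2 where "band_op q I h1 (\<lambda>s. int k * (c - s)) (fst (rep1 v))"
    "band_op p I h2 (\<lambda>s. int l * s) (fst (rep2 v))" "\<And>s. poly (h1 s) 0 = poly (h2 s) 0"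
proof -
  obtain I F where I: "finite I" and F: "\<And>s. F s \<in> pol"
    and v_eq: "v = (\<Oplus>\<^bsub>S\<^esub>s\<in>I. F s \<otimes>\<^bsub>S\<^esub> zpow a (int l * s) \<otimes>\<^bsub>S\<^esub> zpow b (int k * (c - s)))"
    by (rule homog_multiple[OF v]) (rule that)
  have Fc: "F s \<in> carrier S" for s using F by simp
  from choice[OF allI[OF pol_acts_by[OF F]]] obtain P1 where P1: "\<forall>s. \<exists>P2. acts_by (F s) (P1 s) P2" ..
  from choice[OF P1] obtain P2 where P2: "\<forall>s. acts_by (F s) (P1 s) (P2 s)" ..
  have P: "poly (P1 s) 0 = poly (P2 s) 0"
    "fst (rep1 (F s)) f n = poly (P1 s) (q \<up> n) * f n"
    "fst (rep2 (F s)) f n = poly (P2 s) (p \<up> n) * f n" for s f n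
    using P2 unfolding acts_by_def by blast+
  from choice[OF allI[OF fst_zpow_shift[OF params(3)]]] obtain Q where Q': "\<forall>j. poly (Q j) 0 = 1 \<and>
      (\<forall>f n. fst (op_alg.zpow (shift q) j) f n = poly (Q j) (q \<up> n) * f (n - j))" ..
  have Q: "poly (Q j) 0 = 1"
    "fst (op_alg.zpow (shift q) j) f n = poly (Q j) (q \<up> n) * f (n - j)" for j f n
    using Q' by blast+
  from choice[OF allI[OF fst_zpow_shift[OF params(1)]]] obtain R where R': "\<forall>j. poly (R j) 0 = 1 \<and>
      (\<forall>f n. fst (op_alg.zpow (shift p) j) f n = poly (R j) (p \<up> n) * f (n - j))" ..
  have R: "poly (R j) 0 = 1"
    "fst (op_alg.zpow (shift p) j) f n = poly (R j) (p \<up> n) * f (n - j)" for j f n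
    using R' by blast+
  let ?t = "\<lambda>s. F s \<otimes>\<^bsub>S\<^esub> zpow a (int l * s) \<otimes>\<^bsub>S\<^esub> zpow b (int k * (c - s))"
  have closed: "rep1 x \<in> carrier op_alg" "rep2 x \<in> carrier op_alg" if "x \<in> carrier S" for x
    using that by (rule star_alg_hom_closed[OF rep1(1)], rule star_alg_hom_closed[OF rep2(1)])
  have sum: "fst (rep1 v) f n = (\<Sum>s\<in>I. fst (rep1 (?t s)) f n)" "fst (rep2 v) f n = (\<Sum>s\<in>I. fst (rep2 (?t s)) f n)" for f n
  proof -
    have "rep1 v = finsum op_alg (\<lambda>s. rep1 (?t s)) I" "rep2 v = finsum op_alg (\<lambda>s. rep2 (?t s)) I"
      unfolding v_eq using Fc
      by (intro star_alg_hom_finsum[OF star_algebra_axioms op_alg_star_algebra _ I] rep1 rep2; simp)+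
    then show "fst (rep1 v) f n = (\<Sum>s\<in>I. fst (rep1 (?t s)) f n)" "fst (rep2 v) f n = (\<Sum>s\<in>I. fst (rep2 (?t s)) f n)"
      using Fc by (simp_all only:) (rule fst_op_finsum[OF I]; intro closed; simp)+
  qed
  have term1: "fst (rep1 (?t s)) f n = poly (P1 s * Q (int k * (c - s))) (q \<up> n) *
      cis (2 * pi * \<theta> * (int l * s) * n) * f (n - int k * (c - s))" for s f n
    using Fc
    by (simp add: star_alg_hom_mult[OF rep1(1)] P(2) Q(2) rep1(2,3) fst_zpow_rotation
        star_alg_hom_zpow[OF star_algebra_axioms op_alg_star_algebra rep1(1)])
  have term2: "fst (rep2 (?t s)) f n = poly (P2 s * R (int l * s)) (p \<up> n) *
      cis (2 * pi * (- \<theta>) * (int k * (c - s)) * (n - int l * s)) * f (n - int l * s)" for s f n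
    using Fc
    by (simp add: star_alg_hom_mult[OF rep2(1)] P(3) R(2) rep2(2,3) fst_zpow_rotation
        star_alg_hom_zpow[OF star_algebra_axioms op_alg_star_algebra rep2(1)])
  have "v \<in> carrier S" using v by (rule homog_closed)
  then have ops: "fst (rep1 v) \<in> ops" "fst (rep2 v) \<in> ops" using closed[of v] by auto
  show thesis
  proof (rule that)
    show "band_op q I (\<lambda>s. P1 s * Q (int k * (c - s))) (\<lambda>s. int k * (c - s)) (fst (rep1 v))"
      unfolding band_op_def
    proof (intro conjI)
      show "\<exists>\<omega>. (\<forall>s n. cmod (\<omega> s n) = 1) \<and> (\<forall>f n. fst (rep1 v) f n =
          (\<Sum>s\<in>I. poly (P1 s * Q (int k * (c - s))) (q \<up> n) * \<omega> s n * f (n - int k * (c - s))))"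
        by (rule exI[of _ "\<lambda>(s::int) (n::int). cis (2 * pi * \<theta> * (int l * s) * n)"])
          (simp only: sum term1 norm_cis simp_thms)
    qed (use I ops kl in \<open>auto simp: inj_on_def\<close>)
    show "band_op p I (\<lambda>s. P2 s * R (int l * s)) (\<lambda>s. int l * s) (fst (rep2 v))"
      unfolding band_op_def
    proof (intro conjI)
      show "\<exists>\<omega>. (\<forall>s n. cmod (\<omega> s n) = 1) \<and> (\<forall>f n. fst (rep2 v) f n =
          (\<Sum>s\<in>I. poly (P2 s * R (int l * s)) (p \<up> n) * \<omega> s n * f (n - int l * s)))"
        by (rule exI[of _ "\<lambda>(s::int) (n::int). cis (2 * pi * (- \<theta>) * (int k * (c - s)) * (n - int l * s))"])
          (simp only: sum term2 norm_cis simp_thms)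
    qed (use I ops kl in \<open>auto simp: inj_on_def\<close>)
  qed (simp add: P(1) Q(1) R(1))
qed

text \<open>For an invertible element of degree \<open>k l\<close>, the first representation leaves only the diagonal
  \<open>s = 1\<close>, which stands for \<open>a\<^sup>l\<close>, with a nonzero constant term; the second one
  leaves only \<open>s = 0\<close>, which stands for \<open>b\<^sup>k\<close>.\<close>

lemma no_unit_of_degree_kl:
  assumes v: "v \<in> homog (int (k * l))" and w: "w \<in> homog (- int (k * l))"
    and inv: "v \<otimes>\<^bsub>S\<^esub> w = \<one>\<^bsub>S\<^esub>" "w \<otimes>\<^bsub>S\<^esub> v = \<one>\<^bsub>S\<^esub>"
  shows False
proof -
  have v1: "v \<in> homog (1 * int (k * l))" and w1: "w \<in> homog (- 1 * int (k * l))" using v w by simp_all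
  obtain I h1 h2 where v_ops: "band_op q I h1 (\<lambda>s. int k * (1 - s)) (fst (rep1 v))"
    "band_op p I h2 (\<lambda>s. int l * s) (fst (rep2 v))" and const: "\<And>s. poly (h1 s) 0 = poly (h2 s) 0"
    by (rule homog_band_ops[OF v1]) (rule that)
  obtain J g1 g2 where w_ops: "band_op q J g1 (\<lambda>s. int k * (- 1 - s)) (fst (rep1 w))"
    "band_op p J g2 (\<lambda>s. int l * s) (fst (rep2 w))"
    by (rule homog_band_ops[OF w1]) (rule that)
  have c: "v \<in> carrier S" "w \<in> carrier S" using v w homog_closed by auto
  have "rep1 v \<otimes>\<^bsub>op_alg\<^esub> rep1 w = \<one>\<^bsub>op_alg\<^esub>" "rep1 w \<otimes>\<^bsub>op_alg\<^esub> rep1 v = \<one>\<^bsub>op_alg\<^esub>"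
    "rep2 v \<otimes>\<^bsub>op_alg\<^esub> rep2 w = \<one>\<^bsub>op_alg\<^esub>" "rep2 w \<otimes>\<^bsub>op_alg\<^esub> rep2 v = \<one>\<^bsub>op_alg\<^esub>"
    using c inv star_alg_hom_one[OF rep1(1)] star_alg_hom_one[OF rep2(1)]
    by (simp_all only: star_alg_hom_mult[OF rep1(1), symmetric] star_alg_hom_mult[OF rep2(1), symmetric])
  then have "fst (rep1 v) (fst (rep1 w) f) = f" "fst (rep1 w) (fst (rep1 v) f) = f"
    "fst (rep2 v) (fst (rep2 w) f) = f" "fst (rep2 w) (fst (rep2 v) f) = f" for f
    by (simp_all add: fun_eq_iff)
  note 1 = invertible_band_op[OF params(3,4) v_ops(1) w_ops(1) this(1,2)]
    and 2 = invertible_band_op[OF params(1,2) v_ops(2) w_ops(2) this(3,4)]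
  obtain s where s: "s \<in> I" "int k * (1 - s) = 0" "poly (h1 s) 0 \<noteq> 0" using 1(2) by blast
  then have "int l * s \<noteq> 0" using kl by simp
  then have "h2 s = 0" by (rule 2(1)[OF s(1)])
  then show False using s(3) const[of s] by simp
qed

lemma not_cleft: "\<not> cleft circle_hopf \<A> (rho p q \<theta> k l)"
proof
  assume "cleft circle_hopf \<A> (rho p q \<theta> k l)"
  then obtain v w where vw': "v \<in> carrier \<A>" "w \<in> carrier \<A>" "v \<otimes>\<^bsub>\<A>\<^esub> w = \<one>\<^bsub>\<A>\<^esub>" "w \<otimes>\<^bsub>\<A>\<^esub> v = \<one>\<^bsub>\<A>\<^esub>"
    and rho_v: "rho p q \<theta> k l v = tensor_elem \<A> circle_alg v circle_u"
    by (rule cleft_circle_unit[OF \<A>.star_algebra_axioms]) (rule that)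
  note vw = vw'[unfolded \<A>_simps]
  have c: "v \<in> carrier S" "w \<in> carrier S" using vw by (simp_all add: \<A>_carrier)
  have gv: "gauge s v = cis (real (k * l) * s) \<odot>\<^bsub>S\<^esub> v" for s
    by (rule gauge_if_rho[OF vw(1) rho_v])
  have gw: "gauge s w = cis (- (real (k * l) * s)) \<odot>\<^bsub>S\<^esub> w" for s
  proof -
    let ?t = "real (k * l) * s"
    have gc: "gauge s w \<in> carrier S" by (rule star_alg_hom_closed[OF gauge(1) c(2)])
    have "gauge s v \<otimes>\<^bsub>S\<^esub> gauge s w = \<one>\<^bsub>S\<^esub>"
      using c vw(3) star_alg_hom_one[OF gauge(1)] star_alg_hom_mult[OF gauge(1), of v w s] by simp
    then have "cis ?t \<odot>\<^bsub>S\<^esub> (v \<otimes>\<^bsub>S\<^esub> gauge s w) = \<one>\<^bsub>S\<^esub>"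
      using c gc by (simp only: gv smult_mult_left)
    then have "cis ?t \<odot>\<^bsub>S\<^esub> (w \<otimes>\<^bsub>S\<^esub> (v \<otimes>\<^bsub>S\<^esub> gauge s w)) = w"
      using c gc by (simp add: smult_mult_right[symmetric] del: of_nat_mult)
    then have "cis ?t \<odot>\<^bsub>S\<^esub> gauge s w = w"
      using c gc vw(4) by (simp add: m_assoc[symmetric] del: of_nat_mult)
    then have "cis (- ?t) \<odot>\<^bsub>S\<^esub> (cis ?t \<odot>\<^bsub>S\<^esub> gauge s w) = cis (- ?t) \<odot>\<^bsub>S\<^esub> w" by simp
    then show ?thesis using gc by (simp add: smult_smult cis_mult del: of_nat_mult)
  qed
  show False
  proof (rule no_unit_of_degree_kl[OF _ _ vw(3,4)])
    show "v \<in> homog (int (k * l))"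
      using gv by (intro homog_if_gauge[OF c(1)]) (simp only: of_int_of_nat_eq)
    show "w \<in> homog (- int (k * l))"
      using gw by (intro homog_if_gauge[OF c(2)]) (simp only: of_int_of_nat_eq of_int_minus mult_minus_left)
  qed
qed

end

theorem proposition3p2:
  fixes p q \<theta> :: real and k l :: nat
  assumes "0 < p" "p < 1" "0 < q" "q < 1" "0 < \<theta>" "\<theta> < 1" "\<theta> \<notin> \<rat>"
    and "0 < k" "0 < l" "coprime k l"
  shows "\<not> cleft circle_hopf (A_alg p q \<theta> k l) (rho p q \<theta> k l)"
proof -
  interpret quantum_sphere p q \<theta> k l
    using assms by (intro quantum_sphere.intro)
  show ?thesis by (rule not_cleft)
qed

end
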